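(* Let $(I,<)$ be a well-ordered set and let $S$ be a free pro-$2$ group on generators $x_i$, $i\in I$. Let $\mathcal{R}$ be a set of elements of $S_{(2)}$. Assume there exist $r\in\mathcal{R}$ and distinct indices $i,j,k\in I$ with $i<j$, $k<j$ such that: (i) in the canonical decomposition modulo $S_{(4)}$ of $r$, $a_k=a_j=u_{ij}=u_{kj}=u_{ki}=u_{kl}=u_{jl}=0$ for all $l\neq i,j,k$, and $c_{ijk}\neq 0$; and (ii) for every $s\in\mathcal{R}$ different from $r$, the factors $[x_k,x_i]$, $[x_i,x_k]$ and $[x_i,x_j]$ do not occur in the canonical decomposition modulo $S_{(4)}$ of $s$ (i.e. the corresponding exponent is $0$). Then $G=S/\langle\mathcal{R}\rangle$ is not isomorphic to $G_F(2)$ for any field $F$.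
   Context: $[x,y]=x^{-1}y^{-1}xy$. The $2$-Zassenhaus filtration of a pro-$2$ group $S$ is defined by $S_{(1)}=S$, $S_{(n)}=S_{(\lceil n/2\rceil)}^2\prod_{i+j=n}[S_{(i)},S_{(j)}]$ (closed subgroups generated). Every $r\in S_{(2)}$ can be written uniquely as $r=\prod_{i\in I}x_i^{2a_i}\prod_{i<j}[x_i,x_j]^{b_{ij}}\prod_{i<j,\,k\le j}[[x_i,x_j],x_k]^{c_{ijk}}\cdot r'$ with $a_i,b_{ij},c_{ijk}\in\{0,1\}$ and $r'\in S_{(4)}$ (products taken in a fixed order); this is the canonical decomposition modulo $S_{(4)}$ of $r$. Set $u_{ij}=b_{ij}$ if $i<j$ and $u_{ij}=b_{ji}$ if $j<i$. $\langle\mathcal{R}\rangle$ is the closed normal subgroup of $S$ generated by $\mathcal{R}$. $G_F(2)$ is the maximal pro-$2$ quotient of the absolute Galois group of $F$. *)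

theory Defs
  imports
    "HOL-Analysis.Analysis"
    "HOL-Algebra.Algebra"
    "HOL-Algebra.Algebraic_Closure_Type"
begin

section \<open>Topological groups\<close>

record 'a tgroup = "'a monoid" +
  tg_top :: "'a topology"

definition topological_group :: "'a tgroup \<Rightarrow> bool" where
  "topological_group G \<longleftrightarrow>
     group G \<and> topspace (tg_top G) = carrier G \<and>
     continuous_map (prod_topology (tg_top G) (tg_top G)) (tg_top G) (\<lambda>(x, y). x \<otimes>\<^bsub>G\<^esub> y) \<and>
     continuous_map (tg_top G) (tg_top G) (\<lambda>x. inv\<^bsub>G\<^esub> x)"

definition tgroup_hom :: "'a tgroup \<Rightarrow> 'b tgroup \<Rightarrow> ('a \<Rightarrow> 'b) set" where
  "tgroup_hom G H = {h \<in> hom G H. continuous_map (tg_top G) (tg_top H) h}"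

definition tgroup_isomorphic :: "'a tgroup \<Rightarrow> 'b tgroup \<Rightarrow> bool" where
  "tgroup_isomorphic G H \<longleftrightarrow> (\<exists>h \<in> iso G H. homeomorphic_map (tg_top G) (tg_top H) h)"

definition quotient_top :: "'a tgroup \<Rightarrow> 'a set \<Rightarrow> 'a set topology" where
  "quotient_top G N =
     topology (\<lambda>U. U \<subseteq> carrier (G Mod N) \<and> openin (tg_top G) {g \<in> topspace (tg_top G). N #>\<^bsub>G\<^esub> g \<in> U})"

lemma openin_quotient_top:
  "openin (quotient_top G N) U \<longleftrightarrow>
     U \<subseteq> carrier (G Mod N) \<and> openin (tg_top G) {g \<in> topspace (tg_top G). N #>\<^bsub>G\<^esub> g \<in> U}"
proof -
  let ?pre = "\<lambda>U. {g \<in> topspace (tg_top G). N #>\<^bsub>G\<^esub> g \<in> U}"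
  have int: "?pre (A \<inter> B) = ?pre A \<inter> ?pre B" for A B by blast
  have un: "?pre (\<Union>\<K>) = \<Union>(?pre ` \<K>)" for \<K> by blast
  have "istopology (\<lambda>U. U \<subseteq> carrier (G Mod N) \<and> openin (tg_top G) (?pre U))"
    unfolding istopology_def int un by (auto intro!: openin_Union)
  then show ?thesis
    by (simp add: quotient_top_def topology_inverse')
qed

definition quotient_tgroup :: "'a tgroup \<Rightarrow> 'a set \<Rightarrow> 'a set tgroup" where
  "quotient_tgroup G N =
     \<lparr>carrier = carrier (G Mod N), mult = mult (G Mod N), one = one (G Mod N),
      tg_top = quotient_top G N\<rparr>"

definition closed_subgroup_generated :: "'a tgroup \<Rightarrow> 'a set \<Rightarrow> 'a set" where
  "closed_subgroup_generated G A = \<Inter>{H. subgroup H G \<and> closedin (tg_top G) H \<and> A \<subseteq> H}"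

definition closed_normal_subgroup_generated :: "'a tgroup \<Rightarrow> 'a set \<Rightarrow> 'a set" where
  "closed_normal_subgroup_generated G A = \<Inter>{N. N \<lhd> G \<and> closedin (tg_top G) N \<and> A \<subseteq> N}"


section \<open>Pro-$p$ groups\<close>

definition profinite_group :: "'a tgroup \<Rightarrow> bool" where
  "profinite_group G \<longleftrightarrow>
     topological_group G \<and> compact_space (tg_top G) \<and> Hausdorff_space (tg_top G) \<and>
     (\<forall>U. openin (tg_top G) U \<and> \<one>\<^bsub>G\<^esub> \<in> U \<longrightarrow>
        (\<exists>H. subgroup H G \<and> openin (tg_top G) H \<and> H \<subseteq> U))"

definition p_power_open_normal :: "nat \<Rightarrow> 'a tgroup \<Rightarrow> 'a set set" where
  "p_power_open_normal p G =
     {N. N \<lhd> G \<and> openin (tg_top G) N \<and> (\<exists>n. order (G Mod N) = p ^ n)}"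

definition pro_p_group :: "nat \<Rightarrow> 'a tgroup \<Rightarrow> bool" where
  "pro_p_group p G \<longleftrightarrow>
     profinite_group G \<and> (\<forall>N. N \<lhd> G \<and> openin (tg_top G) N \<longrightarrow> (\<exists>n. order (G Mod N) = p ^ n))"

definition max_pro_p_quotient :: "nat \<Rightarrow> 'a tgroup \<Rightarrow> 'a set tgroup" where
  "max_pro_p_quotient p G = quotient_tgroup G (\<Inter>(p_power_open_normal p G))"

definition converges_to_one :: "'a tgroup \<Rightarrow> ('i \<Rightarrow> 'a) \<Rightarrow> bool" where
  "converges_to_one G x \<longleftrightarrow>
     range x \<subseteq> carrier G \<and>
     (\<forall>U. openin (tg_top G) U \<and> \<one>\<^bsub>G\<^esub> \<in> U \<longrightarrow> finite {i. x i \<notin> U})"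

text \<open>
  The universal property is required for pro-\<open>p\<close> groups \<open>H\<close> on the type \<open>('i \<times> nat) set\<close>.  This is
  the universal property for all pro-\<open>p\<close> groups: the closed subgroup generated by a family
  indexed by \<open>'i\<close> and converging to 1 has at most \<open>max |'i| \<aleph>\<^sub>0\<close> open normal
  subgroups, hence at most \<open>2 ^ max |'i| \<aleph>\<^sub>0\<close> elements, so it has an isomorphic copy on this type.
\<close>
definition free_pro_p_group :: "nat \<Rightarrow> 'a tgroup \<Rightarrow> ('i \<Rightarrow> 'a) \<Rightarrow> bool" where
  "free_pro_p_group p S x \<longleftrightarrow>
     pro_p_group p S \<and> converges_to_one S x \<and>
     closed_subgroup_generated S (range x) = carrier S \<and>
     (\<forall>(H :: ('i \<times> nat) set tgroup) y. pro_p_group p H \<and> converges_to_one H y \<longrightarrow>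
        (\<exists>!h. h \<in> tgroup_hom S H \<and> h \<in> extensional (carrier S) \<and> (\<forall>i. h (x i) = y i)))"


section \<open>The 2-Zassenhaus filtration and canonical decompositions\<close>

definition commutator :: "('a, 'm) monoid_scheme \<Rightarrow> 'a \<Rightarrow> 'a \<Rightarrow> 'a" where
  "commutator G x y = inv\<^bsub>G\<^esub> x \<otimes>\<^bsub>G\<^esub> inv\<^bsub>G\<^esub> y \<otimes>\<^bsub>G\<^esub> x \<otimes>\<^bsub>G\<^esub> y"

text \<open>\<open>(n + 1) div 2\<close> is the ceiling of \<open>n / 2\<close>; the value at \<open>0\<close> is a dummy.\<close>
function zassenhaus2 :: "'a tgroup \<Rightarrow> nat \<Rightarrow> 'a set" where
  "zassenhaus2 S n =
     (if n \<le> 1 then carrier S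
      else closed_subgroup_generated S
        ((\<lambda>g. g [^]\<^bsub>S\<^esub> (2::nat)) ` zassenhaus2 S ((n + 1) div 2) \<union>
         (\<Union>i\<in>{1..<n}. {commutator S g h | g h. g \<in> zassenhaus2 S i \<and> h \<in> zassenhaus2 S (n - i)})))"
  by pat_completeness auto
termination
  by (relation "Wellfounded.measure snd") auto

declare zassenhaus2.simps [simp del]

text \<open>\<open>r\<close> is a strict linear order; the factors are multiplied in increasing order.\<close>
definition ordered_prod :: "('a, 'm) monoid_scheme \<Rightarrow> 'j rel \<Rightarrow> ('j \<Rightarrow> 'a) \<Rightarrow> 'j set \<Rightarrow> 'a" where
  "ordered_prod S r f A =
     foldr (\<lambda>j g. f j \<otimes>\<^bsub>S\<^esub> g) (THE js. sorted_wrt (\<lambda>j k. (j, k) \<in> r) js \<and> set js = A) \<one>\<^bsub>S\<^esub>"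

definition has_ordered_prod :: "'a tgroup \<Rightarrow> 'j rel \<Rightarrow> ('j \<Rightarrow> 'a) \<Rightarrow> 'j set \<Rightarrow> 'a \<Rightarrow> bool" where
  "has_ordered_prod S r f J g \<longleftrightarrow>
     limitin (tg_top S) (ordered_prod S r f) g (finite_subsets_at_top J)"

abbreviation less_rel :: "'i::linorder rel" where
  "less_rel \<equiv> {(i, j). i < j}"

text \<open>
  Only the values \<open>b i j\<close> with \<open>i < j\<close> and \<open>c i j k\<close> with \<open>i < j\<close>, \<open>k \<le> j\<close> are meaningful.
  Pairs and triples of indices are ordered lexicographically.  If the index type is infinite, then
  the three products are limits of the products over finite sets of indices.
\<close>
definition canonical_decomposition ::
  "'a tgroup \<Rightarrow> ('i::wellorder \<Rightarrow> 'a) \<Rightarrow> 'a \<Rightarrow>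
     ('i \<Rightarrow> nat) \<Rightarrow> ('i \<Rightarrow> 'i \<Rightarrow> nat) \<Rightarrow> ('i \<Rightarrow> 'i \<Rightarrow> 'i \<Rightarrow> nat) \<Rightarrow> bool" where
  "canonical_decomposition S x s a b c \<longleftrightarrow>
     (\<forall>i. a i \<in> {0, 1}) \<and>
     (\<forall>i j. i < j \<longrightarrow> b i j \<in> {0, 1}) \<and>
     (\<forall>i j k. i < j \<and> k \<le> j \<longrightarrow> c i j k \<in> {0, 1}) \<and>
     (\<exists>g1 g2 g3 s'.
        has_ordered_prod S less_rel (\<lambda>i. x i [^]\<^bsub>S\<^esub> (2 * a i)) UNIV g1 \<and>
        has_ordered_prod S (less_rel <*lex*> less_rel)
          (\<lambda>(i, j). commutator S (x i) (x j) [^]\<^bsub>S\<^esub> b i j) {(i, j). i < j} g2 \<and>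
        has_ordered_prod S (less_rel <*lex*> less_rel <*lex*> less_rel)
          (\<lambda>(i, j, k). commutator S (commutator S (x i) (x j)) (x k) [^]\<^bsub>S\<^esub> c i j k)
          {(i, j, k). i < j \<and> k \<le> j} g3 \<and>
        s' \<in> zassenhaus2 S 4 \<and>
        s = g1 \<otimes>\<^bsub>S\<^esub> g2 \<otimes>\<^bsub>S\<^esub> g3 \<otimes>\<^bsub>S\<^esub> s')"

definition sym_exponent :: "('i::linorder \<Rightarrow> 'i \<Rightarrow> nat) \<Rightarrow> 'i \<Rightarrow> 'i \<Rightarrow> nat" where
  "sym_exponent b i j = (if i < j then b i j else b j i)"


section \<open>Absolute Galois groups\<close>

definition separable_closure :: "'f::field alg_closure set" where
  "separable_closure =
     {z. \<exists>p :: 'f poly. Factorial_Ring.irreducible p \<and> rsquarefree (map_poly to_ac p) \<and> poly (map_poly to_ac p) z = 0}"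

definition galois_carrier :: "('f::field alg_closure \<Rightarrow> 'f alg_closure) set" where
  "galois_carrier =
     {\<sigma> \<in> Bij separable_closure.
        (\<forall>y\<in>separable_closure. \<forall>z\<in>separable_closure.
           \<sigma> (y + z) = \<sigma> y + \<sigma> z \<and> \<sigma> (y * z) = \<sigma> y * \<sigma> z) \<and>
        (\<forall>t :: 'f. \<sigma> (to_ac t) = to_ac t)}"

text \<open>
  The Krull topology is the topology of pointwise convergence on the discrete separable closure: the
  automorphisms agreeing with \<open>\<sigma>\<close> on a finite set \<open>A\<close> form the coset of \<open>\<sigma>\<close> modulo the subgroup
  fixing the finite extension generated by \<open>A\<close>.
\<close>
definition absolute_galois_group ::
  "'f::field itself \<Rightarrow> ('f alg_closure \<Rightarrow> 'f alg_closure) tgroup" where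
  "absolute_galois_group F =
     \<lparr>carrier = galois_carrier,
      mult = mult (BijGroup separable_closure),
      one = one (BijGroup separable_closure),
      tg_top = subtopology
        (product_topology (\<lambda>_. discrete_topology separable_closure) separable_closure) galois_carrier\<rparr>"

end

theory Submission
  imports Defs "HOL-Library.Z2"
begin

text \<open>
  Suppose that \<open>G = S/\<langle>R\<rangle>\<close> is isomorphic to \<open>G\<^sub>F(2)\<close>.  Sending \<open>x\<^sub>k\<close>, \<open>x\<^sub>i\<close>, \<open>x\<^sub>j\<close> to the three elementary
  superdiagonal matrices, and all other generators to \<open>1\<close>, maps \<open>S\<close> to the group \<open>U\<^sub>4\<close> of unitriangular
  \<open>4 \<times> 4\<close> matrices over the field with two elements, and \<open>R\<close> into the centre of \<open>U\<^sub>4\<close>.  Hence the characters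
  \<open>\<chi>\<^sub>k, \<chi>\<^sub>i, \<chi>\<^sub>j\<close> of \<open>G\<close> have a defined triple Massey product.  Over a field it vanishes:
  there is a homomorphism from \<open>G\<^sub>F\<close>, hence from \<open>G\<close>, to \<open>U\<^sub>4\<close> with superdiagonal \<open>(\<chi>\<^sub>k, \<chi>\<^sub>i, \<chi>\<^sub>j)\<close>.
  But every homomorphism from \<open>S\<close> to \<open>U\<^sub>4\<close> with this superdiagonal sends \<open>r\<close> to the nontrivial
  central element.

  The vanishing is explicit.  If the characteristic is not \<open>2\<close>, let \<open>a, b, c\<close> be the Kummer elements of the
  characters.  Hilbert 90 gives \<open>\<alpha>\<close> in \<open>F(\<surd>a)\<close> and \<open>\<gamma>\<close> in \<open>F(\<surd>c)\<close> of norm \<open>b\<close>, and \<open>\<delta> = \<alpha> + \<gamma>\<close>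
  has norm \<open>b (Tr \<alpha> + Tr \<gamma>)\<^sup>2\<close> from \<open>F(\<surd>a, \<surd>c)\<close> to \<open>F\<close>; since \<open>U\<^sub>4\<close> is the wreath product of \<open>\<int>/2\<close>
  with \<open>(\<int>/2)\<^sup>2\<close>, the square roots of the conjugates of \<open>\<delta>\<close> define the homomorphism.  In
  characteristic \<open>2\<close> it is obtained by solving Artin--Schreier equations.  Only automorphisms of the separable
  closure with finite orbits enter, so neither the fixed field of \<open>G\<^sub>F\<close> nor the extension of
  embeddings plays a role.
\<close>

section \<open>Hilbert 90 for a group acting on a field with finite orbits\<close>

text \<open>Why \<open>r\<close> cannot be repaired: for any homomorphism with the prescribed
  superdiagonal, the generators other than \<open>x k\<close> and \<open>x j\<close> go to matrices
  with superdiagonal (0, u, 0), and these form an elementary abelian group. The vanishing of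
  \<open>a\<close> and \<open>b\<close> in (i) concerns exactly the squares of \<open>x k\<close>
  and \<open>x j\<close> and the commutators involving them, so the first two products of
  \<open>r\<close> die. A triple commutator depends on superdiagonals only, so no choice of the
  other entries affects what remains.

  Why the norm is b times a square: if \<alpha>\<alpha>' = \<gamma>\<gamma>' = b, then (\<alpha> +
  \<gamma>)(\<alpha> + \<gamma>') = \<alpha>(\<alpha> + \<alpha>' + \<gamma> + \<gamma>'), and the
  other two conjugates give the same with \<alpha>' in front.

  An isomorphism of the quotients yields no map between \<open>S\<close> and the Galois group.
  Homomorphisms to finite groups are therefore carried across along the relation that two elements
  have corresponding classes. This is done twice: a homomorphism to \<open>U4\<close> modulo its
  centre goes to the Galois group, and its lift to \<open>U4\<close> comes back.\<close>

declare add_bit_eq_xor [simp del] mult_bit_eq_and [simp del]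

text \<open>Subtracting \<open>e p0 w\<close> times the relation at \<open>z\<close> from the
  relation at \<open>w * z\<close> eliminates \<open>p0\<close> and multiplies the other
  coefficients by \<open>e p w - e p0 w\<close>. Only a multiplicatively closed set \<open>L\<close>
  is involved, so the lemma applies to the elements fixed by a subgroup.\<close>

lemma dedekind_independence:
  fixes e :: "'p \<Rightarrow> 'm::monoid_mult \<Rightarrow> 'k::field"
  assumes "finite P" and one: "1 \<in> L" "\<And>p. p \<in> P \<Longrightarrow> e p 1 = 1"
    and mult: "\<And>x y. x \<in> L \<Longrightarrow> y \<in> L \<Longrightarrow> x * y \<in> L"
      "\<And>p x y. p \<in> P \<Longrightarrow> x \<in> L \<Longrightarrow> y \<in> L \<Longrightarrow> e p (x * y) = e p x * e p y"
    and distinct: "\<And>p q. p \<in> P \<Longrightarrow> q \<in> P \<Longrightarrow> p \<noteq> q \<Longrightarrow> \<exists>z\<in>L. e p z \<noteq> e q z"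
    and "\<And>z. z \<in> L \<Longrightarrow> (\<Sum>p\<in>P. c p * e p z) = 0" and "p \<in> P"
  shows "c p = 0"
  using assms(1) one(2) mult(2) distinct assms(7,8)
proof (induction P arbitrary: c p rule: finite_induct)
  case (insert p0 P)
  have *: "c p = 0" if p: "p \<in> P" for p
  proof -
    obtain w where w: "w \<in> L" "e p w \<noteq> e p0 w"
      using insert.prems(3)[of p p0] p insert.hyps by auto
    have "(\<Sum>p\<in>P. c p * (e p w - e p0 w) * e p z) = 0" if z: "z \<in> L" for z
    proof -
      have 1: "(\<Sum>p\<in>P. c p * e p (w * z)) = - (c p0 * e p0 (w * z))"
        using insert.prems(4)[of "w * z"] insert.hyps mult(1) w z by (simp add: add_eq_0_iff)
      have 2: "(\<Sum>p\<in>P. c p * e p z) = - (c p0 * e p0 z)"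
        using insert.prems(4)[of z] insert.hyps z by (simp add: add_eq_0_iff)
      have "(\<Sum>p\<in>P. c p * e p (w * z)) - e p0 w * (\<Sum>p\<in>P. c p * e p z) = 0"
        unfolding 1 2 using insert.prems(2)[of p0 w z] w z by simp
      moreover have "(\<Sum>p\<in>P. c p * e p (w * z)) = (\<Sum>p\<in>P. c p * e p w * e p z)"
        using insert.prems(2) w z by (auto intro!: sum.cong)
      ultimately show ?thesis
        by (simp add: sum_distrib_left algebra_simps flip: sum_subtractf)
    qed
    then have "c p * (e p w - e p0 w) = 0"
      using insert.IH[of "\<lambda>p. c p * (e p w - e p0 w)" p] insert.prems p by blast
    then show ?thesis using w by simp
  qed
  then have "c p0 * e p0 1 = 0"
    using insert.prems(4)[OF one(1)] insert.hyps by (simp add: sum.neutral)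
  then show ?case using * insert.prems(1)[of p0] insert.prems(5) by auto
qed simp

definition bit_sign :: "bit \<Rightarrow> 'k::ring_1" where
  "bit_sign u = (if u = 0 then 1 else - 1)"

lemma bit_sign_simps [simp]: "bit_sign 0 = 1" "bit_sign 1 = - 1"
  by (simp_all add: bit_sign_def)

lemma bit_sign_add: "bit_sign (u + v) = bit_sign u * bit_sign v"
  by (cases u; cases v) simp_all

lemma bit_sign_square [simp]: "bit_sign u * bit_sign u = 1"
  by (cases u) simp_all

lemma bit_sign_square' [simp]: "bit_sign u * (bit_sign u * z) = z"
  by (cases u) simp_all

lemma bit_add_self [simp]: "(u::bit) + u = 0" "(u::bit) + (u + v) = v"
  by (cases u; cases v; simp)+

text \<open>An abstraction of the separable closure with its Galois group. The field is a subset
  \<open>K\<close> of a type, and algebraicity enters only through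
  \<open>finite_orbit\<close>.\<close>

locale field_action = group G for G (structure) +
  fixes K :: "'k::field set" and act :: "'a \<Rightarrow> 'k \<Rightarrow> 'k"
  assumes K_1 [simp]: "1 \<in> K"
    and K_add [simp]: "\<And>y z. y \<in> K \<Longrightarrow> z \<in> K \<Longrightarrow> y + z \<in> K"
    and K_minus [simp]: "\<And>z. z \<in> K \<Longrightarrow> - z \<in> K"
    and K_mult [simp]: "\<And>y z. y \<in> K \<Longrightarrow> z \<in> K \<Longrightarrow> y * z \<in> K"
    and K_inverse [simp]: "\<And>z. z \<in> K \<Longrightarrow> inverse z \<in> K"
    and act_closed [simp]: "\<And>g z. g \<in> carrier G \<Longrightarrow> z \<in> K \<Longrightarrow> act g z \<in> K"
    and act_add [simp]: "\<And>g y z. g \<in> carrier G \<Longrightarrow> y \<in> K \<Longrightarrow> z \<in> K \<Longrightarrow> act g (y + z) = act g y + act g z"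
    and act_mult [simp]: "\<And>g y z. g \<in> carrier G \<Longrightarrow> y \<in> K \<Longrightarrow> z \<in> K \<Longrightarrow> act g (y * z) = act g y * act g z"
    and act_1 [simp]: "\<And>g. g \<in> carrier G \<Longrightarrow> act g 1 = 1"
    and act_id [simp]: "\<And>z. z \<in> K \<Longrightarrow> act \<one> z = z"
    and act_comp: "\<And>g h z. g \<in> carrier G \<Longrightarrow> h \<in> carrier G \<Longrightarrow> z \<in> K \<Longrightarrow> act (g \<otimes> h) z = act g (act h z)"
    and finite_orbit: "\<And>z. z \<in> K \<Longrightarrow> finite ((\<lambda>g. act g z) ` carrier G)"
begin

lemma K_0 [simp]: "0 \<in> K"
  using K_add[OF K_1 K_minus[OF K_1]] by simp

lemma K_divide [simp]: "y \<in> K \<Longrightarrow> z \<in> K \<Longrightarrow> y / z \<in> K"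
  by (simp add: divide_inverse)

lemma K_bit_sign [simp]: "bit_sign u \<in> K"
  by (cases u) simp_all

lemma K_sum [simp]: "(\<And>p. p \<in> P \<Longrightarrow> f p \<in> K) \<Longrightarrow> sum f P \<in> K"
  by (induction P rule: infinite_finite_induct) simp_all

lemma act_0 [simp]: "g \<in> carrier G \<Longrightarrow> act g 0 = 0"
  using act_add[of g 0 0] by (simp only: K_0 add_0_right add_cancel_right_right simp_thms)

lemma act_minus [simp]: "g \<in> carrier G \<Longrightarrow> z \<in> K \<Longrightarrow> act g (- z) = - act g z"
  using act_add[of g z "- z"] by (simp add: eq_neg_iff_add_eq_0 add.commute)

lemma act_inverse [simp]:
  assumes "g \<in> carrier G" "z \<in> K" shows "act g (inverse z) = inverse (act g z)"
proof (cases "z = 0")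
  case False
  then have "act g z * act g (inverse z) = 1"
    using assms act_mult[of g z "inverse z"] by (simp add: act_1[OF assms(1)] del: act_mult)
  then show ?thesis by (metis inverse_unique)
qed (use assms in simp)

lemma act_divide [simp]:
  "g \<in> carrier G \<Longrightarrow> y \<in> K \<Longrightarrow> z \<in> K \<Longrightarrow> act g (y / z) = act g y / act g z"
  by (simp add: divide_inverse)

lemma act_bit_sign [simp]: "g \<in> carrier G \<Longrightarrow> act g (bit_sign u) = bit_sign u"
  by (cases u) simp_all

lemma act_sum: "g \<in> carrier G \<Longrightarrow> (\<And>p. p \<in> P \<Longrightarrow> f p \<in> K) \<Longrightarrow> act g (sum f P) = (\<Sum>p\<in>P. act g (f p))"
  by (induction P rule: infinite_finite_induct) simp_all

lemma act_inv [simp]: "g \<in> carrier G \<Longrightarrow> z \<in> K \<Longrightarrow> act (inv g) (act g z) = z"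
    "g \<in> carrier G \<Longrightarrow> z \<in> K \<Longrightarrow> act g (act (inv g) z) = z"
  by (simp_all flip: act_comp)

lemma act_eq_0_iff [simp]: "g \<in> carrier G \<Longrightarrow> z \<in> K \<Longrightarrow> act g z = 0 \<longleftrightarrow> z = 0"
  by (metis act_inv(1) act_0 inv_closed)

text \<open>A finite \<open>T\<close> plays the role of the finite extension it generates:
  \<open>agree T g \<one>\<close> says that \<open>g\<close> lies in the open subgroup fixing that
  extension.\<close>

definition agree :: "'k set \<Rightarrow> 'a \<Rightarrow> 'a \<Rightarrow> bool" where
  "agree T g h \<longleftrightarrow> (\<forall>t\<in>T. act g t = act h t)"

definition fixed_by :: "'a set \<Rightarrow> 'k set \<Rightarrow> 'k set" where
  "fixed_by H T = {z \<in> K. \<forall>g\<in>H. agree T g \<one> \<longrightarrow> act g z = z}"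

text \<open>\<open>P\<close> behaves like a set of representatives of \<open>H\<close> modulo the
  pointwise stabilizer of \<open>T\<close>. The two quantified clauses are what both forms of
  Hilbert 90 require: resolvents do not vanish identically, and left translation permutes the
  cosets.\<close>

definition orbit_reps :: "'a set \<Rightarrow> 'k set \<Rightarrow> 'a set \<Rightarrow> bool" where
  "orbit_reps H T P \<longleftrightarrow> finite P \<and> P \<subseteq> H \<and> P \<noteq> {} \<and>
     (\<forall>\<epsilon>. (\<exists>p\<in>P. \<epsilon> p \<noteq> 0) \<longrightarrow> (\<exists>z\<in>fixed_by H T. (\<Sum>p\<in>P. \<epsilon> p * act p z) \<noteq> 0)) \<and>
     (\<forall>\<epsilon>. \<forall>\<tau>\<in>H. \<forall>z\<in>fixed_by H T. (\<forall>g\<in>H. \<forall>h\<in>H. agree T g h \<longrightarrow> \<epsilon> g = \<epsilon> h) \<longrightarrow>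
        (\<Sum>p\<in>P. \<epsilon> p * act (\<tau> \<otimes> p) z) = (\<Sum>p\<in>P. \<epsilon> (inv \<tau> \<otimes> p) * act p z))"

text \<open>Finite orbits leave finitely many restrictions of elements of \<open>H\<close> to
  \<open>T\<close>, and one representative is chosen for each. Distinct representatives differ on
  some element of \<open>T\<close>, which itself lies in \<open>fixed_by H T\<close>, so Dedekind
  independence applies there.\<close>

lemma orbit_reps_exist:
  assumes H: "subgroup H G" and T: "finite T" "T \<subseteq> K"
  shows "\<exists>P. orbit_reps H T P"
proof -
  have HG [simp]: "h \<in> carrier G" if "h \<in> H" for h
    by (rule subgroup.mem_carrier[OF H that])
  have H_inv [simp]: "inv h \<in> H" if "h \<in> H" for h
    by (rule subgroup.m_inv_closed[OF H that])
  have H_mult [simp]: "g \<otimes> h \<in> H" if "g \<in> H" "h \<in> H" for g h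
    by (rule subgroup.m_closed[OF H that])
  have TK [simp]: "t \<in> K" if "t \<in> T" for t using T that by blast
  define rs where "rs h = restrict (act h) T" for h
  have rs_eq: "rs g = rs h \<longleftrightarrow> agree T g h" for g h
    by (simp add: rs_def agree_def restrict_def fun_eq_iff) metis
  have "rs ` H \<subseteq> PiE T (\<lambda>t. (\<lambda>g. act g t) ` carrier G)"
    by (auto simp: rs_def)
  then have fin: "finite (rs ` H)"
    using finite_PiE[OF T(1), of "\<lambda>t. (\<lambda>g. act g t) ` carrier G"] finite_orbit
    by (meson TK finite_subset)
  \<comment> \<open>The choice depends on \<open>h\<close> only through \<open>rs h\<close>, so
    elements with equal restrictions share a representative.\<close>
  define rep where "rep h = (SOME g. g \<in> H \<and> rs g = rs h)" for h
  have rep: "rep h \<in> H \<and> rs (rep h) = rs h" if "h \<in> H" for h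
    unfolding rep_def by (rule someI[of _ h]) (use that in simp)
  have rep_cong: "rep g = rep h" if "rs g = rs h" for g h
    using that by (simp add: rep_def)
  define P where "P = rep ` H"
  have "P = (\<lambda>f. SOME g. g \<in> H \<and> rs g = f) ` rs ` H"
    by (simp add: P_def rep_def image_image)
  then have finP: "finite P" using fin by simp
  have PH: "P \<subseteq> H" using rep by (auto simp: P_def)
  have P_eq: "p = q" if pq: "p \<in> P" "q \<in> P" "rs p = rs q" for p q
  proof -
    obtain g h where "g \<in> H" "p = rep g" "h \<in> H" "q = rep h" using pq by (auto simp: P_def)
    then show ?thesis using rep[of g] rep[of h] pq(3) rep_cong[of g h] by simp
  qed
  have act_cong: "act g z = act h z" if "g \<in> H" "h \<in> H" "rs g = rs h" "z \<in> fixed_by H T" for g h z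
  proof -
    have "agree T (inv h \<otimes> g) \<one>"
      using that by (auto simp: rs_eq agree_def act_comp)
    then have "act (inv h \<otimes> g) z = z" and zK: "z \<in> K" using that by (auto simp: fixed_by_def)
    then show ?thesis using that by (metis HG act_closed act_comp act_inv(2) H_inv)
  qed
  have nz: "\<exists>z\<in>fixed_by H T. (\<Sum>p\<in>P. \<epsilon> p * act p z) \<noteq> 0" if "\<exists>p\<in>P. \<epsilon> p \<noteq> 0" for \<epsilon>
  proof (rule ccontr)
    assume neg: "\<not> ?thesis"
    have "\<epsilon> p = 0" if "p \<in> P" for p
    proof (rule dedekind_independence[where e = act and L = "fixed_by H T" and P = P])
      show "\<exists>z\<in>fixed_by H T. act p z \<noteq> act q z" if "p \<in> P" "q \<in> P" "p \<noteq> q" for p q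
      proof -
        have "\<not> agree T p q" using P_eq that rs_eq by blast
        then obtain t where "t \<in> T" "act p t \<noteq> act q t" by (auto simp: agree_def)
        moreover from \<open>t \<in> T\<close> have "t \<in> fixed_by H T" by (auto simp: fixed_by_def agree_def)
        ultimately show ?thesis by blast
      qed
    qed (use neg finP PH that in \<open>auto simp: fixed_by_def subset_iff\<close>)
    with that show False by blast
  qed
  have reindex: "(\<Sum>p\<in>P. \<epsilon> p * act (\<tau> \<otimes> p) z) = (\<Sum>p\<in>P. \<epsilon> (inv \<tau> \<otimes> p) * act p z)"
    if \<tau>: "\<tau> \<in> H" and z: "z \<in> fixed_by H T"
      and \<epsilon>: "\<forall>g\<in>H. \<forall>h\<in>H. agree T g h \<longrightarrow> \<epsilon> g = \<epsilon> h" for \<epsilon> \<tau> z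
  proof (rule sum.reindex_bij_witness[where j = "\<lambda>p. rep (\<tau> \<otimes> p)" and i = "\<lambda>p. rep (inv \<tau> \<otimes> p)"])
    fix p assume p: "p \<in> P"
    then have pH: "p \<in> H" using PH by blast
    have cancel: "rep (\<sigma> \<otimes> rep (inv \<sigma> \<otimes> p)) = p" if "\<sigma> \<in> H" for \<sigma>
    proof (rule P_eq)
      have "agree T (rep (inv \<sigma> \<otimes> p)) (inv \<sigma> \<otimes> p)"
        using rep[of "inv \<sigma> \<otimes> p"] that pH by (simp add: rs_eq)
      then have "agree T (\<sigma> \<otimes> rep (inv \<sigma> \<otimes> p)) p"
        using that pH rep[of "inv \<sigma> \<otimes> p"] by (auto simp: agree_def act_comp)
      then show "rs (rep (\<sigma> \<otimes> rep (inv \<sigma> \<otimes> p))) = rs p"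
        using that pH rep[of "\<sigma> \<otimes> rep (inv \<sigma> \<otimes> p)"] rep[of "inv \<sigma> \<otimes> p"]
        by (simp flip: rs_eq)
    qed (use that pH rep p in \<open>auto simp: P_def\<close>)
    show "rep (\<tau> \<otimes> rep (inv \<tau> \<otimes> p)) = p" "rep (inv \<tau> \<otimes> rep (\<tau> \<otimes> p)) = p"
      using cancel[of \<tau>] cancel[of "inv \<tau>"] \<tau> by simp_all
    show "rep (\<tau> \<otimes> p) \<in> P" "rep (inv \<tau> \<otimes> p) \<in> P"
      using \<tau> pH by (auto simp: P_def)
    have "act (rep (\<tau> \<otimes> p)) z = act (\<tau> \<otimes> p) z"
      using \<tau> pH rep z by (intro act_cong) auto
    moreover have "agree T (inv \<tau> \<otimes> rep (\<tau> \<otimes> p)) p"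
      using rep[of "\<tau> \<otimes> p"] \<tau> pH by (auto simp: rs_eq agree_def act_comp)
    then have "\<epsilon> (inv \<tau> \<otimes> rep (\<tau> \<otimes> p)) = \<epsilon> p"
      using \<tau> pH rep by (intro \<epsilon>[rule_format]) auto
    ultimately show "\<epsilon> (inv \<tau> \<otimes> rep (\<tau> \<otimes> p)) * act (rep (\<tau> \<otimes> p)) z = \<epsilon> p * act (\<tau> \<otimes> p) z"
      by simp
  qed
  have "P \<noteq> {}" using subgroup.one_closed[OF H] by (auto simp: P_def)
  then have "orbit_reps H T P"
    unfolding orbit_reps_def by (intro conjI allI impI ballI finP PH nz reindex) auto
  then show ?thesis by blast
qed

lemma agree_imp_eq:
  assumes H: "subgroup H G" and T: "T \<subseteq> K"
    and hom: "\<And>g h. g \<in> H \<Longrightarrow> h \<in> H \<Longrightarrow> \<phi> (g \<otimes> h) = \<phi> g + (\<phi> h :: bit)"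
    and triv: "\<And>g. g \<in> H \<Longrightarrow> agree T g \<one> \<Longrightarrow> \<phi> g = 0"
    and gh: "g \<in> H" "h \<in> H" "agree T g h"
  shows "\<phi> g = \<phi> h"
proof -
  have c: "g \<in> carrier G" "h \<in> carrier G" using subgroup.mem_carrier[OF H] gh by simp_all
  have i: "inv h \<in> H" "inv h \<otimes> g \<in> H" using H gh by (simp_all add: subgroup.m_inv_closed subgroup.m_closed)
  have "agree T (inv h \<otimes> g) \<one>" using gh c T by (auto simp: agree_def act_comp)
  then have "\<phi> (inv h \<otimes> g) = 0" using i triv by blast
  then have "\<phi> (h \<otimes> (inv h \<otimes> g)) = \<phi> h" using hom[OF gh(2) i(2)] by simp
  then show ?thesis using c by (simp flip: m_assoc)
qed

lemma hom_inv_eq: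
  assumes H: "subgroup H G"
    and hom: "\<And>g h. g \<in> H \<Longrightarrow> h \<in> H \<Longrightarrow> \<phi> (g \<otimes> h) = \<phi> g + (\<phi> h :: bit)" and "g \<in> H"
  shows "\<phi> (inv g) = \<phi> g"
proof -
  have "\<phi> (\<one> \<otimes> \<one>) = \<phi> \<one> + \<phi> \<one>" using H hom subgroup.one_closed by blast
  then have "\<phi> \<one> = 0" by simp
  moreover have "\<phi> (g \<otimes> inv g) = \<phi> g + \<phi> (inv g)" using H hom assms(3) by (simp add: subgroup.m_inv_closed)
  moreover have "g \<in> carrier G" using subgroup.mem_carrier[OF H] assms(3) by simp
  ultimately show ?thesis by (cases "\<phi> g"; cases "\<phi> (inv g)") simp_all
qed

text \<open>\<open>w\<close> is a Lagrange resolvent: the sum of the conjugates of \<open>z\<close>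
  weighted by the signs of \<phi>, for a \<open>z\<close> at which it is nonzero. A general subgroup
  \<open>H\<close> is allowed because \<open>norm_element\<close> applies this to the kernel of a
  character.\<close>

lemma hilbert90_mult:
  assumes H: "subgroup H G" and T: "finite T" "T \<subseteq> K"
    and hom: "\<And>g h. g \<in> H \<Longrightarrow> h \<in> H \<Longrightarrow> \<phi> (g \<otimes> h) = \<phi> g + (\<phi> h :: bit)"
    and triv: "\<And>g. g \<in> H \<Longrightarrow> agree T g \<one> \<Longrightarrow> \<phi> g = 0"
  obtains w where "w \<in> K" "w \<noteq> 0" "\<And>g. g \<in> H \<Longrightarrow> act g w = bit_sign (\<phi> g) * w"
proof -
  obtain P where rP: "orbit_reps H T P" using orbit_reps_exist[OF H T] by blast
  then have P: "finite P" "P \<subseteq> H" "P \<noteq> {}"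
    and nz: "\<And>\<epsilon>. \<exists>p\<in>P. \<epsilon> p \<noteq> 0 \<Longrightarrow> \<exists>z\<in>fixed_by H T. (\<Sum>p\<in>P. \<epsilon> p * act p z) \<noteq> 0"
    unfolding orbit_reps_def by simp_all
  have re: "(\<Sum>p\<in>P. \<epsilon> p * act (\<tau> \<otimes> p) z) = (\<Sum>p\<in>P. \<epsilon> (inv \<tau> \<otimes> p) * act p z)"
    if "\<tau> \<in> H" "z \<in> fixed_by H T" "\<forall>g\<in>H. \<forall>h\<in>H. agree T g h \<longrightarrow> \<epsilon> g = \<epsilon> h" for \<epsilon> \<tau> z
    using rP that unfolding orbit_reps_def by simp
  have HG: "h \<in> carrier G" if "h \<in> H" for h
    by (rule subgroup.mem_carrier[OF H that])
  have "\<exists>p\<in>P. bit_sign (\<phi> p) \<noteq> (0::'k)" using P(3) by (auto simp: bit_sign_def)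
  then obtain z where z: "z \<in> fixed_by H T" "(\<Sum>p\<in>P. bit_sign (\<phi> p) * act p z) \<noteq> 0"
    using nz[of "\<lambda>p. bit_sign (\<phi> p)"] by auto
  have zK: "z \<in> K" using z by (simp add: fixed_by_def)
  show thesis
  proof (rule that[OF _ z(2)])
    show "(\<Sum>p\<in>P. bit_sign (\<phi> p) * act p z) \<in> K" using zK P HG by (intro K_sum) auto
    fix g assume g: "g \<in> H"
    have "act g (\<Sum>p\<in>P. bit_sign (\<phi> p) * act p z) = (\<Sum>p\<in>P. bit_sign (\<phi> p) * act (g \<otimes> p) z)"
      using g zK P HG by (subst act_sum) (auto intro!: sum.cong simp: act_comp subset_iff)
    also have "\<dots> = (\<Sum>p\<in>P. bit_sign (\<phi> (inv g \<otimes> p)) * act p z)"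
      using z g agree_imp_eq[OF H T(2) hom triv] by (intro re[where \<epsilon> = "\<lambda>p. bit_sign (\<phi> p)"]) auto
    also have "\<dots> = (\<Sum>p\<in>P. bit_sign (\<phi> g) * (bit_sign (\<phi> p) * act p z))"
      using P g by (intro sum.cong)
        (auto simp: hom hom_inv_eq[OF H hom] bit_sign_add subgroup.m_inv_closed[OF H] subset_iff)
    finally show "act g (\<Sum>p\<in>P. bit_sign (\<phi> p) * act p z) = bit_sign (\<phi> g) * (\<Sum>p\<in>P. bit_sign (\<phi> p) * act p z)"
      by (simp add: sum_distrib_left)
  qed
qed

definition bit_emb :: "bit \<Rightarrow> 'k" where "bit_emb u = (if u = 0 then 0 else 1)"

lemma bit_emb_simps [simp]: "bit_emb 0 = 0" "bit_emb 1 = 1"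
  by (simp_all add: bit_emb_def)

text \<open>The additive resolvent: the sum of the conjugates of \<open>z\<close> weighted by
  \<phi>, divided by the trace of \<open>z\<close>. Translation by \<open>g\<close> adds \<phi>(g)
  times the trace to the numerator.\<close>

lemma hilbert90_add:
  assumes two: "(1::'k) + 1 = 0" and T: "finite T" "T \<subseteq> K"
    and hom: "\<And>g h. g \<in> carrier G \<Longrightarrow> h \<in> carrier G \<Longrightarrow> \<phi> (g \<otimes> h) = \<phi> g + (\<phi> h :: bit)"
    and triv: "\<And>g. g \<in> carrier G \<Longrightarrow> agree T g \<one> \<Longrightarrow> \<phi> g = 0"
  obtains w where "w \<in> K" "\<And>g. g \<in> carrier G \<Longrightarrow> act g w = w + bit_emb (\<phi> g)"
proof -
  have H: "subgroup (carrier G) G" by (rule subgroup_self)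
  obtain P where rP: "orbit_reps (carrier G) T P" using orbit_reps_exist[OF H T] by blast
  then have P: "finite P" "P \<subseteq> (carrier G)" "P \<noteq> {}"
    and nz: "\<And>\<epsilon>. \<exists>p\<in>P. \<epsilon> p \<noteq> 0 \<Longrightarrow> \<exists>z\<in>fixed_by (carrier G) T. (\<Sum>p\<in>P. \<epsilon> p * act p z) \<noteq> 0"
    unfolding orbit_reps_def by simp_all
  have re: "(\<Sum>p\<in>P. \<epsilon> p * act (\<tau> \<otimes> p) z) = (\<Sum>p\<in>P. \<epsilon> (inv \<tau> \<otimes> p) * act p z)"
    if "\<tau> \<in> (carrier G)" "z \<in> fixed_by (carrier G) T" "\<forall>g\<in>(carrier G). \<forall>h\<in>(carrier G). agree T g h \<longrightarrow> \<epsilon> g = \<epsilon> h" for \<epsilon> \<tau> z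
    using rP that unfolding orbit_reps_def by simp
  \<comment> \<open>Constant coefficients 1 provide an element \<open>z\<close> of nonzero
    trace.\<close>
  have "\<exists>p\<in>P. (\<lambda>_. 1) p \<noteq> (0::'k)" using P(3) by auto
  then obtain z where z: "z \<in> fixed_by (carrier G) T" "(\<Sum>p\<in>P. 1 * act p z) \<noteq> 0"
    using nz[of "\<lambda>_. 1"] by simp blast
  have zK [simp]: "z \<in> K" using z by (simp add: fixed_by_def)
  have PG [simp]: "p \<in> carrier G" if "p \<in> P" for p using P that by blast
  have emb [simp]: "bit_emb u \<in> K" "g \<in> carrier G \<Longrightarrow> act g (bit_emb u) = bit_emb u" for u g
    by (cases u; simp)+
  have [simp]: "(2::'k) = 0" using two by simp
  have emb_add: "bit_emb (u + v) = bit_emb u + bit_emb v" for u v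
    using two by (cases u; cases v) simp_all
  define s where "s = (\<Sum>p\<in>P. act p z)"
  define v where "v = (\<Sum>p\<in>P. bit_emb (\<phi> p) * act p z)"
  have s: "s \<in> K" "s \<noteq> 0" and v: "v \<in> K" using z by (auto simp: s_def v_def intro!: K_sum)
  have acts: "act g s = s" if g: "g \<in> carrier G" for g
    using re[OF g z(1), where \<epsilon> = "\<lambda>_. 1"] g by (simp add: s_def act_sum flip: act_comp)
  have actv: "act g v = bit_emb (\<phi> g) * s + v" if g: "g \<in> carrier G" for g
  proof -
    have "act g v = (\<Sum>p\<in>P. bit_emb (\<phi> p) * act (g \<otimes> p) z)"
      unfolding v_def using g by (subst act_sum) (auto intro!: sum.cong simp: act_comp)
    also have "\<dots> = (\<Sum>p\<in>P. bit_emb (\<phi> (inv g \<otimes> p)) * act p z)"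
      using z g agree_imp_eq[OF H T(2) hom triv] by (intro re[where \<epsilon> = "\<lambda>p. bit_emb (\<phi> p)"]) auto
    also have "\<dots> = (\<Sum>p\<in>P. bit_emb (\<phi> g) * act p z + bit_emb (\<phi> p) * act p z)"
      using g by (intro sum.cong) (auto simp: hom hom_inv_eq[OF H hom] emb_add distrib_right)
    finally show ?thesis by (simp add: sum.distrib sum_distrib_left s_def v_def)
  qed
  show thesis
  proof (rule that[of "v / s"])
    show "v / s \<in> K" using s v by simp
    show "act g (v / s) = v / s + bit_emb (\<phi> g)" if "g \<in> carrier G" for g
      using that s v by (simp add: acts actv add_divide_distrib)
  qed
qed

end

section \<open>Lifting to unitriangular matrices\<close>

lemma bit_sign_eq_iff: "(2::'k::field) \<noteq> 0 \<Longrightarrow> bit_sign u = (bit_sign v :: 'k) \<longleftrightarrow> u = v"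
proof -
  assume "(2::'k) \<noteq> 0"
  moreover have "(1::'k) = - 1 \<longleftrightarrow> (2::'k) = 0" by (metis add.right_inverse one_add_one add_eq_0_iff)
  moreover have "- 1 = (1::'k) \<longleftrightarrow> (2::'k) = 0" using calculation(2) by metis
  ultimately show ?thesis by (cases u; cases v) simp_all
qed

context field_action begin

text \<open>\<open>D\<close> exhibits the cup product of \<open>A\<close> and \<open>B\<close> as a
  coboundary, which classically makes b a norm from F(\<surd>a). Here \<beta> stands for \<surd>b
  and \<alpha> for an element with conjugate \<beta>\<beta>/\<alpha>, hence of norm b. On the kernel
  of \<open>A\<close> the function \<open>D\<close> is a character, and Hilbert 90 gives the square
  root \<open>w\<close> of \<alpha>.\<close>

lemma norm_element:
  assumes T: "finite T" "T \<subseteq> K"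
    and A: "\<And>g h. g \<in> carrier G \<Longrightarrow> h \<in> carrier G \<Longrightarrow> A (g \<otimes> h) = A g + (A h :: bit)"
    and B: "\<And>g h. g \<in> carrier G \<Longrightarrow> h \<in> carrier G \<Longrightarrow> B (g \<otimes> h) = B g + (B h :: bit)"
    and D: "\<And>g h. g \<in> carrier G \<Longrightarrow> h \<in> carrier G \<Longrightarrow> D (g \<otimes> h) = D g + D h + A g * B h"
    and triv: "\<And>g. g \<in> carrier G \<Longrightarrow> agree T g \<one> \<Longrightarrow> D g = 0"
    and s: "s \<in> carrier G" "A s = 1"
  obtains \<alpha> \<beta> where "\<alpha> \<in> K" "\<beta> \<in> K" "\<alpha> \<noteq> 0" "\<beta> \<noteq> 0"
    "\<And>g. g \<in> carrier G \<Longrightarrow> act g \<alpha> = (if A g = 0 then \<alpha> else \<beta> * \<beta> / \<alpha>)"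
    "\<And>g. g \<in> carrier G \<Longrightarrow> act g \<beta> = bit_sign (B g) * \<beta>"
proof -
  define H where "H = {g \<in> carrier G. A g = 0}"
  note A_inv = hom_inv_eq[OF subgroup_self A] and B_inv = hom_inv_eq[OF subgroup_self B]
  have A1: "A \<one> = 0" using A[of \<one> \<one>] by simp
  have H: "subgroup H G"
    by (rule subgroupI) (auto simp: H_def A A_inv intro!: exI[of _ \<one>] A1)
  have HG: "g \<in> carrier G" "A g = 0" if "g \<in> H" for g using that by (auto simp: H_def)
  obtain w where w: "w \<in> K" "w \<noteq> 0" and actw: "\<And>g. g \<in> H \<Longrightarrow> act g w = bit_sign (D g) * w"
    by (rule hilbert90_mult[OF H T, of D]) (use triv D in \<open>auto simp: H_def\<close>)
  define w' where "w' = act s w"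
  have w': "w' \<in> K" "w' \<noteq> 0" using w s by (auto simp: w'_def)
  \<comment> \<open>The value of \<open>D\<close> at the conjugate \<open>r\<close> comes from
    expanding \<open>D\<close> on both sides of \<open>s \<otimes> r = t \<otimes> s\<close>. The
    extra summand \<open>B t\<close> is the sign by which \<open>t\<close> acts on the product
    \<open>w * w'\<close>.\<close>
  have actw': "act t w' = bit_sign (D t + B t) * w'" if t: "t \<in> H" for t
  proof -
    define r where "r = inv s \<otimes> t \<otimes> s"
    have rG: "r \<in> carrier G" and rt: "s \<otimes> r = t \<otimes> s"
      using s HG[OF t] by (simp_all add: r_def flip: m_assoc)
    have Ar: "A r = 0" and Br: "B r = B t"
      using s HG[OF t] by (simp_all add: r_def A A_inv B B_inv add_ac)
    have "D s + D r + B r = D t + D s" using D[of s r] D[of t s] rG rt s HG[OF t] by simp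
    then have Dr: "D r = D t + B t" unfolding Br by (cases "D s"; cases "D r"; cases "D t"; cases "B t") simp_all
    have "act t w' = act (s \<otimes> r) w" using s w HG[OF t] by (simp add: w'_def rt act_comp)
    also have "\<dots> = act s (bit_sign (D r) * w)" using s rG w Ar actw[of r] by (simp add: act_comp H_def)
    finally show ?thesis using s w by (simp add: w'_def Dr)
  qed
  have "s \<otimes> s \<in> H" using s A[of s s] by (simp add: H_def)
  then have sw': "act s w' = bit_sign (B s) * w"
    using s w actw[of "s \<otimes> s"] D[of s s] by (simp add: w'_def flip: act_comp)
  \<comment> \<open>The group is the union of \<open>H\<close> and its coset by \<open>s\<close>, so
    the action on \<open>w\<close> and \<open>w'\<close> is now known everywhere.\<close>
  have dec: "\<exists>t\<in>H. g = s \<otimes> t" if "g \<in> carrier G" "A g \<noteq> 0" for g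
    using that s by (intro bexI[of _ "inv s \<otimes> g"]) (auto simp: H_def A A_inv simp flip: m_assoc)
  show thesis
  \<comment> \<open>Squaring removes the sign given by \<open>D\<close>, so \<open>w * w\<close> is
    fixed by \<open>H\<close>; its other conjugate is \<open>w' * w'\<close>.\<close>
  proof (rule that[of "w * w" "w * w'"])
    fix g assume g: "g \<in> carrier G"
    show "act g (w * w) = (if A g = 0 then w * w else w * w' * (w * w') / (w * w))"
    proof (cases "A g = 0")
      case True
      then show ?thesis using g w actw[of g] by (simp add: H_def mult_ac)
    next
      case False
      then obtain t where t: "t \<in> H" "g = s \<otimes> t" using dec g by blast
      then have "act g w = bit_sign (D t) * w'"
        using s w HG[OF t(1)] actw[OF t(1)] by (simp add: act_comp w'_def)
      then show ?thesis using g w False by (simp add: mult_ac)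
    qed
    show "act g (w * w') = bit_sign (B g) * (w * w')"
    proof (cases "A g = 0")
      case True
      then show ?thesis using g w w' actw[of g] actw'[of g] by (simp add: H_def mult_ac bit_sign_add)
    next
      case False
      then obtain t where t: "t \<in> H" "g = s \<otimes> t" using dec g by blast
      then have "act g w = bit_sign (D t) * w'" "act g w' = bit_sign (D t + B t) * (bit_sign (B s) * w)"
        using s w w' HG[OF t(1)] actw[OF t(1)] actw'[OF t(1)] sw'
        by (simp_all add: act_comp) (simp add: w'_def)
      then show ?thesis using g w w' t s HG[OF t(1)] by (simp add: mult_ac B bit_sign_add)
    qed
  qed (use w w' in auto)
qed

end

text \<open>\<open>(A, B, C, D, E)\<close> is a homomorphism to \<open>U4\<close> modulo its centre,
  that is, a defining system for the triple Massey product of \<open>A\<close>, \<open>B\<close>,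
  \<open>C\<close>. The elements \<open>sa\<close>, \<open>sb\<close>, \<open>sc\<close> carry the
  required independence of the characters.\<close>

locale massey_data = field_action +
  fixes A B C D E :: "'a \<Rightarrow> bit" and T :: "'c set" and sa sb sc :: 'a
  assumes A: "\<And>g h. g \<in> carrier G \<Longrightarrow> h \<in> carrier G \<Longrightarrow> A (g \<otimes> h) = A g + A h"
    and B: "\<And>g h. g \<in> carrier G \<Longrightarrow> h \<in> carrier G \<Longrightarrow> B (g \<otimes> h) = B g + B h"
    and C: "\<And>g h. g \<in> carrier G \<Longrightarrow> h \<in> carrier G \<Longrightarrow> C (g \<otimes> h) = C g + C h"
    and D: "\<And>g h. g \<in> carrier G \<Longrightarrow> h \<in> carrier G \<Longrightarrow> D (g \<otimes> h) = D g + D h + A g * B h"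
    and E: "\<And>g h. g \<in> carrier G \<Longrightarrow> h \<in> carrier G \<Longrightarrow> E (g \<otimes> h) = E g + E h + B g * C h"
    and T: "finite T" "T \<subseteq> K"
    and triv: "\<And>g. g \<in> carrier G \<Longrightarrow> agree T g \<one> \<Longrightarrow>
      A g = 0 \<and> B g = 0 \<and> C g = 0 \<and> D g = 0 \<and> E g = 0"
    and sa: "sa \<in> carrier G" "A sa = 1" "C sa = 0"
    and sb: "sb \<in> carrier G" "A sb = 0" "B sb = 1"
    and sc: "sc \<in> carrier G" "C sc = 1"
begin

text \<open>Functions \<open>D', E', F'\<close> extending \<open>A, B, C\<close> to a homomorphism into the unitriangular
  \<open>4 \<times> 4\<close> matrices.\<close>
definition lift :: "('a \<Rightarrow> bit) \<Rightarrow> ('a \<Rightarrow> bit) \<Rightarrow> ('a \<Rightarrow> bit) \<Rightarrow> 'c set \<Rightarrow> bool" where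
  "lift D' E' F' T' \<longleftrightarrow> finite T' \<and> T' \<subseteq> K \<and>
     (\<forall>g\<in>carrier G. agree T' g \<one> \<longrightarrow>
        A g = 0 \<and> B g = 0 \<and> C g = 0 \<and> D' g = 0 \<and> E' g = 0 \<and> F' g = 0) \<and>
     (\<forall>g\<in>carrier G. \<forall>h\<in>carrier G.
        D' (g \<otimes> h) = D' g + D' h + A g * B h \<and>
        E' (g \<otimes> h) = E' g + E' h + B g * C h \<and>
        F' (g \<otimes> h) = F' g + F' h + A g * E' h + D' g * C h)"

text \<open>The square roots \<open>y u v\<close> of the four conjugates \<alpha>_u + \<gamma>_v are
  permuted up to sign. Since \<alpha>\<alpha>' = \<gamma>\<gamma>' = \<beta>\<beta>, the product of
  the conjugates is the square of \<beta>t, where t is the sum of both traces. So the product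
  \<open>Y\<close> of the roots is \<beta>t up to sign, \<open>g\<close> acts on it by the sign of
  \<open>B g\<close>, and the four signs of \<open>g\<close> add up to \<open>B g\<close>. Weighted
  sums of these signs then give the other entries.\<close>

lemma lift_char_neq_2:
  assumes two: "(2::'c) \<noteq> 0" and sqrt: "\<And>z. z \<in> K \<Longrightarrow> \<exists>y\<in>K. y * y = z"
  shows "\<exists>D' E' F' T'. lift D' E' F' T'"
proof -
  obtain \<alpha> \<beta> where ab: "\<alpha> \<in> K" "\<beta> \<in> K" "\<alpha> \<noteq> 0" "\<beta> \<noteq> 0"
    and act\<alpha>: "\<And>g. g \<in> carrier G \<Longrightarrow> act g \<alpha> = (if A g = 0 then \<alpha> else \<beta> * \<beta> / \<alpha>)"
    and act\<beta>: "\<And>g. g \<in> carrier G \<Longrightarrow> act g \<beta> = bit_sign (B g) * \<beta>"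
    by (rule norm_element[OF T A B D _ sa(1,2)]) (use triv in auto)
  \<comment> \<open>Adding \<open>B * C\<close> exchanges the factors of the cup product, so that
    \<open>norm_element\<close> applies to \<open>C\<close> and \<open>B\<close> in this
    order.\<close>
  have E': "E (g \<otimes> h) + B (g \<otimes> h) * C (g \<otimes> h) = (E g + B g * C g) + (E h + B h * C h) + C g * B h"
    if "g \<in> carrier G" "h \<in> carrier G" for g h
    using that by (cases "E g"; cases "E h"; cases "B g"; cases "B h"; cases "C g"; cases "C h") (simp_all add: B C E)
  obtain \<gamma>0 \<beta>' where cb: "\<gamma>0 \<in> K" "\<beta>' \<in> K" "\<gamma>0 \<noteq> 0" "\<beta>' \<noteq> 0"
    and act\<gamma>0: "\<And>g. g \<in> carrier G \<Longrightarrow> act g \<gamma>0 = (if C g = 0 then \<gamma>0 else \<beta>' * \<beta>' / \<gamma>0)"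
    and act\<beta>': "\<And>g. g \<in> carrier G \<Longrightarrow> act g \<beta>' = bit_sign (B g) * \<beta>'"
    by (rule norm_element[OF T C B E' _ sc]) (use triv in auto)
  \<comment> \<open>Both \<beta> and \<beta>' change sign according to \<open>B\<close>, so their
    ratio is invariant; dividing \<gamma>0 by it makes the norms of \<alpha> and \<gamma>
    equal.\<close>
  define f where "f = \<beta>' / \<beta>"
  have f: "f \<in> K" "f \<noteq> 0" "\<beta>' = f * \<beta>" using ab cb by (auto simp: f_def)
  have actf: "act g f = f" if "g \<in> carrier G" for g
    using that ab cb by (cases "B g") (simp_all add: f_def act\<beta> act\<beta>')
  define \<gamma> where "\<gamma> = \<gamma>0 / f"
  have c: "\<gamma> \<in> K" "\<gamma> \<noteq> 0" using cb f by (auto simp: \<gamma>_def)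
  have act\<gamma>: "act g \<gamma> = (if C g = 0 then \<gamma> else \<beta> * \<beta> / \<gamma>)" if "g \<in> carrier G" for g
    using that ab cb f by (simp add: \<gamma>_def act\<gamma>0 actf)
  define al ga where "al u = (if u = 0 then \<alpha> else \<beta> * \<beta> / \<alpha>)"
    and "ga u = (if u = 0 then \<gamma> else \<beta> * \<beta> / \<gamma>)" for u :: bit
  have alK [simp]: "al u \<in> K" and gaK [simp]: "ga u \<in> K" for u
    using ab c by (auto simp: al_def ga_def)
  have act_al: "act g (al u) = al (u + A g)" if "g \<in> carrier G" for g u
    using that ab by (cases u; cases "A g") (simp_all add: al_def act\<alpha> act\<beta> mult_ac)
  have act_ga: "act g (ga u) = ga (u + C g)" if "g \<in> carrier G" for g u
    using that ab c by (cases u; cases "C g") (simp_all add: ga_def act\<gamma> act\<beta> mult_ac)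
  \<comment> \<open>If a conjugate of \<delta> vanished, then \<open>sa\<close>, which moves
    \<alpha> and fixes \<gamma>, would force \<alpha> to equal its conjugate, so \<alpha> = \<beta>
    or \<alpha> = -\<beta>. But \<open>sb\<close> fixes \<alpha> and negates \<beta>.\<close>
  have nz: "al u + ga v \<noteq> 0" for u v
  proof
    assume eq: "al u + ga v = 0"
    then have alga: "al u = - ga v" by (simp add: add_eq_0_iff2)
    have "al (u + 1) = al u"
      using act_al[OF sa(1), of u] act_ga[OF sa(1), of v] sa alga by simp
    then have "\<alpha> * \<alpha> = \<beta> * \<beta>" using ab by (cases u) (auto simp: al_def divide_eq_eq eq_divide_eq)
    then have "\<alpha> = \<beta> \<or> \<alpha> = - \<beta>" by (simp add: square_eq_iff)
    moreover have "act sb \<alpha> = \<alpha>" "act sb \<beta> = - \<beta>" using act\<alpha>[OF sb(1)] act\<beta>[OF sb(1)] sb by simp_all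
    ultimately have "\<beta> = - \<beta>" using sb ab by auto
    then have "2 * \<beta> = 0" by (metis add.right_inverse mult_2)
    then show False using two ab by simp
  qed
  have "\<exists>y. \<forall>u v. y u v \<in> K \<and> y u v * y u v = al u + ga v"
    using sqrt[OF K_add[OF alK gaK]] by metis
  then obtain y where yK [simp]: "\<And>u v. y u v \<in> K" and y2: "\<And>u v. y u v * y u v = al u + ga v" by blast
  have ynz: "y u v \<noteq> 0" for u v using y2[of u v] nz[of u v] by auto
  \<comment> \<open>The sign of \<open>g\<close> on the root with index (u, v), a cocycle with
    values in functions on (Z/2)^2: the base component in the wreath product.\<close>
  define e where "e g u v = (if act g (y u v) = y (u + A g) (v + C g) then 0 else 1 :: bit)" for g u v
  have act_y: "act g (y u v) = bit_sign (e g u v) * y (u + A g) (v + C g)" if g: "g \<in> carrier G" for g u v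
  proof -
    have "act g (y u v) * act g (y u v) = y (u + A g) (v + C g) * y (u + A g) (v + C g)"
      using g act_mult[of g "y u v" "y u v"] by (simp add: y2 act_al act_ga del: act_mult)
    then show ?thesis by (auto simp: e_def square_eq_iff)
  qed
  have e_mult: "e (g \<otimes> h) u v = e h u v + e g (u + A h) (v + C h)"
    if g: "g \<in> carrier G" and h: "h \<in> carrier G" for g h u v
  proof -
    have "bit_sign (e (g \<otimes> h) u v) * y (u + A h + A g) (v + C h + C g) = act (g \<otimes> h) (y u v)"
      using g h by (simp add: act_y A C add_ac)
    also have "\<dots> = bit_sign (e h u v + e g (u + A h) (v + C h)) * y (u + A h + A g) (v + C h + C g)"
      unfolding act_comp[OF g h yK] using g h by (simp add: act_y bit_sign_add)
    finally show ?thesis using ynz bit_sign_eq_iff[OF two] by simp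
  qed
  define Y where "Y = y 0 0 * y 0 1 * y 1 0 * y 1 1"
  define t where "t = \<alpha> + \<beta> * \<beta> / \<alpha> + \<gamma> + \<beta> * \<beta> / \<gamma>"
  have Y0: "Y \<noteq> 0" using ynz by (simp add: Y_def)
  have "Y * Y = (al 0 + ga 0) * (al 0 + ga 1) * (al 1 + ga 0) * (al 1 + ga 1)"
    unfolding Y_def y2[symmetric] by (simp add: mult_ac)
  also have "\<dots> = (\<beta> * t) * (\<beta> * t)"
    using ab c by (simp add: al_def ga_def t_def field_simps)
  finally have "Y = \<beta> * t \<or> Y = - (\<beta> * t)" by (simp add: square_eq_iff)
  moreover have "act g t = t" if "g \<in> carrier G" for g
  proof -
    have "t = al 0 + al 1 + ga 0 + ga 1" by (simp add: t_def al_def ga_def)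
    then show ?thesis using that by (cases "A g"; cases "C g") (simp_all add: act_al act_ga add_ac)
  qed
  moreover have "t \<in> K" using ab c by (simp add: t_def)
  ultimately have "act g Y = bit_sign (B g) * Y" if "g \<in> carrier G" for g
    using that ab by (auto simp: act\<beta>)
  moreover have "act g Y = bit_sign (e g 0 0 + e g 0 1 + e g 1 0 + e g 1 1) * Y" if "g \<in> carrier G" for g
    using that by (cases "A g"; cases "C g") (simp_all add: Y_def act_y bit_sign_add mult_ac)
  ultimately have Be: "B g = e g 0 0 + e g 0 1 + e g 1 0 + e g 1 1" if "g \<in> carrier G" for g
    using that Y0 bit_sign_eq_iff[OF two] by (metis mult_right_cancel)
  \<comment> \<open>\<open>D', E', F'\<close> are the sums of \<open>(u + A g) * e g u v\<close>, \<open>v * e g u v\<close> and \<open>(u + A g) * v * e g u v\<close>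
    over all \<open>u\<close> and \<open>v\<close>.\<close>
  define D' E' F' where "D' g = A g * (e g 0 0 + e g 0 1) + (1 + A g) * (e g 1 0 + e g 1 1)"
    and "E' g = e g 0 1 + e g 1 1" and "F' g = A g * e g 0 1 + (1 + A g) * e g 1 1" for g
  define T' where "T' = T \<union> {y 0 0, y 0 1, y 1 0, y 1 1}"
  have "lift D' E' F' T'"
    unfolding lift_def
  proof (intro conjI ballI impI)
    fix g assume g: "g \<in> carrier G" and ag: "agree T' g \<one>"
    then have "agree T g \<one>" by (auto simp: agree_def T'_def)
    with triv[OF g] have z: "A g = 0" "B g = 0" "C g = 0" by auto
    then show "A g = 0" "B g = 0" "C g = 0" .
    from ag have "act g (y u v) = y u v" for u v
      by (cases u; cases v) (auto simp: agree_def T'_def)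
    then have "e g u v = 0" for u v using z by (simp add: e_def)
    then show "D' g = 0" "E' g = 0" "F' g = 0" by (simp_all add: D'_def E'_def F'_def)
  next
    fix g h assume g: "g \<in> carrier G" and h: "h \<in> carrier G"
    show "D' (g \<otimes> h) = D' g + D' h + A g * B h"
      unfolding D'_def Be[OF h] e_mult[OF g h] A[OF g h]
      by (cases "A g"; cases "A h"; cases "C h") (simp_all add: add_ac)
    show "E' (g \<otimes> h) = E' g + E' h + B g * C h"
      unfolding E'_def Be[OF g] e_mult[OF g h]
      by (cases "A h"; cases "C h") (simp_all add: add_ac)
    show "F' (g \<otimes> h) = F' g + F' h + A g * E' h + D' g * C h"
      unfolding D'_def E'_def F'_def e_mult[OF g h] A[OF g h]
      by (cases "A g"; cases "A h"; cases "C h") (simp_all add: add_ac)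
  qed (use T in \<open>auto simp: T'_def\<close>)
  then show ?thesis by blast
qed

text \<open>The matrix \<open>M\<close> over \<open>K\<close> with rows \<open>(1, ta, x, z)\<close>, \<open>(0, 1, tb, y)\<close>, \<open>(0, 0, 1, tc)\<close> satisfies
  \<open>Frob M = Q M\<close> with \<open>Q\<close> invariant, so that \<open>M\<^sup>-\<^sup>1 g(M)\<close> has entries in the prime field.\<close>
lemma lift_char_2:
  assumes two: "(2::'c) = 0" and root: "\<And>z. z \<in> K \<Longrightarrow> \<exists>y\<in>K. y * y + y = z"
  shows "\<exists>D' E' F' T'. lift D' E' F' T'"
proof -
  have one: "(1::'c) + 1 = 0" using two by simp
  have dbl [simp]: "w + w = 0" "w + (w + w') = w'" for w w' :: 'c
    using two by (metis mult_2 mult_zero_left) (metis add.assoc add.left_neutral mult_2 mult_zero_left two)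
  have emb [simp]: "bit_emb u \<in> K" "g \<in> carrier G \<Longrightarrow> act g (bit_emb u) = bit_emb u" for u g
    by (cases u; simp)+
  have emb_add: "bit_emb (u + v) = bit_emb u + bit_emb v" for u v
    using two by (cases u; cases v) simp_all
  have emb_mult: "bit_emb (u * v) = bit_emb u * bit_emb v" for u v
    by (cases u; cases v) simp_all
  have emb_inj: "u = v" if "bit_emb u = bit_emb v" for u v
    using that by (cases u; cases v) simp_all
  \<comment> \<open>The Artin-Schreier operator. It is additive in characteristic 2 and its kernel
    is the prime field; below, an expression is recognized as a bit by checking that
    \<open>P\<close> kills it.\<close>
  define P where "P w = w * w + w" for w :: 'c
  have P_add: "P (v + w) = P v + P w" for v w
    by (simp add: P_def algebra_simps)
  have P_emb: "P (w * bit_emb u) = P w * bit_emb u" for w u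
    by (cases u) (simp_all add: P_def)
  have P_emb0: "P (bit_emb u) = 0" for u
    using two by (cases u) (simp_all add: P_def)
  have P_act: "P (act g w) = act g (P w)" if "g \<in> carrier G" "w \<in> K" for g w
    using that by (simp add: P_def)
  have P_0: "\<exists>u. w = bit_emb u" if "P w = 0" for w
  proof -
    have "w * (w + 1) = 0" using that by (simp add: P_def algebra_simps)
    then have "w = 0 \<or> w = 1" using one by (metis add_right_imp_eq mult_eq_0_iff)
    then show ?thesis by (metis bit_emb_simps)
  qed
  have PK [simp]: "P w \<in> K" if "w \<in> K" for w using that by (simp add: P_def)
  have emb_fix: "act g (P w) = P w" if "g \<in> carrier G" "w \<in> K" "\<And>g. g \<in> carrier G \<Longrightarrow> act g w = w + bit_emb (\<phi> g)" for g w \<phi>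
    using that by (simp add: P_add P_emb0 flip: P_act)
  obtain ta where ta [simp]: "ta \<in> K" and act_ta: "\<And>g. g \<in> carrier G \<Longrightarrow> act g ta = ta + bit_emb (A g)"
    by (rule hilbert90_add[OF one T A]) (use triv in auto)
  obtain tb where tb [simp]: "tb \<in> K" and act_tb: "\<And>g. g \<in> carrier G \<Longrightarrow> act g tb = tb + bit_emb (B g)"
    by (rule hilbert90_add[OF one T B]) (use triv in auto)
  obtain tc where tc [simp]: "tc \<in> K" and act_tc: "\<And>g. g \<in> carrier G \<Longrightarrow> act g tc = tc + bit_emb (C g)"
    by (rule hilbert90_add[OF one T C]) (use triv in auto)
  define a b where "a = P ta" and "b = P tb"
  have a: "a \<in> K" "\<And>g. g \<in> carrier G \<Longrightarrow> act g a = a" and b: "b \<in> K" "\<And>g. g \<in> carrier G \<Longrightarrow> act g b = b"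
    using emb_fix[OF _ ta act_ta] emb_fix[OF _ tb act_tb] by (simp_all add: a_def b_def)
  \<comment> \<open>The equation of the matrices read entry by entry, with \<open>Q\<close> having
    superdiagonal \<open>P ta\<close>, \<open>P tb\<close>, \<open>P tc\<close> and zeros above
    it.\<close>
  obtain x where x: "x \<in> K" "P x = a * tb" using root[of "a * tb"] a by (auto simp: P_def)
  obtain y where y: "y \<in> K" "P y = b * tc" using root[of "b * tc"] b by (auto simp: P_def)
  obtain z where z: "z \<in> K" "P z = a * y" using root[of "a * y"] a y by (auto simp: P_def)
  \<comment> \<open>Here \<open>P\<close> sends \<open>act g x + x\<close> to
    \<open>a * bit_emb (B g)\<close>, and it sends \<open>ta * bit_emb (B g)\<close> to the same
    element, so the sum is killed.\<close>
  have "\<exists>u. act g x + x + ta * bit_emb (B g) = bit_emb u" if "g \<in> carrier G" for g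
    using that x a by (intro P_0) (simp add: P_add P_emb P_act act_tb algebra_simps flip: a_def)
  then obtain D' where D': "\<And>g. g \<in> carrier G \<Longrightarrow> act g x + x + ta * bit_emb (B g) = bit_emb (D' g)" by metis
  have "\<exists>u. act g y + y + tb * bit_emb (C g) = bit_emb u" if "g \<in> carrier G" for g
    using that y b by (intro P_0) (simp add: P_add P_emb P_act act_tc algebra_simps flip: b_def)
  then obtain E' where E': "\<And>g. g \<in> carrier G \<Longrightarrow> act g y + y + tb * bit_emb (C g) = bit_emb (E' g)" by metis
  have act_x: "act g x = x + ta * bit_emb (B g) + bit_emb (D' g)" if "g \<in> carrier G" for g
    by (simp add: add_ac flip: D'[OF that])
  have act_y: "act g y = y + tb * bit_emb (C g) + bit_emb (E' g)" if "g \<in> carrier G" for g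
    by (simp add: add_ac flip: E'[OF that])
  have "\<exists>u. act g z + z + ta * bit_emb (E' g) + x * bit_emb (C g) = bit_emb u" if "g \<in> carrier G" for g
    using that x z a y by (intro P_0) (simp add: P_add P_emb P_act act_y algebra_simps flip: a_def)
  then obtain F' where F': "\<And>g. g \<in> carrier G \<Longrightarrow> act g z + z + ta * bit_emb (E' g) + x * bit_emb (C g) = bit_emb (F' g)"
    by metis
  have act_z: "act g z = z + ta * bit_emb (E' g) + x * bit_emb (C g) + bit_emb (F' g)" if "g \<in> carrier G" for g
    by (simp add: add_ac flip: F'[OF that])
  have "lift D' E' F' (T \<union> {x, y, z})"
    unfolding lift_def
  proof (intro conjI ballI impI)
    fix g assume g: "g \<in> carrier G" and ag: "agree (T \<union> {x, y, z}) g \<one>"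
    then have "agree T g \<one>" by (auto simp: agree_def)
    with triv[OF g] have abc: "A g = 0" "B g = 0" "C g = 0" by auto
    then show "A g = 0" "B g = 0" "C g = 0" .
    from ag have "act g x = x" "act g y = y" "act g z = z" using x y z by (auto simp: agree_def)
    then show "D' g = 0" "E' g = 0" "F' g = 0"
      using act_x[OF g] act_y[OF g] act_z[OF g] abc emb_inj[of _ 0] by (metis add_cancel_right_right bit_emb_simps(1) mult_zero_right)+
  next
    fix g h assume g: "g \<in> carrier G" and h: "h \<in> carrier G"
    have "bit_emb (D' (g \<otimes> h)) = act g (act h x) + x + ta * bit_emb (B (g \<otimes> h))"
      using g h x by (simp add: act_comp flip: D')
    also have "\<dots> = bit_emb (D' g + D' h + A g * B h)"
      unfolding B[OF g h] using g h x by (simp add: emb_add emb_mult act_x act_ta algebra_simps)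
    finally show "D' (g \<otimes> h) = D' g + D' h + A g * B h" by (rule emb_inj)
    have "bit_emb (E' (g \<otimes> h)) = act g (act h y) + y + tb * bit_emb (C (g \<otimes> h))"
      using g h y by (simp add: act_comp flip: E')
    also have "\<dots> = bit_emb (E' g + E' h + B g * C h)"
      unfolding C[OF g h] using g h y by (simp add: emb_add emb_mult act_y act_tb algebra_simps)
    finally show E'_mult: "E' (g \<otimes> h) = E' g + E' h + B g * C h" by (rule emb_inj)
    have "bit_emb (F' (g \<otimes> h)) = act g (act h z) + z + ta * bit_emb (E' (g \<otimes> h)) + x * bit_emb (C (g \<otimes> h))"
      using g h z by (simp add: act_comp flip: F')
    also have "\<dots> = bit_emb (F' g + F' h + A g * E' h + D' g * C h)"
      unfolding E'_mult C[OF g h] using g h x y z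
      by (simp add: emb_add emb_mult act_x act_y act_z act_ta algebra_simps)
    finally show "F' (g \<otimes> h) = F' g + F' h + A g * E' h + D' g * C h" by (rule emb_inj)
  qed (use T x y z in auto)
  then show ?thesis by blast
qed

end

section \<open>The separable closure\<close>

hide_const (open) Polynomials.degree up_ring.coeff up_ring.monom Polynomials.lead_coeff module.smult Divisibility.prime

lemma card_roots_rsquarefree:
  fixes P :: "'k::alg_closed_field poly"
  assumes "rsquarefree P"
  shows "card {r. poly P r = 0} = degree P"
proof -
  have P0: "P \<noteq> 0" using assms by (simp add: rsquarefree_def)
  obtain R where R: "size R = degree P" "P = smult (lead_coeff P) (\<Prod>r\<in>#R. [:- r, 1:])"
    using alg_closed_imp_factorization[OF P0] by blast
  have "proots (\<Prod>r\<in>#N. [:- r, 1:]) = N" for N :: "'k multiset"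
  proof (induction N)
    case (add r N)
    have "(\<Prod>r\<in>#N. [:- r, 1:]) \<noteq> 0" by (auto simp: prod_mset_zero_iff)
    then show ?case using add by (simp add: proots_mult del: mult_pCons_left)
  qed simp
  then have "proots P = R"
    using P0 R(2) proots_smult[of "lead_coeff P" "\<Prod>r\<in>#R. [:- r, 1:]"] by simp
  then have "degree P = (\<Sum>r\<in>set_mset (proots P). count (proots P) r)"
    using R(1) by (simp add: size_multiset_overloaded_eq)
  also have "\<dots> = (\<Sum>r\<in>{r. poly P r = 0}. 1)"
    using P0 assms rsquarefree_root_order[of P] by (intro sum.cong) auto
  finally show ?thesis by simp
qed

lemma inj_frobenius:
  fixes y z :: "'k::field"
  assumes "prime CHAR('k)" "y ^ CHAR('k) = z ^ CHAR('k)"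
  shows "y = z"
proof -
  have "(y - z + z) ^ CHAR('k) = (y - z) ^ CHAR('k) + z ^ CHAR('k)"
    by (rule freshmans_dream[OF assms(1) refl])
  then have "(y - z) ^ CHAR('k) = 0" using assms(2) by simp
  then show ?thesis by simp
qed

context vector_space begin

lemma span_subset_span_of_card:
  assumes "independent B" "B \<subseteq> span T" "finite T" "card T \<le> card B"
  shows "span T \<subseteq> span B"
proof
  fix v assume v: "v \<in> span T"
  show "v \<in> span B"
  proof (rule ccontr)
    assume n: "v \<notin> span B"
    then have i: "independent (insert v B)" using assms by (intro independent_insertI)
    have "insert v B \<subseteq> span T" using v assms by blast
    then have "finite (insert v B)" "card (insert v B) \<le> card T"
      using independent_span_bound[OF assms(3) i] by simp_all
    moreover have "v \<notin> B" using n span_base by blast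
    ultimately show False using assms(4) by simp
  qed
qed

text \<open>A redundant vector of \<open>T\<close> would leave fewer spanning vectors than the
  independent set \<open>B\<close> has elements.\<close>

lemma independent_of_card_span:
  assumes "independent B" "B \<subseteq> span T" "finite T" "card T \<le> card B"
  shows "independent T"
proof
  assume "dependent T"
  then obtain t where t: "t \<in> T" "t \<in> span (T - {t})" by (auto simp: dependent_def)
  then have "B \<subseteq> span (T - {t})" using assms(2) span_redundant[of t "T - {t}"] by (simp add: insert_absorb)
  then have "card B \<le> card (T - {t})" using independent_span_bound[of "T - {t}" B] assms by simp
  moreover have "card (T - {t}) < card T" using t assms(3) by (rule_tac card_Diff1_less)
  ultimately show False using assms(4) by linarith
qed

end

definition ac_eval :: "'f::field poly \<Rightarrow> 'f alg_closure \<Rightarrow> 'f alg_closure" where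
  "ac_eval p z = poly (map_poly to_ac p) z"

lemma ac_eval_pCons [simp]: "ac_eval (pCons t p) z = to_ac t + z * ac_eval p z"
  by (simp add: ac_eval_def map_poly_pCons)

lemma ac_eval_0 [simp]: "ac_eval 0 z = 0" and ac_eval_1 [simp]: "ac_eval 1 z = 1"
  by (simp_all add: ac_eval_def)

lemma ac_eval_add [simp]: "ac_eval (p + q) z = ac_eval p z + ac_eval q z"
proof -
  have "map_poly to_ac (p + q) = map_poly to_ac p + map_poly to_ac q"
    by (rule poly_eqI) (simp add: coeff_map_poly)
  then show ?thesis by (simp add: ac_eval_def)
qed

lemma map_poly_to_ac_mult: "map_poly to_ac (p * q) = map_poly to_ac p * map_poly to_ac q"
  by (rule poly_eqI) (simp add: coeff_map_poly coeff_mult to_ac_sum)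

lemma ac_eval_mult [simp]: "ac_eval (p * q) z = ac_eval p z * ac_eval q z"
  by (simp add: ac_eval_def map_poly_to_ac_mult)

lemma ac_eval_sum: "ac_eval (sum f U) z = (\<Sum>x\<in>U. ac_eval (f x) z)"
  by (induction U rule: infinite_finite_induct) simp_all

lemma ac_eval_monom [simp]: "ac_eval (monom t n) z = to_ac t * z ^ n"
  by (simp add: ac_eval_def map_poly_monom poly_monom)

lemma ac_eval_pcompose [simp]: "ac_eval (pcompose p q) z = ac_eval p (ac_eval q z)"
  by (induction p) (simp_all add: pcompose_pCons)

lemma map_poly_to_ac_pderiv: "map_poly to_ac (pderiv p) = pderiv (map_poly to_ac p)"
  by (rule poly_eqI) (simp add: coeff_map_poly coeff_pderiv)

lemma degree_map_poly_to_ac [simp]: "degree (map_poly to_ac p) = degree p"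
  by (rule degree_map_poly) simp

lemma map_poly_to_ac_eq_0_iff [simp]: "map_poly to_ac p = 0 \<longleftrightarrow> p = 0"
  by (rule map_poly_eq_0_iff) auto

lemma ac_eval_altdef:
  assumes "degree p < d" shows "ac_eval p z = (\<Sum>n<d. to_ac (coeff p n) * z ^ n)"
proof -
  have "ac_eval p z = (\<Sum>n\<le>degree p. to_ac (coeff p n) * z ^ n)"
    by (simp add: ac_eval_def poly_altdef coeff_map_poly)
  also have "\<dots> = (\<Sum>n<d. to_ac (coeff p n) * z ^ n)"
    using assms by (intro sum.mono_neutral_left) (auto simp: not_le coeff_eq_0)
  finally show ?thesis .
qed

definition is_minimal_poly :: "'f::field poly \<Rightarrow> 'f alg_closure \<Rightarrow> bool" where
  "is_minimal_poly m z \<longleftrightarrow> Factorial_Ring.irreducible m \<and> ac_eval m z = 0 \<and>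
     (\<forall>h. ac_eval h z = 0 \<longrightarrow> m dvd h) \<and>
     (\<forall>h. h \<noteq> 0 \<longrightarrow> degree h < degree m \<longrightarrow> ac_eval h z \<noteq> 0)"

lemma is_minimal_polyD:
  assumes "is_minimal_poly m z"
  shows "Factorial_Ring.irreducible m" "ac_eval m z = 0" "\<And>h. ac_eval h z = 0 \<Longrightarrow> m dvd h"
    "\<And>h. h \<noteq> 0 \<Longrightarrow> degree h < degree m \<Longrightarrow> ac_eval h z \<noteq> 0"
  using assms by (simp_all add: is_minimal_poly_def)

lemma minimal_poly_exists:
  fixes z :: "'f::field alg_closure"
  shows "\<exists>m. is_minimal_poly m z"
proof -
  obtain p0 :: "'f poly" where "p0 \<noteq> 0" "ac_eval p0 z = 0"
    using alg_closure_algebraic[of z] by (metis ac_eval_def)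
  then obtain m :: "'f poly" where m: "m \<noteq> 0" "ac_eval m z = 0"
    and least: "\<And>h. h \<noteq> 0 \<Longrightarrow> ac_eval h z = 0 \<Longrightarrow> degree m \<le> degree h"
    using ex_has_least_nat[of "\<lambda>p. p \<noteq> 0 \<and> ac_eval p z = 0" p0 degree] by auto
  have dvd: "m dvd h" if "ac_eval h z = 0" for h
  proof -
    have "ac_eval h z = ac_eval (m * (h div m) + h mod m) z" by simp
    then have "ac_eval (h mod m) z = 0"
      using that by (simp only: ac_eval_add ac_eval_mult m(2) mult_zero_left add_0_left)
    then have "h mod m = 0" using least[of "h mod m"] degree_mod_less[OF m(1), of h] by force
    then show ?thesis by (simp add: dvd_eq_mod_eq_0)
  qed
  have unit: "is_unit q" if "m = p * q" "ac_eval p z = 0" for p q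
  proof -
    have nz: "p \<noteq> 0" "q \<noteq> 0" using m(1) that(1) by auto
    then have "degree q = 0" using least[OF nz(1) that(2)] that(1) by (simp add: degree_mult_eq)
    then show ?thesis using nz(2) by (simp add: is_unit_iff_degree)
  qed
  have "Factorial_Ring.irreducible m"
  proof (rule Factorial_Ring.irreducibleI)
    show "\<not> is_unit m"
    proof
      assume "is_unit m"
      then obtain n where "1 = m * n" by (auto simp: dvd_def)
      then have "ac_eval 1 z = ac_eval m z * ac_eval n z" by (metis ac_eval_mult)
      then show False using m(2) by simp
    qed
    show "is_unit p \<or> is_unit q" if "m = p * q" for p q
    proof -
      have "ac_eval p z = 0 \<or> ac_eval q z = 0" using m(2) that by simp
      then show ?thesis using unit[of p q] unit[of q p] that by (auto simp: mult.commute)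
    qed
  qed (use m in simp)
  moreover have "ac_eval h z \<noteq> 0" if "h \<noteq> 0" "degree h < degree m" for h
    using least[OF that(1)] that(2) by force
  ultimately have "is_minimal_poly m z" using m(2) dvd by (simp add: is_minimal_poly_def)
  then show ?thesis ..
qed

lemma irreducible_dvd_if_common_root:
  assumes q: "Factorial_Ring.irreducible q" "ac_eval q z = 0" and h: "ac_eval h z = 0"
  shows "q dvd h"
proof -
  obtain m where "is_minimal_poly m z" using minimal_poly_exists by blast
  note m = is_minimal_polyD[OF this]
  obtain u where u: "q = m * u" using m(3)[OF q(2)] by (auto simp: dvd_def)
  then have "is_unit u" using q(1) m(1) by (auto simp: Factorial_Ring.irreducible_def)
  then have "q dvd m" using u by (simp add: mult_unit_dvd_iff)
  then show ?thesis using m(3)[OF h] by (rule dvd_trans)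
qed

lemma double_root_iff:
  fixes P :: "'k::field poly"
  assumes "P \<noteq> 0"
  shows "Polynomial.order a P \<ge> 2 \<longleftrightarrow> poly P a = 0 \<and> poly (pderiv P) a = 0"
proof
  assume "Polynomial.order a P \<ge> 2"
  then have "[:- a, 1:] ^ 2 dvd P" by (simp add: order_divides)
  then obtain Q where "P = [:- a, 1:] ^ 2 * Q" by (elim dvdE)
  then have "P = [:- a, 1:] * ([:- a, 1:] * Q)" by (simp only: power2_eq_square mult.assoc)
  then show "poly P a = 0 \<and> poly (pderiv P) a = 0"
    by (simp add: pderiv_mult pderiv_pCons del: mult_pCons_left)
next
  assume *: "poly P a = 0 \<and> poly (pderiv P) a = 0"
  then obtain Q where Q: "P = [:- a, 1:] * Q" by (auto simp: poly_eq_0_iff_dvd)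
  then have "poly Q a = 0" using * by (simp add: pderiv_mult pderiv_pCons del: mult_pCons_left)
  then have "[:- a, 1:] dvd Q" by (simp add: poly_eq_0_iff_dvd)
  then have "[:- a, 1:] * [:- a, 1:] dvd [:- a, 1:] * Q" by (rule mult_dvd_mono[OF dvd_refl])
  then have "[:- a, 1:] ^ 2 dvd P" using Q by (simp only: power2_eq_square)
  then show "Polynomial.order a P \<ge> 2" using assms by (simp add: order_divides)
qed

lemma degree_pderiv_less:
  fixes p :: "'f::field poly"
  assumes "degree p > 0" shows "degree (pderiv p) < degree p"
proof -
  have "degree (pderiv p) \<le> degree p - 1"
    by (rule degree_le) (auto simp: coeff_pderiv coeff_eq_0)
  then show ?thesis using assms by simp
qed

lemma irreducible_degree_pos:
  fixes p :: "'f::field poly"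
  assumes "Factorial_Ring.irreducible p" shows "degree p > 0"
  using assms by (metis Factorial_Ring.irreducible_def is_unit_iff_degree not_gr_zero)

text \<open>A root shared with the derivative makes the irreducible \<open>p\<close> divide a
  polynomial of smaller degree, which must then be 0.\<close>

lemma irreducible_rsquarefree_iff:
  assumes p: "Factorial_Ring.irreducible p"
  shows "rsquarefree (map_poly to_ac p) \<longleftrightarrow> pderiv p \<noteq> 0"
proof -
  have nz: "map_poly to_ac p \<noteq> 0" using p by auto
  have "rsquarefree (map_poly to_ac p) \<longleftrightarrow> \<not> (\<exists>a. ac_eval p a = 0 \<and> ac_eval (pderiv p) a = 0)"
    using double_root_iff[OF nz] nz unfolding rsquarefree_def ac_eval_def map_poly_to_ac_pderiv
    by (metis less_2_cases_iff linorder_not_less One_nat_def)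
  moreover have "pderiv p = 0" if "ac_eval p a = 0" "ac_eval (pderiv p) a = 0" for a
    using irreducible_dvd_if_common_root[OF p that] degree_pderiv_less[OF irreducible_degree_pos[OF p]]
    by (meson dvd_imp_degree_le linorder_not_less)
  moreover have "\<exists>a. ac_eval p a = 0"
    using alg_closed_imp_poly_has_root[of "map_poly to_ac p"] irreducible_degree_pos[OF p]
    by (simp add: ac_eval_def)
  ultimately show ?thesis by fastforce
qed

text \<open>The polynomial need not be irreducible: the minimal polynomial divides it and inherits
  the nonzero derivative. This form makes adjoining roots a matter of composing polynomials.\<close>

lemma separable_closure_iff: "z \<in> separable_closure \<longleftrightarrow> (\<exists>p. ac_eval p z = 0 \<and> ac_eval (pderiv p) z \<noteq> 0)"
proof
  assume "z \<in> separable_closure"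
  then obtain p where p: "Factorial_Ring.irreducible p" "rsquarefree (map_poly to_ac p)" "ac_eval p z = 0"
    by (auto simp: separable_closure_def ac_eval_def)
  have "Polynomial.order z (map_poly to_ac p) < 2" using p(2) by (auto simp: rsquarefree_def) (metis One_nat_def Suc_1 lessI less_2_cases_iff)
  then have "ac_eval (pderiv p) z \<noteq> 0"
    using double_root_iff[of "map_poly to_ac p" z] p by (auto simp: ac_eval_def map_poly_to_ac_pderiv rsquarefree_def)
  with p(3) show "\<exists>p. ac_eval p z = 0 \<and> ac_eval (pderiv p) z \<noteq> 0" by blast
next
  assume "\<exists>p. ac_eval p z = 0 \<and> ac_eval (pderiv p) z \<noteq> 0"
  then obtain p where p: "ac_eval p z = 0" "ac_eval (pderiv p) z \<noteq> 0" by blast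
  obtain m where "is_minimal_poly m z" using minimal_poly_exists by blast
  note m = is_minimal_polyD[OF this]
  obtain k where "p = m * k" using m(3)[OF p(1)] by (auto simp: dvd_def)
  then have "pderiv m \<noteq> 0" using p(2) m(2) by (auto simp: pderiv_mult)
  then show "z \<in> separable_closure"
    using m irreducible_rsquarefree_iff[of m] by (auto simp: separable_closure_def ac_eval_def)
qed

text \<open>Inseparability forces the derivative of \<open>m\<close> to vanish, so \<open>m\<close>
  is a polynomial in the power of X with exponent the characteristic.\<close>

lemma not_separable_imp:
  fixes w :: "'f::field alg_closure"
  assumes "w \<notin> separable_closure" and m: "Factorial_Ring.irreducible m" "ac_eval m w = 0"
  shows "prime CHAR('f)" and "\<exists>g. g \<noteq> 0 \<and> degree g < degree m \<and> ac_eval g (w ^ CHAR('f)) = 0"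
proof -
  let ?q = "CHAR('f)"
  have "pderiv m = 0"
    using assms irreducible_rsquarefree_iff[of m] by (auto simp: separable_closure_def ac_eval_def)
  then have co: "coeff m n = 0" if "\<not> ?q dvd n" for n
  proof (cases n)
    case (Suc k)
    then have "of_nat n * coeff m n = 0" using \<open>pderiv m = 0\<close> coeff_pderiv[of m k] by simp
    then show ?thesis using that of_nat_eq_0_iff_char_dvd[of n, where 'a = 'f] by auto
  qed (use that in simp)
  have dm: "degree m > 0" using m irreducible_degree_pos by blast
  then have "coeff m (degree m) \<noteq> 0" by auto
  then have qdm: "?q dvd degree m" using co by blast
  then have "?q \<noteq> 0" using dm by auto
  then show prime: "prime ?q" using prime_CHAR_semidom by blast
  have q2: "?q \<ge> 2" using prime prime_ge_2_nat by blast
  \<comment> \<open>The coefficients of \<open>m\<close> at multiples of the characteristic; all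
    others vanish by \<open>co\<close>.\<close>
  define g where "g = (\<Sum>n\<le>degree m div ?q. monom (coeff m (?q * n)) n)"
  have cg: "coeff g n = (if n \<le> degree m div ?q then coeff m (?q * n) else 0)" for n
    by (auto simp: g_def coeff_sum coeff_monom if_distrib cong: if_cong)
  have "coeff g (degree m div ?q) \<noteq> 0" using qdm dm by (auto simp: cg)
  then have g0: "g \<noteq> 0" by auto
  have "degree g \<le> degree m div ?q" by (rule degree_le) (simp add: cg)
  moreover have "degree m div ?q < degree m" using q2 dm by (intro div_less_dividend) auto
  ultimately have "degree g < degree m" by linarith
  moreover have "ac_eval g (w ^ ?q) = ac_eval m w"
  proof -
    have "ac_eval m w = (\<Sum>n<Suc (degree m). to_ac (coeff m n) * w ^ n)" by (rule ac_eval_altdef) simp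
    also have "\<dots> = (\<Sum>n\<in>(\<lambda>n. ?q * n) ` {..degree m div ?q}. to_ac (coeff m n) * w ^ n)"
    proof (intro sum.mono_neutral_right ballI)
      show "(\<lambda>n. ?q * n) ` {..degree m div ?q} \<subseteq> {..<Suc (degree m)}"
        using \<open>?q \<noteq> 0\<close> by (auto simp: less_Suc_eq_le less_eq_div_iff_mult_less_eq mult.commute)
      fix n assume n: "n \<in> {..<Suc (degree m)} - (\<lambda>n. ?q * n) ` {..degree m div ?q}"
      have "\<not> ?q dvd n"
      proof
        assume "?q dvd n"
        then obtain k where "n = ?q * k" by (auto simp: dvd_def)
        then show False using n \<open>?q \<noteq> 0\<close> by (auto simp: less_Suc_eq_le less_eq_div_iff_mult_less_eq mult.commute)
      qed
      then show "to_ac (coeff m n) * w ^ n = 0" by (simp add: co)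
    qed simp
    also have "\<dots> = (\<Sum>n\<le>degree m div ?q. to_ac (coeff m (?q * n)) * w ^ (?q * n))"
      using \<open>?q \<noteq> 0\<close> by (subst sum.reindex) (auto simp: inj_on_def)
    also have "\<dots> = ac_eval g (w ^ ?q)"
      by (simp add: g_def ac_eval_sum power_mult)
    finally show ?thesis ..
  qed
  ultimately show "\<exists>g. g \<noteq> 0 \<and> degree g < degree m \<and> ac_eval g (w ^ ?q) = 0" using m g0 by auto
qed

section \<open>Separable elements through linear independence of p-th powers\<close>

interpretation ac: vector_space "\<lambda>(t::'f::field) (z::'f alg_closure). to_ac t * z"
  by standard (simp_all add: algebra_simps)

text \<open>Translates degrees of annihilating polynomials into linear algebra. Injectivity is
  stated separately because the image set would hide a coincidence of two powers.\<close>

lemma powers_independent_iff: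
  fixes z :: "'f::field alg_closure"
  shows "inj_on (\<lambda>n. z ^ n) {..<d} \<and> ac.independent ((\<lambda>n. z ^ n) ` {..<d}) \<longleftrightarrow>
     (\<forall>h. h \<noteq> 0 \<longrightarrow> degree h < d \<longrightarrow> ac_eval h z \<noteq> 0)"
proof (intro iffI allI impI conjI)
  fix h :: "'f poly" assume *: "inj_on (\<lambda>n. z ^ n) {..<d} \<and> ac.independent ((\<lambda>n. z ^ n) ` {..<d})"
    and h: "h \<noteq> 0" "degree h < d"
  show "ac_eval h z \<noteq> 0"
  proof
    assume h0: "ac_eval h z = 0"
    define u where "u v = coeff h (the_inv_into {..<d} (\<lambda>n. z ^ n) v)" for v
    have "(\<Sum>v\<in>(\<lambda>n. z ^ n) ` {..<d}. to_ac (u v) * v) = (\<Sum>n<d. to_ac (coeff h n) * z ^ n)"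
      using * by (subst sum.reindex) (auto simp: u_def the_inv_into_f_f intro!: sum.cong)
    also have "\<dots> = 0" using h h0 ac_eval_altdef[of h d z] by simp
    finally have "\<forall>v\<in>(\<lambda>n. z ^ n) ` {..<d}. u v = 0"
      using * ac.dependent_finite[of "(\<lambda>n. z ^ n) ` {..<d}"] by auto
    then have "u (z ^ degree h) = 0" using h(2) by blast
    then show False using * h by (simp add: u_def the_inv_into_f_f)
  qed
next
  assume *: "\<forall>h. h \<noteq> 0 \<longrightarrow> degree h < d \<longrightarrow> ac_eval h z \<noteq> 0"
  show inj: "inj_on (\<lambda>n. z ^ n) {..<d}"
  proof (rule inj_onI, rule ccontr)
    fix a b assume ab: "a \<in> {..<d}" "b \<in> {..<d}" "z ^ a = z ^ b" "a \<noteq> b"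
    let ?h = "monom 1 a + monom (- 1) b :: 'f poly"
    have "coeff ?h a = 1" using ab by simp
    then have "?h \<noteq> 0" by (metis coeff_0 zero_neq_one)
    moreover have "degree ?h < d"
      using ab by (intro degree_add_less) (auto intro: le_less_trans[OF degree_monom_le])
    ultimately show False using *[rule_format, of ?h] ab(3) by simp
  qed
  show "ac.independent ((\<lambda>n. z ^ n) ` {..<d})"
  proof
    assume "ac.dependent ((\<lambda>n. z ^ n) ` {..<d})"
    then obtain u where u: "\<exists>v\<in>(\<lambda>n. z ^ n) ` {..<d}. u v \<noteq> 0" "(\<Sum>v\<in>(\<lambda>n. z ^ n) ` {..<d}. to_ac (u v) * v) = 0"
      using ac.dependent_finite[of "(\<lambda>n. z ^ n) ` {..<d}"] by auto
    define h where "h = (\<Sum>n<d. monom (u (z ^ n)) n)"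
    have ch: "coeff h n = (if n < d then u (z ^ n) else 0)" for n
      by (auto simp: h_def coeff_sum coeff_monom if_distrib cong: if_cong)
    obtain n where n: "n < d" "u (z ^ n) \<noteq> 0" using u(1) by auto
    then have "h \<noteq> 0" using ch[of n] by auto
    moreover have "degree h < d"
      by (rule degree_lessI) (use n ch in \<open>auto\<close>)
    moreover have "ac_eval h z = 0"
      using u(2) inj by (simp add: h_def ac_eval_sum sum.reindex)
    ultimately show False using * by blast
  qed
qed

text \<open>Finite-dimensional algebras spanned by their \<open>p\<close>-th powers, where \<open>p\<close> is the characteristic:
  they consist of separable elements, and are closed under composita.\<close>
definition separable_algebra :: "'f::field alg_closure set \<Rightarrow> bool" where
  "separable_algebra M \<longleftrightarrow> (\<exists>B. finite B \<and> M = ac.span B) \<and> 1 \<in> M \<and>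
     (\<forall>y\<in>M. \<forall>z\<in>M. y * z \<in> M) \<and> M \<subseteq> ac.span ((\<lambda>m. m ^ CHAR('f)) ` M)"

text \<open>Extend the independent powers of \<open>w\<close> to a basis. The p-th powers of the
  basis still span, so by counting they are independent, and in particular the powers of
  \<open>w ^ ?q\<close> below the degree of \<open>m\<close> are. For inseparable \<open>w\<close>
  this contradicts \<open>not_separable_imp\<close>.\<close>

lemma separable_algebra_subset:
  fixes M :: "'f::field alg_closure set"
  assumes M: "separable_algebra M"
  shows "M \<subseteq> separable_closure"
proof
  fix w assume w: "w \<in> M"
  show "w \<in> separable_closure"
  proof (rule ccontr)
    assume ns: "w \<notin> separable_closure"
    let ?q = "CHAR('f)"
    obtain m where "is_minimal_poly m w" using minimal_poly_exists by blast
    note m = is_minimal_polyD[OF this]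
    note q = not_separable_imp(1)[OF ns m(1,2)]
    obtain g where g: "g \<noteq> 0" "degree g < degree m" "ac_eval g (w ^ ?q) = 0"
      using not_separable_imp(2)[OF ns m(1,2)] by blast
    let ?d = "degree m" and ?fr = "\<lambda>z::'f alg_closure. z ^ ?q"
    have pw: "inj_on (\<lambda>n. w ^ n) {..<?d}" "ac.independent ((\<lambda>n. w ^ n) ` {..<?d})"
      using powers_independent_iff[of w ?d] m(4) by blast+
    have powM: "w ^ n \<in> M" for n using w M by (induction n) (auto simp: separable_algebra_def)
    obtain B where B: "(\<lambda>n. w ^ n) ` {..<?d} \<subseteq> B" "B \<subseteq> M" "ac.independent B" "M \<subseteq> ac.span B"
      using ac.maximal_independent_subset_extend[of "(\<lambda>n. w ^ n) ` {..<?d}" M] pw powM by blast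
    have finB: "finite B" using M B ac.independent_span_bound unfolding separable_algebra_def by metis
    have "?fr z \<in> ac.span (?fr ` B)" if "z \<in> M" for z
    proof -
      have "z \<in> ac.span B" using that B by blast
      then obtain u where "z = (\<Sum>v\<in>B. to_ac (u v) * v)" using ac.span_finite[OF finB] by auto
      then have "?fr z = (\<Sum>v\<in>B. to_ac (u v ^ ?q) * ?fr v)"
        using q by (simp add: freshmans_dream_sum power_mult_distrib)
      also have "\<dots> \<in> ac.span (?fr ` B)" by (intro ac.span_sum ac.span_scale ac.span_base) auto
      finally show ?thesis .
    qed
    then have "ac.span (?fr ` M) \<subseteq> ac.span (?fr ` B)" by (intro ac.span_minimal) (auto simp: ac.subspace_span)
    then have Bsp: "B \<subseteq> ac.span (?fr ` B)" using M B unfolding separable_algebra_def by blast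
    have "ac.independent (?fr ` B)"
      using ac.independent_of_card_span[OF B(3) Bsp] finB card_image_le by blast
    moreover have "(\<lambda>n. (w ^ ?q) ^ n) ` {..<?d} \<subseteq> ?fr ` B"
      using B(1) by (auto simp: mult.commute simp flip: power_mult) (simp add: power_mult image_subset_iff)
    ultimately have "ac.independent ((\<lambda>n. (w ^ ?q) ^ n) ` {..<?d})" using ac.independent_mono by blast
    moreover have "inj_on (\<lambda>n. (w ^ ?q) ^ n) {..<?d}"
    proof (rule inj_onI)
      fix a b assume ab: "a \<in> {..<?d}" "b \<in> {..<?d}" "(w ^ ?q) ^ a = (w ^ ?q) ^ b"
      then have "(w ^ a) ^ CHAR('f alg_closure) = (w ^ b) ^ CHAR('f alg_closure)" by (simp add: mult.commute flip: power_mult)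
      then have "w ^ a = w ^ b" by (rule inj_frobenius[rotated]) (use q in simp)
      then show "a = b" using pw(1) ab by (auto dest: inj_onD)
    qed
    ultimately show False using powers_independent_iff[of "w ^ ?q" ?d] g by blast
  qed
qed

text \<open>\<open>M\<close> is the algebra F[z]. If some nonzero \<open>g\<close> of degree below
  that of \<open>m\<close> killed \<open>z ^ ?q\<close>, then \<open>m\<close> would divide g(X^p),
  and the distinct roots of \<open>m\<close>, as many as its degree, would have distinct p-th powers
  that are all roots of \<open>g\<close>.\<close>

lemma separable_algebra_generated:
  fixes z :: "'f::field alg_closure"
  assumes q: "prime CHAR('f)" and z: "z \<in> separable_closure"
  shows "\<exists>M. separable_algebra M \<and> z \<in> M"
proof -
  let ?q = "CHAR('f)"
  obtain m where "is_minimal_poly m z" using minimal_poly_exists by blast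
  note m = is_minimal_polyD[OF this]
  let ?d = "degree m"
  have dm: "?d > 0" using m irreducible_degree_pos by blast
  define M where "M = range (\<lambda>p. ac_eval p z)"
  have m0: "m \<noteq> 0" using dm by auto
  have Msp: "M = ac.span ((\<lambda>n. z ^ n) ` {..<?d})"
  proof (intro antisym subsetI)
    fix y assume "y \<in> M"
    then obtain p where "y = ac_eval p z" by (auto simp: M_def)
    also have "\<dots> = ac_eval (m * (p div m) + p mod m) z" by simp
    also have "\<dots> = ac_eval (p mod m) z" by (simp only: ac_eval_add ac_eval_mult m(2) mult_zero_left add_0_left)
    also have "\<dots> = (\<Sum>n<?d. to_ac (coeff (p mod m) n) * z ^ n)"
      using degree_mod_less[OF m0, of p] dm by (intro ac_eval_altdef) auto
    also have "\<dots> \<in> ac.span ((\<lambda>n. z ^ n) ` {..<?d})" by (intro ac.span_sum ac.span_scale ac.span_base) auto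
    finally show "y \<in> ac.span ((\<lambda>n. z ^ n) ` {..<?d})" .
  next
    fix y assume "y \<in> ac.span ((\<lambda>n. z ^ n) ` {..<?d})"
    then show "y \<in> M"
    proof (induction rule: ac.span_induct_alt)
      case base
      show ?case unfolding M_def by (rule range_eqI[of _ _ 0]) simp
    next
      case (step c x y)
      then obtain n p where "x = z ^ n" "y = ac_eval p z" by (auto simp: M_def)
      then show ?case unfolding M_def by (intro range_eqI[of _ _ "monom c n + p"]) simp
    qed
  qed
  have "\<not> (\<exists>g. g \<noteq> 0 \<and> degree g < ?d \<and> ac_eval g (z ^ ?q) = 0)"
  proof
    assume "\<exists>g. g \<noteq> 0 \<and> degree g < ?d \<and> ac_eval g (z ^ ?q) = 0"
    then obtain g where g: "g \<noteq> 0" "degree g < ?d" "ac_eval g (z ^ ?q) = 0" by blast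
    have "m dvd pcompose g (monom 1 ?q)" by (rule m(3)) (use g in simp)
    then obtain k where k: "pcompose g (monom 1 ?q) = m * k" by (auto simp: dvd_def)
    have root: "ac_eval g (r ^ ?q) = 0" if "ac_eval m r = 0" for r
      using arg_cong[OF k, of "\<lambda>p. ac_eval p r"] that by simp
    obtain p where p: "ac_eval p z = 0" "ac_eval (pderiv p) z \<noteq> 0" using z separable_closure_iff by blast
    obtain k' where "p = m * k'" using m(3)[OF p(1)] by (auto simp: dvd_def)
    then have "pderiv m \<noteq> 0" using p(2) m(2) by (auto simp: pderiv_mult)
    then have "card {r. poly (map_poly to_ac m) r = 0} = ?d"
      using m(1) irreducible_rsquarefree_iff card_roots_rsquarefree by fastforce
    then have d: "card {r. ac_eval m r = 0} = ?d" by (simp add: ac_eval_def)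
    have fing: "finite {r. ac_eval g r = 0}" using g(1) poly_roots_finite[of "map_poly to_ac g"] by (simp add: ac_eval_def)
    have "?d = card ((\<lambda>r. r ^ ?q) ` {r. ac_eval m r = 0})"
      unfolding d[symmetric] using inj_frobenius[where 'k = "'f alg_closure"] q
      by (intro card_image[symmetric] inj_onI) simp
    also have "\<dots> \<le> card {r. ac_eval g r = 0}" using root by (intro card_mono fing) auto
    also have "\<dots> \<le> degree g" using card_poly_roots_bound[of "map_poly to_ac g"] g(1) by (simp add: ac_eval_def)
    finally show False using g(2) by simp
  qed
  then have pw: "inj_on (\<lambda>n. (z ^ ?q) ^ n) {..<?d}" "ac.independent ((\<lambda>n. (z ^ ?q) ^ n) ` {..<?d})"
    using powers_independent_iff[of "z ^ ?q" ?d] by blast+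
  have powM: "z ^ n \<in> M" for n unfolding M_def by (rule range_eqI[of _ _ "monom 1 n"]) simp
  have "M \<subseteq> ac.span ((\<lambda>n. (z ^ ?q) ^ n) ` {..<?d})"
    unfolding Msp
  proof (rule ac.span_subset_span_of_card[OF pw(2)])
    show "(\<lambda>n. (z ^ ?q) ^ n) ` {..<?d} \<subseteq> ac.span ((\<lambda>n. z ^ n) ` {..<?d})"
      using powM unfolding Msp by (auto simp flip: power_mult)
    show "card ((\<lambda>n. z ^ n) ` {..<?d}) \<le> card ((\<lambda>n. (z ^ ?q) ^ n) ` {..<?d})"
      using card_image_le[of "{..<?d}" "\<lambda>n. z ^ n"] card_image[OF pw(1)] by simp
  qed simp
  also have "\<dots> \<subseteq> ac.span ((\<lambda>m. m ^ ?q) ` M)"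
  proof (intro ac.span_mono subsetI)
    fix y assume "y \<in> (\<lambda>n. (z ^ ?q) ^ n) ` {..<?d}"
    then obtain n where "y = (z ^ n) ^ ?q" by (auto simp: mult.commute simp flip: power_mult)
    then show "y \<in> (\<lambda>m. m ^ ?q) ` M" using powM by blast
  qed
  finally have "M \<subseteq> ac.span ((\<lambda>m. m ^ ?q) ` M)" .
  moreover have "x * y \<in> M" if "x \<in> M" "y \<in> M" for x y
    using that unfolding M_def by (auto simp flip: ac_eval_mult)
  ultimately have "separable_algebra M"
    using powM[of 0] unfolding separable_algebra_def by (auto simp: Msp intro!: exI[of _ "(\<lambda>n. z ^ n) ` {..<?d}"])
  then show ?thesis using powM[of 1] by auto
qed

text \<open>Products of p-th powers are p-th powers of products, so the span of all products of
  elements of \<open>M\<close> and \<open>N\<close> inherits the property.\<close>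

lemma separable_algebra_compositum:
  fixes M N :: "'f::field alg_closure set"
  assumes q: "prime CHAR('f)" and M: "separable_algebra M" and N: "separable_algebra N"
  shows "\<exists>L. separable_algebra L \<and> M \<subseteq> L \<and> N \<subseteq> L"
proof -
  let ?q = "CHAR('f)"
  obtain B C where B: "finite B" "M = ac.span B" and C: "finite C" "N = ac.span C"
    using M N unfolding separable_algebra_def by auto
  define mul where "mul U Y = {x * y | x y. x \<in> U \<and> y \<in> Y}" for U Y :: "'f alg_closure set"
  have span_mul: "x * y \<in> ac.span (mul U Y)" if x: "x \<in> ac.span U" and y: "y \<in> ac.span Y" for x y U Y
    using x
  proof (induction rule: ac.span_induct_alt)
    case base
    show ?case by (simp add: ac.span_zero)
  next
    case (step c x x')
    have "x * y \<in> ac.span (mul U Y)"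
      using y
    proof (induction rule: ac.span_induct_alt)
      case base
      show ?case by (simp add: ac.span_zero)
    next
      case (step d y y')
      have "x * y \<in> mul U Y" using \<open>x \<in> U\<close> step unfolding mul_def by blast
      then have "to_ac d * (x * y) + x * y' \<in> ac.span (mul U Y)"
        using step by (simp add: ac.span_add ac.span_scale ac.span_base)
      then show ?case by (simp add: algebra_simps)
    qed
    then have "to_ac c * (x * y) + x' * y \<in> ac.span (mul U Y)"
      using step by (intro ac.span_add ac.span_scale) auto
    then show ?case by (simp add: algebra_simps)
  qed
  have span_sub: "ac.span (mul (ac.span U) (ac.span Y)) \<subseteq> ac.span (mul U Y)" for U Y
    using span_mul by (intro ac.span_minimal ac.subspace_span) (auto simp: mul_def)
  define L where "L = ac.span (mul M N)"
  have one: "1 \<in> M" "1 \<in> N" using M N by (auto simp: separable_algebra_def)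
  have "separable_algebra L"
    unfolding separable_algebra_def
  proof (intro conjI ballI)
    have "mul B C = (\<lambda>(x, y). x * y) ` (B \<times> C)" by (auto simp: mul_def)
    then have "finite (mul B C)" using B C by simp
    moreover have "mul B C \<subseteq> mul M N" using B C ac.span_base unfolding mul_def by blast
    then have "L = ac.span (mul B C)"
      using span_sub[of B C] B C ac.span_mono unfolding L_def by blast
    ultimately show "\<exists>B. finite B \<and> L = ac.span B" by blast
    have "1 * 1 \<in> mul M N" using one unfolding mul_def by blast
    then show "1 \<in> L" unfolding L_def by (simp add: ac.span_base)
    have "mul (mul M N) (mul M N) \<subseteq> mul M N"
    proof
      fix v assume "v \<in> mul (mul M N) (mul M N)"
      then obtain x y x' y' where v: "v = (x * y) * (x' * y')" "x \<in> M" "x' \<in> M" "y \<in> N" "y' \<in> N"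
        by (auto simp: mul_def)
      then have "v = (x * x') * (y * y')" "x * x' \<in> M" "y * y' \<in> N"
        using M N by (auto simp: separable_algebra_def mult_ac)
      then show "v \<in> mul M N" unfolding mul_def by blast
    qed
    then show "y * z \<in> L" if "y \<in> L" "z \<in> L" for y z
      using span_mul[of y "mul M N" z "mul M N"] that ac.span_mono unfolding L_def by blast
    have "mul M N \<subseteq> ac.span (mul ((\<lambda>m. m ^ ?q) ` M) ((\<lambda>m. m ^ ?q) ` N))"
      using M N span_mul unfolding separable_algebra_def mul_def by blast
    moreover have "mul ((\<lambda>m. m ^ ?q) ` M) ((\<lambda>m. m ^ ?q) ` N) \<subseteq> (\<lambda>m. m ^ ?q) ` L"
    proof
      fix v assume "v \<in> mul ((\<lambda>m. m ^ ?q) ` M) ((\<lambda>m. m ^ ?q) ` N)"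
      then obtain x y where v: "v = (x * y) ^ ?q" "x \<in> M" "y \<in> N"
        by (auto simp: mul_def power_mult_distrib)
      then have "x * y \<in> L" unfolding L_def by (intro ac.span_base) (auto simp: mul_def)
      then show "v \<in> (\<lambda>m. m ^ ?q) ` L" using v by blast
    qed
    then have "ac.span (mul ((\<lambda>m. m ^ ?q) ` M) ((\<lambda>m. m ^ ?q) ` N)) \<subseteq> ac.span ((\<lambda>m. m ^ ?q) ` L)"
      by (rule ac.span_mono)
    ultimately have "mul M N \<subseteq> ac.span ((\<lambda>m. m ^ ?q) ` L)" by (rule order_trans)
    then have "ac.span (mul M N) \<subseteq> ac.span ((\<lambda>m. m ^ ?q) ` L)"
      by (rule ac.span_minimal) (rule ac.subspace_span)
    then show "L \<subseteq> ac.span ((\<lambda>m. m ^ ?q) ` L)" by (simp only: L_def)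
  qed
  moreover have "x * 1 \<in> mul M N" if "x \<in> M" for x using that one unfolding mul_def by blast
  moreover have "1 * y \<in> mul M N" if "y \<in> N" for y using that one unfolding mul_def by blast
  ultimately show ?thesis unfolding L_def
    by (intro exI[of _ "ac.span (mul M N)"]) (auto intro!: ac.span_base)
qed

lemma separable_closure_to_ac: "to_ac t \<in> separable_closure"
  unfolding separable_closure_iff by (rule exI[of _ "[:- t, 1:]"]) (simp add: pderiv_pCons)

text \<open>In prime characteristic both elements lie in a common separable algebra. Otherwise every
  algebraic element is separable by \<open>not_separable_imp\<close>.\<close>

lemma separable_closure_add_mult:
  fixes y z :: "'f::field alg_closure"
  assumes y: "y \<in> separable_closure" and z: "z \<in> separable_closure"
  shows "y + z \<in> separable_closure \<and> y * z \<in> separable_closure"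
proof (cases "prime CHAR('f)")
  case True
  obtain M N where MN: "separable_algebra M" "y \<in> M" "separable_algebra N" "z \<in> N"
    using separable_algebra_generated[OF True] y z by metis
  obtain L where L: "separable_algebra L" "M \<subseteq> L" "N \<subseteq> L"
    using separable_algebra_compositum[OF True MN(1,3)] by blast
  then have yz: "y \<in> L" "z \<in> L" using MN by auto
  have "y * z \<in> L" using L(1) yz by (simp add: separable_algebra_def)
  moreover have "y + z \<in> L" using L(1) yz ac.span_add unfolding separable_algebra_def by metis
  ultimately show ?thesis using separable_algebra_subset[OF L(1)] by blast
next
  case False
  have "w \<in> separable_closure" for w :: "'f alg_closure"
    using minimal_poly_exists[of w] not_separable_imp(1)[of w] False is_minimal_polyD(1,2) by blast
  then show ?thesis by blast
qed

lemma separable_closure_minus: "z \<in> separable_closure \<Longrightarrow> - z \<in> separable_closure"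
  using separable_closure_add_mult[OF separable_closure_to_ac[of "- 1"], of z] by simp

lemma separable_closure_ac_eval:
  assumes z: "z \<in> separable_closure" shows "ac_eval h z \<in> separable_closure"
proof (induction h)
  case (pCons a h)
  then show ?case
    using separable_closure_add_mult[OF separable_closure_to_ac[of a], of "z * ac_eval h z"]
      separable_closure_add_mult[OF z, of "ac_eval h z"] by simp
qed (use separable_closure_to_ac[of 0] in simp)

text \<open>With minimal polynomial t + X p, the inverse is -p(z)/t, a polynomial in
  \<open>z\<close>; minimality gives p(z) \<noteq> 0 and hence t \<noteq> 0.\<close>

lemma separable_closure_inverse:
  assumes z: "z \<in> separable_closure" shows "inverse z \<in> separable_closure"
proof (cases "z = 0")
  case False
  obtain m where "is_minimal_poly m z" using minimal_poly_exists by blast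
  note m = is_minimal_polyD[OF this]
  obtain t p where tp: "m = pCons t p" by (cases m)
  have "p \<noteq> 0" using irreducible_degree_pos[OF m(1)] tp by auto
  then have "ac_eval p z \<noteq> 0" using m(4)[of p] tp by simp
  have t: "to_ac t + z * ac_eval p z = 0" using m(2) tp by simp
  then have "t \<noteq> 0" using \<open>ac_eval p z \<noteq> 0\<close> False by auto
  have "ac_eval p z \<in> separable_closure" by (rule separable_closure_ac_eval[OF z])
  then have "to_ac (- inverse t) * ac_eval p z \<in> separable_closure"
    using separable_closure_add_mult separable_closure_to_ac by blast
  moreover have zp: "z * ac_eval p z = - to_ac t" using t by (simp add: add_eq_0_iff)
  have "z * (to_ac (- inverse t) * ac_eval p z) = - inverse (to_ac t) * (z * ac_eval p z)"
    by (simp add: mult_ac)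
  then have "z * (to_ac (- inverse t) * ac_eval p z) = 1"
    unfolding zp using \<open>t \<noteq> 0\<close> by simp
  then have "inverse z = to_ac (- inverse t) * ac_eval p z" by (rule inverse_unique)
  ultimately show ?thesis by simp
qed (use z in simp)

text \<open>If \<open>p\<close> has the simple root \<open>z\<close>, then p(X^2) has the simple
  root \<open>y\<close>: its derivative there is p'(z) times 2y.\<close>

lemma separable_closure_sqrt:
  fixes z :: "'f::field alg_closure"
  assumes two: "(2 :: 'f alg_closure) \<noteq> 0" and z: "z \<in> separable_closure"
  shows "\<exists>y\<in>separable_closure. y * y = z"
proof -
  obtain y where y: "y ^ 2 = z" using nth_root_exists[of 2 z] by auto
  obtain p where p: "ac_eval p z = 0" "ac_eval (pderiv p) z \<noteq> 0" using z separable_closure_iff by blast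
  have "y \<in> separable_closure"
  proof (cases "y = 0")
    case False
    have ev: "ac_eval [:0, 0, 1:] y = z" using y by (simp add: power2_eq_square)
    have "ac_eval (pderiv (pcompose p [:0, 0, 1:])) y = ac_eval (pderiv p) z * (2 * y)"
      by (simp only: pderiv_pcompose ac_eval_mult ac_eval_pcompose ev) (simp add: pderiv_pCons)
    moreover have "ac_eval (pcompose p [:0, 0, 1:]) y = 0" by (simp only: ac_eval_pcompose ev p)
    ultimately show ?thesis unfolding separable_closure_iff
      using p two False by (intro exI[of _ "pcompose p [:0, 0, 1:]"]) simp
  qed (use separable_closure_to_ac[of 0] in simp)
  then show ?thesis using y by (auto simp: power2_eq_square)
qed

text \<open>As for square roots, with X^2 + X in place of X^2; its derivative is the constant 1 in
  characteristic 2.\<close>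

lemma separable_closure_artin_schreier:
  fixes z :: "'f::field alg_closure"
  assumes two: "(2 :: 'f alg_closure) = 0" and z: "z \<in> separable_closure"
  shows "\<exists>y\<in>separable_closure. y * y + y = z"
proof -
  obtain y where y: "poly [:- z, 1, 1:] y = 0"
    using alg_closed_imp_poly_has_root[of "[:- z, 1, 1:]"] by auto
  obtain p where p: "ac_eval p z = 0" "ac_eval (pderiv p) z \<noteq> 0" using z separable_closure_iff by blast
  have ev: "ac_eval [:0, 1, 1:] y = z" using y by (simp add: algebra_simps)
  have "(2::'f) = 0" using two by (metis to_ac_numeral to_ac_eq_0_iff)
  then have "ac_eval (pderiv [:0, 1, 1:]) y = 1" by (simp add: pderiv_pCons)
  then have "ac_eval (pderiv (pcompose p [:0, 1, 1:])) y = ac_eval (pderiv p) z"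
    by (simp only: pderiv_pcompose ac_eval_mult ac_eval_pcompose ev mult_1_right)
  moreover have "ac_eval (pcompose p [:0, 1, 1:]) y = 0" by (simp only: ac_eval_pcompose ev p)
  ultimately have "y \<in> separable_closure" unfolding separable_closure_iff
    using p by (intro exI[of _ "pcompose p [:0, 1, 1:]"]) simp
  then show ?thesis using y by (auto simp: algebra_simps)
qed

section \<open>The absolute Galois group\<close>

lemma galois_carrierD:
  assumes "\<sigma> \<in> galois_carrier"
  shows "\<sigma> \<in> Bij separable_closure" "\<sigma> (to_ac t) = to_ac t"
    "z \<in> separable_closure \<Longrightarrow> \<sigma> z \<in> separable_closure"
    "y \<in> separable_closure \<Longrightarrow> z \<in> separable_closure \<Longrightarrow> \<sigma> (y + z) = \<sigma> y + \<sigma> z"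
    "y \<in> separable_closure \<Longrightarrow> z \<in> separable_closure \<Longrightarrow> \<sigma> (y * z) = \<sigma> y * \<sigma> z"
  using assms Bij_imp_funcset by (auto simp: galois_carrier_def)

lemma galois_mult_eq:
  "\<sigma> \<in> galois_carrier \<Longrightarrow> \<tau> \<in> galois_carrier \<Longrightarrow>
     \<sigma> \<otimes>\<^bsub>absolute_galois_group F\<^esub> \<tau> = compose separable_closure \<sigma> \<tau>"
  by (simp add: absolute_galois_group_def BijGroup_def galois_carrierD(1))

lemma galois_carrier_eq [simp]: "carrier (absolute_galois_group F) = galois_carrier"
  by (simp add: absolute_galois_group_def)

lemma galois_one_eq: "\<one>\<^bsub>absolute_galois_group F\<^esub> = (\<lambda>z\<in>separable_closure. z)"
  by (simp add: absolute_galois_group_def BijGroup_def)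

lemma group_absolute_galois_group: "group (absolute_galois_group F)"
proof (rule groupI)
  note sep = separable_closure_add_mult separable_closure_to_ac
  show st: "\<sigma> \<otimes>\<^bsub>absolute_galois_group F\<^esub> \<tau> \<in> carrier (absolute_galois_group F)"
    if "\<sigma> \<in> carrier (absolute_galois_group F)" "\<tau> \<in> carrier (absolute_galois_group F)" for \<sigma> \<tau>
  proof -
    have sG: "\<sigma> \<in> galois_carrier" and tG: "\<tau> \<in> galois_carrier" using that by simp_all
    show ?thesis
      using compose_Bij[OF galois_carrierD(1)[OF sG] galois_carrierD(1)[OF tG]]
      by (simp add: galois_mult_eq sG tG)
        (simp add: galois_carrier_def compose_eq sep galois_carrierD(2-)[OF sG] galois_carrierD(2-)[OF tG])
  qed
  show one: "\<one>\<^bsub>absolute_galois_group F\<^esub> \<in> carrier (absolute_galois_group F)"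
    by (auto simp: galois_one_eq galois_carrier_def id_Bij sep)
  fix \<sigma> \<tau> \<rho> assume s: "\<sigma> \<in> carrier (absolute_galois_group F)" and t: "\<tau> \<in> carrier (absolute_galois_group F)"
    and r: "\<rho> \<in> carrier (absolute_galois_group F)"
  show "\<sigma> \<otimes>\<^bsub>absolute_galois_group F\<^esub> \<tau> \<otimes>\<^bsub>absolute_galois_group F\<^esub> \<rho>
      = \<sigma> \<otimes>\<^bsub>absolute_galois_group F\<^esub> (\<tau> \<otimes>\<^bsub>absolute_galois_group F\<^esub> \<rho>)"
    using s t r st[OF s t] st[OF t r] 
      compose_assoc[where f = \<rho> and g = \<tau> and h = \<sigma>, OF Bij_imp_funcset[OF galois_carrierD(1)]]
    by (simp add: galois_mult_eq)
  show "\<one>\<^bsub>absolute_galois_group F\<^esub> \<otimes>\<^bsub>absolute_galois_group F\<^esub> \<sigma> = \<sigma>"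
    using s galois_carrierD(1)[of \<sigma>] one
    by (simp add: galois_mult_eq) (simp add: galois_one_eq Bij_imp_funcset Bij_imp_extensional)
  define \<iota> where "\<iota> = restrict (inv_into separable_closure \<sigma>) separable_closure"
  have sG: "\<sigma> \<in> galois_carrier" using s by simp
  have bij: "bij_betw \<sigma> separable_closure separable_closure" using galois_carrierD(1)[OF sG] by (simp add: Bij_def)
  have inv: "\<iota> (\<sigma> z) = z" if "z \<in> separable_closure" for z
    using that bij galois_carrierD(3)[OF sG that] by (simp add: \<iota>_def bij_betw_inv_into_left)
  have surj: "\<exists>z'\<in>separable_closure. z = \<sigma> z'" if "z \<in> separable_closure" for z
    using that bij by (auto simp: bij_betw_def)
  have "\<iota> \<in> galois_carrier"
    unfolding galois_carrier_def
  proof (safe)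
    show "\<iota> \<in> Bij separable_closure" unfolding \<iota>_def by (rule restrict_inv_into_Bij[OF galois_carrierD(1)[OF sG]])
    fix y z :: "'a alg_closure" assume "y \<in> separable_closure" "z \<in> separable_closure"
    then obtain y' z' where yz: "y' \<in> separable_closure" "y = \<sigma> y'" "z' \<in> separable_closure" "z = \<sigma> z'"
      using surj by metis
    show "\<iota> (y + z) = \<iota> y + \<iota> z"
      using yz inv[of "y' + z'"] sep(1)[of y' z'] galois_carrierD(4)[OF sG, of y' z'] by (simp add: inv)
    show "\<iota> (y * z) = \<iota> y * \<iota> z"
      using yz inv[of "y' * z'"] sep(1)[of y' z'] galois_carrierD(5)[OF sG, of y' z'] by (simp add: inv)
  next
    fix t :: 'a
    show "\<iota> (to_ac t) = to_ac t" using inv[of "to_ac t"] galois_carrierD(2)[OF sG, of t] sep(2)[of t] by simp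
  qed
  moreover have "compose separable_closure \<iota> \<sigma> = (\<lambda>z\<in>separable_closure. z)"
    using inv by (auto simp: compose_def restrict_def)
  ultimately show "\<exists>y\<in>carrier (absolute_galois_group F). y \<otimes>\<^bsub>absolute_galois_group F\<^esub> \<sigma> = \<one>\<^bsub>absolute_galois_group F\<^esub>"
    using sG by (auto simp: galois_mult_eq galois_one_eq)
qed

lemma galois_ac_eval:
  assumes s: "\<sigma> \<in> galois_carrier" and z: "z \<in> separable_closure"
  shows "\<sigma> (ac_eval p z) = ac_eval p (\<sigma> z)"
proof (induction p)
  case 0
  show ?case using galois_carrierD(2)[OF s, of 0] by simp
next
  case (pCons t p)
  have "ac_eval p z \<in> separable_closure" by (rule separable_closure_ac_eval[OF z])
  then show ?case
    using pCons z separable_closure_add_mult[of z "ac_eval p z"] separable_closure_to_ac[of t]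
    by (simp add: galois_carrierD[OF s])
qed

lemma field_action_galois:
  "field_action (absolute_galois_group (F :: 'f::field itself)) separable_closure (\<lambda>\<sigma>. \<sigma>)"
proof -
  interpret group "absolute_galois_group F" by (rule group_absolute_galois_group)
  show ?thesis
  proof unfold_locales
    show "1 \<in> (separable_closure :: 'f alg_closure set)" using separable_closure_to_ac[of 1] by simp
    show "finite ((\<lambda>\<sigma>. \<sigma> z) ` carrier (absolute_galois_group F))" if z: "z \<in> separable_closure" for z
    proof -
      obtain p where p: "p \<noteq> 0" "ac_eval p z = 0" using alg_closure_algebraic[of z] by (metis ac_eval_def)
      have "(\<lambda>\<sigma>. \<sigma> z) ` carrier (absolute_galois_group F) \<subseteq> {r. ac_eval p r = 0}"
        using galois_ac_eval[OF _ z, of _ p, symmetric] p galois_carrierD(2)[of _ 0] by auto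
      moreover have "finite {r. ac_eval p r = 0}"
        using p poly_roots_finite[of "map_poly to_ac p"] by (simp add: ac_eval_def)
      ultimately show ?thesis by (rule finite_subset)
    qed
    show "\<sigma> 1 = 1" if "\<sigma> \<in> carrier (absolute_galois_group F)" for \<sigma>
      using that galois_carrierD(2)[of \<sigma> 1] by simp
    show "\<one>\<^bsub>absolute_galois_group F\<^esub> z = z" if "z \<in> separable_closure" for z
      using that by (simp add: galois_one_eq)
    show "(\<sigma> \<otimes>\<^bsub>absolute_galois_group F\<^esub> \<tau>) z = \<sigma> (\<tau> z)"
      if "\<sigma> \<in> carrier (absolute_galois_group F)" "\<tau> \<in> carrier (absolute_galois_group F)" "z \<in> separable_closure" for \<sigma> \<tau> z
      using that by (simp add: galois_mult_eq compose_eq)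
  qed (use separable_closure_add_mult separable_closure_minus separable_closure_inverse galois_carrierD in auto)
qed

lemma topspace_galois [simp]: "topspace (tg_top (absolute_galois_group F)) = galois_carrier"
proof -
  have "\<sigma> \<in> PiE separable_closure (\<lambda>_. separable_closure)" if "\<sigma> \<in> galois_carrier"
    for \<sigma> :: "'a alg_closure \<Rightarrow> 'a alg_closure"
    using galois_carrierD(3)[OF that] Bij_imp_extensional[OF galois_carrierD(1)[OF that]]
    by (simp add: PiE_def Pi_def)
  then show ?thesis by (auto simp: absolute_galois_group_def)
qed

lemma galois_open_nhd_one:
  assumes U: "openin (tg_top (absolute_galois_group F)) U" and "\<one>\<^bsub>absolute_galois_group F\<^esub> \<in> U"
  shows "\<exists>T. finite T \<and> T \<subseteq> separable_closure \<and>
    (\<forall>\<sigma>\<in>galois_carrier. (\<forall>t\<in>T. \<sigma> t = t) \<longrightarrow> \<sigma> \<in> U)"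
proof -
  let ?K = "separable_closure :: 'a alg_closure set"
  obtain V where V: "openin (product_topology (\<lambda>_. discrete_topology ?K) ?K) V" "U = V \<inter> galois_carrier"
    using U by (auto simp: absolute_galois_group_def openin_subtopology)
  then have "(\<lambda>z\<in>?K. z) \<in> V" using assms(2) by (simp add: galois_one_eq)
  from product_topology_open_contains_basis[OF V(1) this]
  obtain Z where Z: "(\<lambda>z\<in>?K. z) \<in> PiE ?K Z" "finite {i. Z i \<noteq> topspace (discrete_topology ?K)}" "PiE ?K Z \<subseteq> V"
    by blast
  have Z2: "finite {i. Z i \<noteq> ?K}" using Z(2) by simp
  show ?thesis
  \<comment> \<open>The finitely many coordinates that a basic open neighbourhood of the identity
    restricts.\<close>
  proof (intro exI[of _ "{i. Z i \<noteq> ?K} \<inter> ?K"] conjI ballI impI)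
    fix \<sigma> assume s: "\<sigma> \<in> galois_carrier" "\<forall>t\<in>{i. Z i \<noteq> ?K} \<inter> ?K. \<sigma> t = t"
    have "\<sigma> z \<in> Z z" if z: "z \<in> ?K" for z
    proof (cases "Z z = ?K")
      case True
      then show ?thesis using galois_carrierD(3)[OF s(1) z] by simp
    next
      case False
      then show ?thesis using PiE_mem[OF Z(1) z] z s(2) by simp
    qed
    then have "\<sigma> \<in> PiE ?K Z"
      using Bij_imp_extensional[OF galois_carrierD(1)[OF s(1)]] by (simp add: PiE_def)
    then show "\<sigma> \<in> U" using Z(3) V(2) s(1) by blast
  qed (use Z2 in auto)
qed

lemma galois_open_set:
  assumes T: "finite T" "T \<subseteq> separable_closure" and W: "W \<subseteq> galois_carrier"
    and stab: "\<And>n g. n \<in> W \<Longrightarrow> g \<in> galois_carrier \<Longrightarrow> \<forall>t\<in>T. g t = n t \<Longrightarrow> g \<in> W"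
  shows "openin (tg_top (absolute_galois_group F)) W"
proof (subst openin_subopen, intro ballI)
  let ?K = "separable_closure :: 'a alg_closure set" and ?G = "absolute_galois_group F"
  fix n assume n: "n \<in> W"
  then have nG: "n \<in> galois_carrier" using W by blast
  define Z where "Z z = (if z \<in> T then {n z} else ?K)" for z
  have "openin (product_topology (\<lambda>_. discrete_topology ?K) ?K) (PiE ?K Z)"
    using T galois_carrierD(3)[OF nG] by (intro product_topology_basis) (auto simp: Z_def intro: finite_subset[of _ T])
  then have op: "openin (tg_top ?G) (PiE ?K Z \<inter> galois_carrier)"
    by (auto simp: absolute_galois_group_def openin_subtopology)
  have "n \<in> PiE ?K Z"
    using galois_carrierD(3)[OF nG] Bij_imp_extensional[OF galois_carrierD(1)[OF nG]]
    by (auto simp: Z_def PiE_def)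
  moreover have "PiE ?K Z \<inter> galois_carrier \<subseteq> W"
  proof
    fix g assume g: "g \<in> PiE ?K Z \<inter> galois_carrier"
    then have "\<forall>t\<in>T. g t = n t" using T by (force simp: Z_def PiE_def Pi_def)
    then show "g \<in> W" using stab[OF n] g by blast
  qed
  ultimately show "\<exists>U. openin (tg_top ?G) U \<and> n \<in> U \<and> U \<subseteq> W"
    using op nG by blast
qed

section \<open>Homomorphisms to unitriangular matrices\<close>

type_synonym u4 = "bit \<times> bit \<times> bit \<times> bit \<times> bit \<times> bit"

text \<open>The tuple \<open>(a, b, c, d, e, f)\<close> is the unitriangular matrix over the field with two elements with
  rows \<open>(1, a, d, f)\<close>, \<open>(0, 1, b, e)\<close>, \<open>(0, 0, 1, c)\<close>, \<open>(0, 0, 0, 1)\<close>.\<close>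
fun u4_mult :: "u4 \<Rightarrow> u4 \<Rightarrow> u4" where
  "u4_mult (a, b, c, d, e, f) (a', b', c', d', e', f') =
     (a + a', b + b', c + c', d + d' + a * b', e + e' + b * c', f + f' + a * e' + d * c')"

definition U4 :: "u4 tgroup" where
  "U4 = \<lparr>carrier = UNIV, mult = u4_mult, one = (0, 0, 0, 0, 0, 0), tg_top = discrete_topology UNIV\<rparr>"

lemma U4_simps [simp]:
  "carrier U4 = UNIV" "mult U4 = u4_mult" "one U4 = (0, 0, 0, 0, 0, 0)" "tg_top U4 = discrete_topology UNIV"
  by (simp_all add: U4_def)

lemma u4_inverse:
  "u4_mult (a, b, c, d + a * b, e + b * c, f + a * e + d * c + a * b * c) (a, b, c, d, e, f) = (0, 0, 0, 0, 0, 0)"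
  by (simp add: algebra_simps)

lemma group_U4: "group U4"
proof (rule groupI)
  fix u v w :: u4
  show "u \<otimes>\<^bsub>U4\<^esub> v \<otimes>\<^bsub>U4\<^esub> w = u \<otimes>\<^bsub>U4\<^esub> (v \<otimes>\<^bsub>U4\<^esub> w)"
    by (cases u; cases v; cases w) (simp add: algebra_simps)
  show "\<one>\<^bsub>U4\<^esub> \<otimes>\<^bsub>U4\<^esub> u = u" by (cases u) simp
  show "\<exists>v\<in>carrier U4. v \<otimes>\<^bsub>U4\<^esub> u = \<one>\<^bsub>U4\<^esub>" 
  proof (cases u)
    case (fields a b c d e f)
    then show ?thesis
      using u4_inverse[of a b c d e f]
      by (intro bexI[of _ "(a, b, c, d + a * b, e + b * c, f + a * e + d * c + a * b * c)"]) (simp_all del: u4_mult.simps)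
  qed
qed simp_all

interpretation U4: group U4 by (rule group_U4)

lemma U4_inv: "inv\<^bsub>U4\<^esub> (a, b, c, d, e, f) =
    (a, b, c, d + a * b, e + b * c, f + a * e + d * c + a * b * c)"
  using u4_inverse by (intro U4.inv_equality) (auto simp del: u4_mult.simps)

lemma finite_UNIV_bit: "finite (UNIV :: bit set)" and card_UNIV_bit: "card (UNIV :: bit set) = 2"
proof -
  have "x \<in> {0, 1}" for x :: bit by (cases x) simp_all
  then have U: "(UNIV :: bit set) = {0, 1}" by (rule UNIV_eq_I)
  show "finite (UNIV :: bit set)" "card (UNIV :: bit set) = 2" unfolding U by simp_all
qed

lemma finite_UNIV_u4: "finite (UNIV :: u4 set)" and order_U4: "order U4 = 2 ^ 6"
  by (simp_all add: order_def finite_UNIV_bit card_UNIV_bit card_cartesian_product flip: UNIV_Times_UNIV)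

text \<open>The corner entry is left unspecified: a further commutator does not depend on
  it.\<close>

lemma U4_commutator:
  "\<exists>f''. commutator U4 (a, b, c, d, e, f) (a', b', c', d', e', f') =
     (0, 0, 0, a * b' + a' * b, b * c' + b' * c, f'')"
  by (simp add: commutator_def U4_inv algebra_simps)

lemma U4_commutator2:
  "commutator U4 (0, 0, 0, d, e, f) (a', b', c', d', e', f') = (0, 0, 0, 0, 0, d * c' + a' * e)"
  "commutator U4 (a', b', c', d', e', f') (0, 0, 0, d, e, f) = (0, 0, 0, 0, 0, d * c' + a' * e)"
  by (simp_all add: commutator_def U4_inv algebra_simps)

lemma U4_commutator_eq_one:
  assumes "u4_mult u v = u4_mult v u" shows "commutator U4 u v = \<one>\<^bsub>U4\<^esub>"
proof -
  have "commutator U4 u v = inv\<^bsub>U4\<^esub> (v \<otimes>\<^bsub>U4\<^esub> u) \<otimes>\<^bsub>U4\<^esub> (u \<otimes>\<^bsub>U4\<^esub> v)"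
    unfolding commutator_def by (simp only: U4.inv_mult_group U4.m_assoc U4_simps(1) UNIV_I U4.inv_closed U4.m_closed)
  also have "u \<otimes>\<^bsub>U4\<^esub> v = v \<otimes>\<^bsub>U4\<^esub> u" using assms by simp
  finally show ?thesis using U4.l_inv[of "v \<otimes>\<^bsub>U4\<^esub> u"] by (simp only: U4_simps(1) UNIV_I simp_thms)
qed

text \<open>The second and third terms of the lower central series of \<open>U4\<close>; they
  receive the second and third terms of the Zassenhaus filtration.\<close>

definition u4_lower2 :: "u4 set" where "u4_lower2 = {(0, 0, 0, d, e, f) | d e f. True}"
definition u4_center :: "u4 set" where "u4_center = {(0, 0, 0, 0, 0, f) | f. True}"

lemma subgroup_u4_lower2: "subgroup u4_lower2 U4" and subgroup_u4_center: "subgroup u4_center U4"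
  by (rule U4.subgroupI; auto simp: u4_lower2_def u4_center_def U4_inv)+

lemma u4_square_lower2: "u4_mult u u \<in> u4_lower2"
  by (cases u) (simp add: u4_lower2_def)

lemma u4_commutator_lower2: "commutator U4 u v \<in> u4_lower2"
proof -
  obtain a b c d e f a' b' c' d' e' f' where "u = (a, b, c, d, e, f)" "v = (a', b', c', d', e', f')"
    by (metis prod_cases6)
  then show ?thesis using U4_commutator[of a b c d e f a' b' c' d' e' f'] by (auto simp: u4_lower2_def)
qed

lemma u4_lower2_square: "u \<in> u4_lower2 \<Longrightarrow> u4_mult u u = \<one>\<^bsub>U4\<^esub>"
  by (auto simp: u4_lower2_def)

lemma u4_commutator_center:
  "u \<in> u4_lower2 \<Longrightarrow> commutator U4 u v \<in> u4_center" "u \<in> u4_lower2 \<Longrightarrow> commutator U4 v u \<in> u4_center"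
  by (cases v; auto simp: u4_lower2_def u4_center_def U4_commutator2)+

lemma u4_commutator_one:
  "u \<in> u4_center \<Longrightarrow> commutator U4 u v = \<one>\<^bsub>U4\<^esub>" "u \<in> u4_center \<Longrightarrow> commutator U4 v u = \<one>\<^bsub>U4\<^esub>"
  "u \<in> u4_lower2 \<Longrightarrow> v \<in> u4_lower2 \<Longrightarrow> commutator U4 u v = \<one>\<^bsub>U4\<^esub>"
  by (cases v; auto simp: u4_lower2_def u4_center_def U4_commutator2)+

text \<open>The projection of \<open>U4\<close> onto its abelianization.\<close>

definition superdiag :: "u4 \<Rightarrow> bit \<times> bit \<times> bit" where
  "superdiag = (\<lambda>(a, b, c, d, e, f). (a, b, c))"

text \<open>In 2 by 2 blocks these matrices have identity diagonal blocks and a free upper right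
  block, so multiplication adds the free blocks.\<close>

lemma superdiag_middle_commute:
  assumes "superdiag u = (0, b, 0)" "superdiag v = (0, b', 0)"
  shows "u4_mult u v = u4_mult v u" and "u4_mult u u = \<one>\<^bsub>U4\<^esub>"
  using assms by (cases u; cases v; simp add: superdiag_def add_ac)+

lemma U4_triple_commutator:
  assumes "superdiag u = (a, b, c)" "superdiag v = (a', b', c')" "superdiag w = (a'', b'', c'')"
  shows "commutator U4 (commutator U4 u v) w =
    (0, 0, 0, 0, 0, (a * b' + a' * b) * c'' + a'' * (b * c' + b' * c))"
proof -
  obtain d e f d' e' f' d'' e'' f'' where uvw:
    "u = (a, b, c, d, e, f)" "v = (a', b', c', d', e', f')" "w = (a'', b'', c'', d'', e'', f'')"
    using assms by (cases u; cases v; cases w) (auto simp: superdiag_def)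
  show ?thesis
    using U4_commutator[of a b c d e f a' b' c' d' e' f'] uvw by (auto simp: U4_commutator2)
qed

section \<open>Continuous homomorphisms to \<open>U4\<close> and the Zassenhaus filtration\<close>

lemma group_tgroup: "topological_group S \<Longrightarrow> group S" "topological_group S \<Longrightarrow> topspace (tg_top S) = carrier S"
  by (simp_all add: topological_group_def)

lemma tgroup_hom_open:
  assumes "\<phi> \<in> tgroup_hom S U4" "topological_group S"
  shows "openin (tg_top S) {g \<in> carrier S. \<phi> g \<in> V}"
  using assms openin_continuous_map_preimage[of "tg_top S" "discrete_topology UNIV" \<phi> V]
  by (simp add: tgroup_hom_def group_tgroup)

lemma tgroup_hom_group_hom:
  assumes "\<phi> \<in> tgroup_hom S U4" "topological_group S"
  shows "group_hom S U4 \<phi>"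
  using assms group_U4 by (simp add: group_hom_def group_hom_axioms_def tgroup_hom_def group_tgroup)

lemma hom_commutator:
  assumes "group_hom S U4 \<phi>" "g \<in> carrier S" "h \<in> carrier S"
  shows "\<phi> (commutator S g h) = commutator U4 (\<phi> g) (\<phi> h)"
proof -
  interpret group_hom S U4 \<phi> by fact
  show ?thesis using assms(2,3) by (simp add: commutator_def hom_mult hom_inv del: U4_simps)
qed

lemma commutator_closed:
  assumes "group S" "g \<in> carrier S" "h \<in> carrier S" shows "commutator S g h \<in> carrier S"
proof -
  interpret group S by fact
  show ?thesis using assms(2,3) by (simp add: commutator_def)
qed

lemma preimage_closed_subgroup:
  assumes \<phi>: "\<phi> \<in> tgroup_hom S U4" and S: "topological_group S" and V: "subgroup V U4"
  shows "subgroup {g \<in> carrier S. \<phi> g \<in> V} S" "closedin (tg_top S) {g \<in> carrier S. \<phi> g \<in> V}"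
proof -
  interpret \<phi>: group_hom S U4 \<phi> by (rule tgroup_hom_group_hom[OF \<phi> S])
  show "subgroup {g \<in> carrier S. \<phi> g \<in> V} S"
    using V by (intro \<phi>.subgroupI) (auto simp: \<phi>.hom_mult \<phi>.hom_inv subgroup.m_closed subgroup.m_inv_closed
        intro!: exI[of _ "\<one>\<^bsub>S\<^esub>"] simp del: U4_simps dest: subgroup.one_closed)
  have "carrier S - {g \<in> carrier S. \<phi> g \<in> V} = {g \<in> carrier S. \<phi> g \<in> - V}" by auto
  then show "closedin (tg_top S) {g \<in> carrier S. \<phi> g \<in> V}"
    using tgroup_hom_open[OF \<phi> S, of "- V"] S by (simp add: closedin_def group_tgroup)
qed

lemma closed_subgroup_generated_image:
  assumes \<phi>: "\<phi> \<in> tgroup_hom S U4" and S: "topological_group S" and V: "subgroup V U4"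
    and A: "A \<subseteq> carrier S" "\<phi> ` A \<subseteq> V" and g: "g \<in> closed_subgroup_generated S A"
  shows "g \<in> carrier S" "\<phi> g \<in> V"
proof -
  have "closed_subgroup_generated S A \<subseteq> {g \<in> carrier S. \<phi> g \<in> V}"
    using A preimage_closed_subgroup[OF \<phi> S V]
    unfolding closed_subgroup_generated_def by (intro Inter_lower) auto
  then show "g \<in> carrier S" "\<phi> g \<in> V" using g by auto
qed

text \<open>The subgroups \<open>u4_lower2\<close>, \<open>u4_center\<close> and 1 satisfy the
  closure conditions of the filtration. For n = 3 and n = 4 the ceiling of n/2 is 2, so the squares
  that occur are squares of elements of \<open>u4_lower2\<close>, which are trivial.\<close>

lemma zassenhaus2_hom:
  assumes \<phi>: "\<phi> \<in> tgroup_hom S U4" and S: "topological_group S"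
  shows "g \<in> zassenhaus2 S 2 \<Longrightarrow> g \<in> carrier S \<and> \<phi> g \<in> u4_lower2"
    and "g \<in> zassenhaus2 S 3 \<Longrightarrow> g \<in> carrier S \<and> \<phi> g \<in> u4_center"
    and "g \<in> zassenhaus2 S 4 \<Longrightarrow> g \<in> carrier S \<and> \<phi> g = \<one>\<^bsub>U4\<^esub>"
proof -
  interpret \<phi>: group_hom S U4 \<phi> by (rule tgroup_hom_group_hom[OF \<phi> S])
  have GS: "group S" by (rule \<phi>.group_axioms)
  note comm = commutator_closed[OF GS] hom_commutator[OF \<phi>.group_hom_axioms]
  have sq: "\<phi> (g [^]\<^bsub>S\<^esub> (2::nat)) = u4_mult (\<phi> g) (\<phi> g)" "g [^]\<^bsub>S\<^esub> (2::nat) \<in> carrier S" if "g \<in> carrier S" for g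
    using that by (simp_all add: numeral_2_eq_2 \<phi>.hom_mult)
  have z1: "zassenhaus2 S (Suc 0) = carrier S" by (subst zassenhaus2.simps) simp
  \<comment> \<open>The preimage of \<open>V\<close> is a closed subgroup, so only the generating
    squares and commutators have to be checked.\<close>
  have step: "g \<in> carrier S \<and> \<phi> g \<in> V"
    if "n > 1" "g \<in> zassenhaus2 S n" "subgroup V U4"
      "\<And>g. g \<in> zassenhaus2 S ((n + 1) div 2) \<Longrightarrow> g \<in> carrier S \<and> u4_mult (\<phi> g) (\<phi> g) \<in> V"
      "\<And>i g h. i \<in> {1..<n} \<Longrightarrow> g \<in> zassenhaus2 S i \<Longrightarrow> h \<in> zassenhaus2 S (n - i) \<Longrightarrow>
         g \<in> carrier S \<and> h \<in> carrier S \<and> commutator U4 (\<phi> g) (\<phi> h) \<in> V" for n V g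
  proof -
    let ?A = "(\<lambda>g. g [^]\<^bsub>S\<^esub> (2::nat)) ` zassenhaus2 S ((n + 1) div 2) \<union>
         (\<Union>i\<in>{1..<n}. {commutator S g h | g h. g \<in> zassenhaus2 S i \<and> h \<in> zassenhaus2 S (n - i)})"
    have g: "g \<in> closed_subgroup_generated S ?A" using that(1,2) by (subst (asm) zassenhaus2.simps) simp
    have "a \<in> carrier S \<and> \<phi> a \<in> V" if "a \<in> ?A" for a
      using that
    proof
      assume "a \<in> (\<lambda>g. g [^]\<^bsub>S\<^esub> (2::nat)) ` zassenhaus2 S ((n + 1) div 2)"
      then obtain g where "g \<in> zassenhaus2 S ((n + 1) div 2)" "a = g [^]\<^bsub>S\<^esub> (2::nat)" by blast
      then show ?thesis using sq[of g] \<open>\<And>g. g \<in> zassenhaus2 S ((n + 1) div 2) \<Longrightarrow> g \<in> carrier S \<and> u4_mult (\<phi> g) (\<phi> g) \<in> V\<close> by metis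
    next
      assume "a \<in> (\<Union>i\<in>{1..<n}. {commutator S g h | g h. g \<in> zassenhaus2 S i \<and> h \<in> zassenhaus2 S (n - i)})"
      then obtain i g h where i: "i \<in> {1..<n}" "g \<in> zassenhaus2 S i" "h \<in> zassenhaus2 S (n - i)" "a = commutator S g h" by blast
      have "g \<in> carrier S \<and> h \<in> carrier S \<and> commutator U4 (\<phi> g) (\<phi> h) \<in> V"
        by (rule \<open>\<And>i g h. i \<in> {1..<n} \<Longrightarrow> g \<in> zassenhaus2 S i \<Longrightarrow> h \<in> zassenhaus2 S (n - i) \<Longrightarrow>
         g \<in> carrier S \<and> h \<in> carrier S \<and> commutator U4 (\<phi> g) (\<phi> h) \<in> V\<close>[OF i(1-3)])
      then show ?thesis using i(4) comm[of g h] by simp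
    qed
    then have A: "?A \<subseteq> carrier S" "\<phi> ` ?A \<subseteq> V" by blast+
    show ?thesis using closed_subgroup_generated_image[OF \<phi> S that(3) A g] by simp
  qed
  have z2: "g \<in> carrier S \<and> \<phi> g \<in> u4_lower2" if "g \<in> zassenhaus2 S 2" for g
  proof (rule step[OF _ that subgroup_u4_lower2])
    fix i g h assume "i \<in> {1..<2::nat}" "g \<in> zassenhaus2 S i" "h \<in> zassenhaus2 S (2 - i)"
    moreover from this have "i = 1" by auto
    ultimately show "g \<in> carrier S \<and> h \<in> carrier S \<and> commutator U4 (\<phi> g) (\<phi> h) \<in> u4_lower2"
      by (simp add: z1 u4_commutator_lower2)
  qed (simp_all add: z1 u4_square_lower2)
  then show "g \<in> zassenhaus2 S 2 \<Longrightarrow> g \<in> carrier S \<and> \<phi> g \<in> u4_lower2" .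
  have one: "\<one>\<^bsub>U4\<^esub> \<in> u4_center" by (simp add: u4_center_def)
  have z3: "g \<in> carrier S \<and> \<phi> g \<in> u4_center" if "g \<in> zassenhaus2 S 3" for g
  proof (rule step[OF _ that subgroup_u4_center])
    fix i g h assume *: "i \<in> {1..<3::nat}" "g \<in> zassenhaus2 S i" "h \<in> zassenhaus2 S (3 - i)"
    then consider "i = 1" | "i = 2" by force
    then show "g \<in> carrier S \<and> h \<in> carrier S \<and> commutator U4 (\<phi> g) (\<phi> h) \<in> u4_center"
    proof cases
      case 1
      then have "g \<in> carrier S" "h \<in> zassenhaus2 S 2" using * by (simp_all add: z1)
      then show ?thesis using z2[of h] u4_commutator_center(2) by blast
    next
      case 2
      then have "g \<in> zassenhaus2 S 2" "h \<in> carrier S" using * by (simp_all add: z1)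
      then show ?thesis using z2[of g] u4_commutator_center(1) by blast
    qed
  qed (use z2 u4_lower2_square one in \<open>auto simp del: U4_simps\<close>)
  then show "g \<in> zassenhaus2 S 3 \<Longrightarrow> g \<in> carrier S \<and> \<phi> g \<in> u4_center" .
  have triv: "subgroup {\<one>\<^bsub>U4\<^esub>} U4" by (rule U4.triv_subgroup)
  have "g \<in> carrier S \<and> \<phi> g \<in> {\<one>\<^bsub>U4\<^esub>}" if "g \<in> zassenhaus2 S 4" for g
  proof (rule step[OF _ that triv])
    fix i g h assume *: "i \<in> {1..<4::nat}" "g \<in> zassenhaus2 S i" "h \<in> zassenhaus2 S (4 - i)"
    then consider "i = 1" | "i = 2" | "i = 3" by force
    then show "g \<in> carrier S \<and> h \<in> carrier S \<and> commutator U4 (\<phi> g) (\<phi> h) \<in> {\<one>\<^bsub>U4\<^esub>}"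
    proof cases
      case 1
      then have "g \<in> carrier S" "h \<in> zassenhaus2 S 3" using * by (simp_all add: z1)
      then show ?thesis using z3[of h] u4_commutator_one(2) by blast
    next
      case 2
      then have "g \<in> zassenhaus2 S 2" "h \<in> zassenhaus2 S 2" using * by (simp_all add: z1)
      then show ?thesis using z2[of g] z2[of h] u4_commutator_one(3) by blast
    next
      case 3
      then have "g \<in> zassenhaus2 S 3" "h \<in> carrier S" using * by (simp_all add: z1)
      then show ?thesis using z3[of g] u4_commutator_one(1) by blast
    qed
  qed (use z2 u4_lower2_square in \<open>auto simp del: U4_simps\<close>)
  then show "g \<in> zassenhaus2 S 4 \<Longrightarrow> g \<in> carrier S \<and> \<phi> g = \<one>\<^bsub>U4\<^esub>" by simp
qed

section \<open>Images of ordered products and canonical decompositions\<close>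

lemma sorted_wrt_unique:
  assumes r: "trans r" "irrefl r"
    and "sorted_wrt (\<lambda>j k. (j, k) \<in> r) js" "sorted_wrt (\<lambda>j k. (j, k) \<in> r) ks" "set js = set ks"
  shows "js = ks"
  using assms(3-)
proof (induction js arbitrary: ks)
  case (Cons j js)
  then obtain k ks' where ks: "ks = k # ks'" by (cases ks) auto
  have "j = k"
  proof (rule ccontr)
    assume "j \<noteq> k"
    then have "j \<in> set ks'" "k \<in> set js" using Cons.prems(3) ks by auto
    then have "(k, j) \<in> r" "(j, k) \<in> r" using Cons.prems ks by auto
    then show False using r by (meson irrefl_def transD)
  qed
  moreover have "j \<notin> set js" "k \<notin> set ks'" using Cons.prems ks r(2) by (auto simp: irrefl_def)
  ultimately have "set js = set ks'" using Cons.prems(3) ks by auto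
  then show ?case using Cons.IH[of ks'] Cons.prems ks \<open>j = k\<close> by simp
qed simp

lemma sorted_wrt_exists:
  assumes r: "trans r" "irrefl r" "total r" and "finite A"
  shows "\<exists>js. sorted_wrt (\<lambda>j k. (j, k) \<in> r) js \<and> set js = A"
  using assms(4)
proof (induction A rule: finite_psubset_induct)
  case (psubset A)
  show ?case
  proof (cases "A = {}")
    case False
    have "\<exists>m\<in>A. \<forall>a\<in>A. a \<noteq> m \<longrightarrow> (m, a) \<in> r"
      using psubset.hyps False
    proof (induction A rule: finite_ne_induct)
      case (insert x A)
      then obtain m where m: "m \<in> A" "\<forall>a\<in>A. a \<noteq> m \<longrightarrow> (m, a) \<in> r" by blast
      have "m \<noteq> x" using m insert by blast
      then consider "(m, x) \<in> r" | "(x, m) \<in> r" using r(3) by (auto simp: total_on_def)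
      then show ?case
      proof cases
        case 2
        then have "\<forall>a\<in>insert x A. a \<noteq> x \<longrightarrow> (x, a) \<in> r" using m r(1) by (metis insertE transD)
        then show ?thesis by blast
      qed (use m in blast)
    qed simp
    then obtain m where m: "m \<in> A" "\<forall>a\<in>A. a \<noteq> m \<longrightarrow> (m, a) \<in> r" by blast
    then obtain js where "sorted_wrt (\<lambda>j k. (j, k) \<in> r) js" "set js = A - {m}"
      using psubset.IH[of "A - {m}"] by blast
    then show ?thesis using m by (intro exI[of _ "m # js"]) auto
  qed simp
qed

lemma ordered_prod_list:
  assumes r: "trans r" "irrefl r" "total r" and "finite A"
  obtains js where "distinct js" "set js = A" "ordered_prod S r f A = foldr (\<lambda>j g. f j \<otimes>\<^bsub>S\<^esub> g) js \<one>\<^bsub>S\<^esub>"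
proof -
  obtain js where js: "sorted_wrt (\<lambda>j k. (j, k) \<in> r) js" "set js = A"
    using sorted_wrt_exists[OF assms] by blast
  then have "(THE js. sorted_wrt (\<lambda>j k. (j, k) \<in> r) js \<and> set js = A) = js"
    using sorted_wrt_unique[OF r(1,2)] by (intro the_equality) auto
  moreover have "distinct js"
    using js(1) r(2) by (induction js) (auto simp: irrefl_def)
  ultimately show thesis using that js(2) by (simp add: ordered_prod_def)
qed

text \<open>\<open>U4\<close> is discrete, so the image of the limit is already the image of a
  finite product. The finite set can be enlarged to contain a prescribed index, which keeps a
  distinguished factor in the product.\<close>

lemma has_ordered_prod_eventually:
  assumes \<phi>: "\<phi> \<in> tgroup_hom S U4" and S: "topological_group S"
    and hp: "has_ordered_prod S r f J g" and j: "j \<in> J"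
  obtains A where "finite A" "A \<subseteq> J" "j \<in> A" "\<phi> (ordered_prod S r f A) = \<phi> g" "g \<in> carrier S"
proof -
  have lim: "limitin (tg_top S) (ordered_prod S r f) g (finite_subsets_at_top J)"
    using hp by (simp add: has_ordered_prod_def)
  then have g: "g \<in> carrier S" using S by (simp add: limitin_def group_tgroup)
  have "openin (tg_top S) {g' \<in> carrier S. \<phi> g' \<in> {\<phi> g}}" by (rule tgroup_hom_open[OF \<phi> S])
  then have "eventually (\<lambda>A. ordered_prod S r f A \<in> {g' \<in> carrier S. \<phi> g' \<in> {\<phi> g}}) (finite_subsets_at_top J)"
    using lim g unfolding limitin_def by auto
  then obtain A0 where A0: "finite A0" "A0 \<subseteq> J"
    "\<And>A. finite A \<Longrightarrow> A0 \<subseteq> A \<Longrightarrow> A \<subseteq> J \<Longrightarrow> \<phi> (ordered_prod S r f A) = \<phi> g"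
    unfolding eventually_finite_subsets_at_top by auto
  show thesis
    using A0(1,2) A0(3)[of "insert j A0"] j g by (intro that[of "insert j A0"]) auto
qed

lemma has_ordered_prod_subgroup:
  assumes \<phi>: "\<phi> \<in> tgroup_hom S U4" and S: "topological_group S" and V: "subgroup V U4"
    and r: "trans r" "irrefl r" "total r"
    and hp: "has_ordered_prod S r f J g" and j: "j \<in> J"
    and f: "\<And>j. j \<in> J \<Longrightarrow> f j \<in> carrier S" "\<And>j. j \<in> J \<Longrightarrow> \<phi> (f j) \<in> V"
  shows "g \<in> carrier S \<and> \<phi> g \<in> V"
proof -
  interpret \<phi>: group_hom S U4 \<phi> by (rule tgroup_hom_group_hom[OF \<phi> S])
  obtain A where A: "finite A" "A \<subseteq> J" "\<phi> (ordered_prod S r f A) = \<phi> g" "g \<in> carrier S"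
    using has_ordered_prod_eventually[OF \<phi> S hp j] by metis
  obtain js where js: "set js = A" "ordered_prod S r f A = foldr (\<lambda>j g. f j \<otimes>\<^bsub>S\<^esub> g) js \<one>\<^bsub>S\<^esub>"
    using ordered_prod_list[OF r A(1)] by metis
  have "foldr (\<lambda>j g. f j \<otimes>\<^bsub>S\<^esub> g) js \<one>\<^bsub>S\<^esub> \<in> carrier S \<and> \<phi> (foldr (\<lambda>j g. f j \<otimes>\<^bsub>S\<^esub> g) js \<one>\<^bsub>S\<^esub>) \<in> V"
    if "set js \<subseteq> J" for js
    using that
  proof (induction js)
    case (Cons j js)
    then show ?case using f[of j] subgroup.m_closed[OF V] by (simp add: \<phi>.hom_mult del: U4_simps)
  qed (use subgroup.one_closed[OF V] in \<open>simp del: U4_simps\<close>)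
  then show ?thesis using A js by metis
qed

lemma has_ordered_prod_single:
  assumes \<phi>: "\<phi> \<in> tgroup_hom S U4" and S: "topological_group S"
    and r: "trans r" "irrefl r" "total r"
    and hp: "has_ordered_prod S r f J g" and j: "j \<in> J"
    and f: "\<And>j. j \<in> J \<Longrightarrow> f j \<in> carrier S" "\<And>j'. j' \<in> J \<Longrightarrow> j' \<noteq> j \<Longrightarrow> \<phi> (f j') = \<one>\<^bsub>U4\<^esub>"
  shows "g \<in> carrier S \<and> \<phi> g = \<phi> (f j)"
proof -
  interpret \<phi>: group_hom S U4 \<phi> by (rule tgroup_hom_group_hom[OF \<phi> S])
  obtain A where A: "finite A" "A \<subseteq> J" "j \<in> A" "\<phi> (ordered_prod S r f A) = \<phi> g" "g \<in> carrier S"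
    using has_ordered_prod_eventually[OF \<phi> S hp j] by metis
  obtain js where js: "distinct js" "set js = A" "ordered_prod S r f A = foldr (\<lambda>j g. f j \<otimes>\<^bsub>S\<^esub> g) js \<one>\<^bsub>S\<^esub>"
    using ordered_prod_list[OF r A(1)] by metis
  have "foldr (\<lambda>j g. f j \<otimes>\<^bsub>S\<^esub> g) js \<one>\<^bsub>S\<^esub> \<in> carrier S \<and>
      \<phi> (foldr (\<lambda>j g. f j \<otimes>\<^bsub>S\<^esub> g) js \<one>\<^bsub>S\<^esub>) = (if j \<in> set js then \<phi> (f j) else \<one>\<^bsub>U4\<^esub>)"
    if "set js \<subseteq> J" "distinct js" for js
    using that
  proof (induction js)
    case (Cons k js)
    then show ?case
      using f(1)[of k] f(2)[of k] U4.l_one U4.r_one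
      by (cases "k = j") (auto simp: \<phi>.hom_mult simp del: U4_simps(2,3))
  qed (simp del: U4_simps)
  then show ?thesis using A js by metis
qed

lemma less_rel_order:
  "trans (less_rel :: 'i::linorder rel)" "irrefl (less_rel :: 'i rel)" "total (less_rel :: 'i rel)"
  by (auto simp: trans_def irrefl_def total_on_def)

text \<open>Exponents are 0 or 1, so the hypotheses kill every factor of the first two products; the
  remainder in the fourth filtration step dies in \<open>U4\<close>. Only the product of triple
  commutators survives.\<close>

lemma canonical_decomposition_eval:
  fixes x :: "'i::wellorder \<Rightarrow> 'g" and l0 m0 :: 'i
  assumes \<phi>: "\<phi> \<in> tgroup_hom S U4" and S: "topological_group S" and x: "\<And>l. x l \<in> carrier S"
    and cd: "canonical_decomposition S x s a b c"
    and lm: "l0 < m0"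
    and sq: "\<And>l. a l \<noteq> 0 \<Longrightarrow> u4_mult (\<phi> (x l)) (\<phi> (x l)) = \<one>\<^bsub>U4\<^esub>"
    and comm: "\<And>l m. l < m \<Longrightarrow> b l m \<noteq> 0 \<Longrightarrow> commutator U4 (\<phi> (x l)) (\<phi> (x m)) = \<one>\<^bsub>U4\<^esub>"
  obtains g3 where "has_ordered_prod S (less_rel <*lex*> less_rel <*lex*> less_rel)
          (\<lambda>(i, j, k). commutator S (commutator S (x i) (x j)) (x k) [^]\<^bsub>S\<^esub> c i j k)
          {(i, j, k). i < j \<and> k \<le> j} g3" "\<phi> s = \<phi> g3"
proof -
  interpret \<phi>: group_hom S U4 \<phi> by (rule tgroup_hom_group_hom[OF \<phi> S])
  have GS: "group S" by (rule \<phi>.group_axioms)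
  obtain g1 g2 g3 s' where
    g1: "has_ordered_prod S less_rel (\<lambda>i. x i [^]\<^bsub>S\<^esub> (2 * a i)) UNIV g1"
    and g2: "has_ordered_prod S (less_rel <*lex*> less_rel)
          (\<lambda>(i, j). commutator S (x i) (x j) [^]\<^bsub>S\<^esub> b i j) {(i, j). i < j} g2"
    and g3: "has_ordered_prod S (less_rel <*lex*> less_rel <*lex*> less_rel)
          (\<lambda>(i, j, k). commutator S (commutator S (x i) (x j)) (x k) [^]\<^bsub>S\<^esub> c i j k)
          {(i, j, k). i < j \<and> k \<le> j} g3"
    and s': "s' \<in> zassenhaus2 S 4" "s = g1 \<otimes>\<^bsub>S\<^esub> g2 \<otimes>\<^bsub>S\<^esub> g3 \<otimes>\<^bsub>S\<^esub> s'"
    and a: "\<forall>i. a i \<in> {0, 1}" and b: "\<forall>i j. i < j \<longrightarrow> b i j \<in> {0, 1}"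
    using cd unfolding canonical_decomposition_def by blast
  have one: "subgroup {\<one>\<^bsub>U4\<^esub>} U4" by (rule U4.triv_subgroup)
  have p1: "g1 \<in> carrier S \<and> \<phi> g1 \<in> {\<one>\<^bsub>U4\<^esub>}"
  proof (rule has_ordered_prod_subgroup[OF \<phi> S one less_rel_order g1 UNIV_I])
    fix l
    have "a l = 0 \<or> a l = 1" using a by auto
    then show "\<phi> (x l [^]\<^bsub>S\<^esub> (2 * a l)) \<in> {\<one>\<^bsub>U4\<^esub>}"
    proof
      assume "a l = 1"
      then have "\<phi> (x l [^]\<^bsub>S\<^esub> (2 * a l)) = u4_mult (\<phi> (x l)) (\<phi> (x l))"
        using x[of l] by (simp add: numeral_2_eq_2 \<phi>.hom_mult)
      then show ?thesis using sq[of l] \<open>a l = 1\<close> by simp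
    qed (simp del: U4_simps)
  qed (use x in simp)
  have J: "(l0, m0) \<in> {(i, j). i < j}" using lm by simp
  have p2: "g2 \<in> carrier S \<and> \<phi> g2 \<in> {\<one>\<^bsub>U4\<^esub>}"
  proof (rule has_ordered_prod_subgroup[OF \<phi> S one _ _ _ g2 J])
    fix p :: "'i \<times> 'i" assume "p \<in> {(l, m). l < m}"
    then obtain l m where p: "p = (l, m)" "l < m" by blast
    show "(case p of (i, j) \<Rightarrow> commutator S (x i) (x j) [^]\<^bsub>S\<^esub> b i j) \<in> carrier S"
      using p x commutator_closed[OF GS] by simp
    have "b l m = 0 \<or> b l m = 1" using b p by auto
    then have "\<phi> (commutator S (x l) (x m) [^]\<^bsub>S\<^esub> b l m) = \<one>\<^bsub>U4\<^esub>"
    proof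
      assume "b l m = 1"
      then show ?thesis
        using p x commutator_closed[OF GS x x] comm[OF p(2)] hom_commutator[OF \<phi>.group_hom_axioms x x]
        by (simp del: U4_simps)
    qed (simp del: U4_simps)
    then show "\<phi> (case p of (i, j) \<Rightarrow> commutator S (x i) (x j) [^]\<^bsub>S\<^esub> b i j) \<in> {\<one>\<^bsub>U4\<^esub>}"
      using p by (simp del: U4_simps)
  qed (simp_all add: less_rel_order)
  have t: "(l0, m0, m0) \<in> {(i, j, k). i < j \<and> k \<le> j}" using lm by simp
  obtain A where p3: "g3 \<in> carrier S"
    using has_ordered_prod_eventually[OF \<phi> S g3 t] by metis
  have p4: "s' \<in> carrier S" "\<phi> s' = \<one>\<^bsub>U4\<^esub>" using zassenhaus2_hom(3)[OF \<phi> S s'(1)] by simp_all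
  have "\<phi> s = \<phi> g3"
    using p1 p2 p3 p4 U4.l_one U4.r_one unfolding s'(2) by (simp add: \<phi>.hom_mult del: U4_simps(2,3))
  with g3 show thesis by (rule that)
qed

text \<open>Elementary matrices at the first and third superdiagonal positions commute, so the only
  noncommuting pairs of generators are {k, i} and {i, j}. Their commutators are those excluded by
  the vanishing of \<open>b\<close>, and triple commutators are central.\<close>

lemma canonical_decomposition_center:
  fixes x :: "'i::wellorder \<Rightarrow> 'g"
  assumes \<phi>: "\<phi> \<in> tgroup_hom S U4" and S: "topological_group S" and x: "\<And>l. x l \<in> carrier S"
    and \<phi>x: "\<And>l. \<phi> (x l) = (of_bool (l = k), of_bool (l = i), of_bool (l = j), 0, 0, 0)"
    and cd: "canonical_decomposition S x s a b c"
    and ijk: "i < j" "k < j" "i \<noteq> k"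
    and b: "k < i \<Longrightarrow> b k i = 0" "i < k \<Longrightarrow> b i k = 0" "b i j = 0"
  shows "\<phi> s \<in> u4_center"
proof -
  interpret \<phi>: group_hom S U4 \<phi> by (rule tgroup_hom_group_hom[OF \<phi> S])
  have GS: "group S" by (rule \<phi>.group_axioms)
  obtain g3 where g3: "has_ordered_prod S (less_rel <*lex*> less_rel <*lex*> less_rel)
          (\<lambda>(i, j, k). commutator S (commutator S (x i) (x j)) (x k) [^]\<^bsub>S\<^esub> c i j k)
          {(i, j, k). i < j \<and> k \<le> j} g3" "\<phi> s = \<phi> g3"
  proof (rule canonical_decomposition_eval[OF \<phi> S x cd ijk(1)])
    show "u4_mult (\<phi> (x l)) (\<phi> (x l)) = \<one>\<^bsub>U4\<^esub>" for l
      using ijk by (auto simp: \<phi>x)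
    show "commutator U4 (\<phi> (x l)) (\<phi> (x m)) = \<one>\<^bsub>U4\<^esub>" if "l < m" "b l m \<noteq> 0" for l m
    proof (rule U4_commutator_eq_one)
      have "\<not> (l = k \<and> m = i)" "\<not> (l = i \<and> m = k)" "\<not> (l = i \<and> m = j)" "\<not> (l = j \<and> m = i)"
        using that b ijk by auto
      then show "u4_mult (\<phi> (x l)) (\<phi> (x m)) = u4_mult (\<phi> (x m)) (\<phi> (x l))"
        unfolding \<phi>x by (auto simp: add_ac)
    qed
  qed
  have pow: "u [^]\<^bsub>U4\<^esub> q \<in> u4_center" if "u \<in> u4_center" for u and q :: nat
    using that subgroup.one_closed[OF subgroup_u4_center] subgroup.m_closed[OF subgroup_u4_center]
    by (induction q) (simp_all del: U4_simps)
  have "g3 \<in> carrier S \<and> \<phi> g3 \<in> u4_center"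
  proof (rule has_ordered_prod_subgroup[OF \<phi> S subgroup_u4_center _ _ _ g3(1)])
    show "(i, j, k) \<in> {(i, j, k). i < j \<and> k \<le> j}" using ijk by simp
    fix p :: "'i \<times> 'i \<times> 'i"
    obtain l m n where p: "p = (l, m, n)" by (metis prod_cases3)
    have cl: "commutator S (commutator S (x l) (x m)) (x n) \<in> carrier S"
      using x commutator_closed[OF GS] by simp
    then show "(case p of (i, j, k) \<Rightarrow> commutator S (commutator S (x i) (x j)) (x k) [^]\<^bsub>S\<^esub> c i j k) \<in> carrier S"
      using p by simp
    have "\<phi> (commutator S (commutator S (x l) (x m)) (x n)) \<in> u4_center"
      using x commutator_closed[OF GS x x] u4_commutator_center(1)[OF u4_commutator_lower2]
      by (simp add: hom_commutator[OF \<phi>.group_hom_axioms])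
    then have "\<phi> (commutator S (commutator S (x l) (x m)) (x n)) [^]\<^bsub>U4\<^esub> c l m n \<in> u4_center"
by (rule pow)
    then show "\<phi> (case p of (i, j, k) \<Rightarrow> commutator S (commutator S (x i) (x j)) (x k) [^]\<^bsub>S\<^esub> c i j k) \<in> u4_center"
      using p cl \<phi>.hom_nat_pow by simp
  qed (simp_all add: less_rel_order)
  then show ?thesis using g3(2) by simp
qed

lemma canonical_decomposition_nontrivial:
  fixes x :: "'i::wellorder \<Rightarrow> 'g"
  assumes \<phi>: "\<phi> \<in> tgroup_hom S U4" and S: "topological_group S" and x: "\<And>l. x l \<in> carrier S"
    and \<phi>x: "\<And>l. superdiag (\<phi> (x l)) = (of_bool (l = k), of_bool (l = i), of_bool (l = j))"
    and cd: "canonical_decomposition S x r a b c"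
    and ijk: "i < j" "k < j" "i \<noteq> k"
    and ab: "a k = 0" "a j = 0" "sym_exponent b i j = 0" "sym_exponent b k j = 0" "sym_exponent b k i = 0"
      "\<forall>l. l \<notin> {i, j, k} \<longrightarrow> sym_exponent b k l = 0 \<and> sym_exponent b j l = 0"
    and c: "c i j k \<noteq> 0"
  shows "\<phi> r \<noteq> \<one>\<^bsub>U4\<^esub>"
proof -
  interpret \<phi>: group_hom S U4 \<phi> by (rule tgroup_hom_group_hom[OF \<phi> S])
  have GS: "group S" by (rule \<phi>.group_axioms)
  have mid: "superdiag (\<phi> (x l)) = (0, of_bool (l = i), 0)" if "l \<noteq> k" "l \<noteq> j" for l
    using that by (simp add: \<phi>x)
  obtain g3 where g3: "has_ordered_prod S (less_rel <*lex*> less_rel <*lex*> less_rel)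
          (\<lambda>(i, j, k). commutator S (commutator S (x i) (x j)) (x k) [^]\<^bsub>S\<^esub> c i j k)
          {(i, j, k). i < j \<and> k \<le> j} g3" "\<phi> r = \<phi> g3"
  proof (rule canonical_decomposition_eval[OF \<phi> S x cd ijk(1)])
    show "u4_mult (\<phi> (x l)) (\<phi> (x l)) = \<one>\<^bsub>U4\<^esub>" if "a l \<noteq> 0" for l
    proof -
      have "l \<noteq> k" "l \<noteq> j" using that ab by auto
      then show ?thesis using superdiag_middle_commute(2)[OF mid mid] by blast
    qed
    show "commutator U4 (\<phi> (x l)) (\<phi> (x m)) = \<one>\<^bsub>U4\<^esub>" if lm: "l < m" "b l m \<noteq> 0" for l m
    proof (rule U4_commutator_eq_one)
      have se: "sym_exponent b l m \<noteq> 0" "sym_exponent b m l \<noteq> 0"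
        using lm by (auto simp: sym_exponent_def)
      have zero: "sym_exponent b k n = 0" "sym_exponent b j n = 0" if "n \<noteq> k" "n \<noteq> j" for n
        using ab that ijk by (cases "n = i"; auto simp: sym_exponent_def)+
      have "sym_exponent b j k = 0" using ab(4) ijk by (simp add: sym_exponent_def)
      have z: "sym_exponent b k n = 0" if "n \<noteq> k" for n
        using zero(1)[of n] ab(4) that by (cases "n = j") simp_all
      have z': "sym_exponent b j n = 0" if "n \<noteq> j" for n
        using zero(2)[of n] that \<open>sym_exponent b j k = 0\<close> by (cases "n = k") simp_all
      \<comment> \<open>A nonzero exponent forces both indices outside {k, j}, hence superdiagonals
        of the form (0, u, 0), whose matrices commute.\<close>
      have "l \<notin> {k, j}" "m \<notin> {k, j}" using se lm(1) z[of l] z[of m] z'[of l] z'[of m] by auto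
      then show "u4_mult (\<phi> (x l)) (\<phi> (x m)) = u4_mult (\<phi> (x m)) (\<phi> (x l))"
        using superdiag_middle_commute(1)[OF mid mid] by simp
    qed
  qed
  have triple: "\<phi> (commutator S (commutator S (x l) (x m)) (x n)) =
      (0, 0, 0, 0, 0, of_bool (l = i \<and> m = j \<and> n = k))"
    if "l < m" "n \<le> m" for l m n
  proof -
    have "\<phi> (commutator S (commutator S (x l) (x m)) (x n)) =
        commutator U4 (commutator U4 (\<phi> (x l)) (\<phi> (x m))) (\<phi> (x n))"
      using x commutator_closed[OF GS x x] by (simp add: hom_commutator[OF \<phi>.group_hom_axioms])
    also have "\<dots> = (0, 0, 0, 0, 0, (of_bool (l = k) * of_bool (m = i) + of_bool (m = k) * of_bool (l = i)) * of_bool (n = j)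
        + of_bool (n = k) * (of_bool (l = i) * of_bool (m = j) + of_bool (m = i) * of_bool (l = j)))"
      by (rule U4_triple_commutator[OF \<phi>x \<phi>x \<phi>x])
    \<comment> \<open>The other three summands would need \<open>j \<le> i\<close>,
      \<open>j \<le> k\<close> or \<open>j < i\<close>, against \<open>j\<close> being the largest
      of the three indices.\<close>
    also have "\<dots> = (0, 0, 0, 0, 0, of_bool (l = i \<and> m = j \<and> n = k))"
      using that ijk by auto
    finally show ?thesis .
  qed
  have J: "(i, j, k) \<in> {(i, j, k). i < j \<and> k \<le> j}" using ijk by simp
  have "g3 \<in> carrier S \<and> \<phi> g3 = \<phi> (case (i, j, k) of (i, j, k) \<Rightarrow> commutator S (commutator S (x i) (x j)) (x k) [^]\<^bsub>S\<^esub> c i j k)"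
  proof (rule has_ordered_prod_single[OF \<phi> S _ _ _ g3(1) J])
    fix p :: "'i \<times> 'i \<times> 'i" assume pJ: "p \<in> {(i, j, k). i < j \<and> k \<le> j}"
    obtain l m n where p: "p = (l, m, n)" by (metis prod_cases3)
    have cl: "commutator S (commutator S (x l) (x m)) (x n) \<in> carrier S"
      using x commutator_closed[OF GS] by simp
    then show "(case p of (i, j, k) \<Rightarrow> commutator S (commutator S (x i) (x j)) (x k) [^]\<^bsub>S\<^esub> c i j k) \<in> carrier S"
      using p by simp
    assume "p \<noteq> (i, j, k)"
    then have "\<phi> (commutator S (commutator S (x l) (x m)) (x n)) = \<one>\<^bsub>U4\<^esub>"
      using triple[of l m n] p pJ by auto
    then have "\<phi> (commutator S (commutator S (x l) (x m)) (x n) [^]\<^bsub>S\<^esub> c l m n) = \<one>\<^bsub>U4\<^esub>"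
      using cl by (simp add: \<phi>.hom_nat_pow del: U4_simps)
    then show "\<phi> (case p of (i, j, k) \<Rightarrow> commutator S (commutator S (x i) (x j)) (x k) [^]\<^bsub>S\<^esub> c i j k) = \<one>\<^bsub>U4\<^esub>"
      using p by (simp del: U4_simps)
  qed (simp_all add: less_rel_order)
  moreover have "c i j k \<in> {0, 1}"
    using cd ijk unfolding canonical_decomposition_def by (meson less_imp_le)
  then have "c i j k = 1" using c by simp
  ultimately have "\<phi> g3 = (0, 0, 0, 0, 0, 1)"
    using triple[OF ijk(1), of k] ijk x commutator_closed[OF GS] GS by (simp add: monoid.nat_pow_eone group.is_monoid)
  then show ?thesis using g3(2) by simp
qed

section \<open>Homomorphisms from the free pro-2 group to \<open>U4\<close>\<close>

lemma finite_discrete_pro_p_group: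
  assumes "group H" "finite (carrier H)" and top: "tg_top H = discrete_topology (carrier H)"
    and "Factorial_Ring.prime p" "order H = p ^ n"
  shows "pro_p_group p H"
proof -
  interpret group H by fact
  have "continuous_map (prod_topology (tg_top H) (tg_top H)) (tg_top H) (\<lambda>(x, y). x \<otimes>\<^bsub>H\<^esub> y)"
    unfolding continuous_map_def top openin_prod_topology_alt
  proof (intro conjI allI impI)
    fix U u v assume "(u, v) \<in> {p \<in> topspace (prod_topology (discrete_topology (carrier H)) (discrete_topology (carrier H))).
        (case p of (x, y) \<Rightarrow> x \<otimes>\<^bsub>H\<^esub> y) \<in> U}"
    then show "\<exists>V W. openin (discrete_topology (carrier H)) V \<and> openin (discrete_topology (carrier H)) W \<and> u \<in> V \<and> v \<in> W \<and>
        V \<times> W \<subseteq> {p \<in> topspace (prod_topology (discrete_topology (carrier H)) (discrete_topology (carrier H))).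
          (case p of (x, y) \<Rightarrow> x \<otimes>\<^bsub>H\<^esub> y) \<in> U}"
      by (intro exI[of _ "{u}"] exI[of _ "{v}"]) auto
  qed auto
  then have tg: "topological_group H"
    using assms(1) by (simp add: topological_group_def top continuous_map_def Pi_def)
  have "\<exists>K. subgroup K H \<and> openin (tg_top H) K \<and> K \<subseteq> U" if "\<one>\<^bsub>H\<^esub> \<in> U" for U
    using that triv_subgroup by (intro exI[of _ "{\<one>\<^bsub>H\<^esub>}"]) (simp add: top)
  then have "profinite_group H"
    using tg assms(2) by (simp add: profinite_group_def top compact_space_discrete_topology Hausdorff_space_discrete_topology)
  moreover have "\<exists>m. order (H Mod N) = p ^ m" if "N \<lhd> H" for N
  proof -
    have "card (rcosets\<^bsub>H\<^esub> N) * card N = p ^ n"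
      using lagrange[OF normal_imp_subgroup[OF that]] assms(5) by simp
    then have "card (rcosets\<^bsub>H\<^esub> N) dvd p ^ n" by (metis dvd_triv_left)
    then show ?thesis using divides_primepow_nat[OF assms(4)] by (auto simp: order_def FactGroup_def)
  qed
  ultimately show ?thesis by (simp add: pro_p_group_def)
qed

lemma free_pro_2_group_hom_U4:
  fixes x :: "'i \<Rightarrow> 'g" and y :: "'i \<Rightarrow> u4"
  assumes free: "free_pro_p_group 2 S x" and fin: "finite {l. y l \<noteq> \<one>\<^bsub>U4\<^esub>}"
  shows "\<exists>\<rho>\<in>tgroup_hom S U4. \<forall>l. \<rho> (x l) = y l"
proof -
  obtain e :: "u4 \<Rightarrow> nat" where e: "inj e"
    using finite_imp_inj_to_nat_seg[OF finite_UNIV_u4] by blast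
  \<comment> \<open>The universal property speaks of groups on the type
    \<open>('i \<times> nat) set\<close>, so \<open>U4\<close> is copied there as a set of
    singletons.\<close>
  define emb :: "u4 \<Rightarrow> ('i \<times> nat) set" where "emb u = {(undefined, e u)}" for u
  define de where "de = inv_into UNIV emb"
  have inj: "inj emb" using e by (auto simp: inj_def emb_def)
  have de [simp]: "de (emb u) = u" for u using inj by (simp add: de_def)
  define H where "H = \<lparr>carrier = range emb, mult = (\<lambda>u v. emb (u4_mult (de u) (de v))),
     one = emb (0, 0, 0, 0, 0, 0), tg_top = discrete_topology (range emb)\<rparr>"
  have H [simp]: "carrier H = range emb" "tg_top H = discrete_topology (range emb)"
    "emb u \<otimes>\<^bsub>H\<^esub> emb v = emb (u4_mult u v)" "\<one>\<^bsub>H\<^esub> = emb (0, 0, 0, 0, 0, 0)" for u v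
    by (simp_all add: H_def)
  have "group H"
  proof (rule groupI)
    show "\<exists>v\<in>carrier H. v \<otimes>\<^bsub>H\<^esub> u = \<one>\<^bsub>H\<^esub>" if u: "u \<in> carrier H" for u
    proof -
      have "u \<in> range emb" using u by simp
      then obtain w where w: "u = emb w" by blast
      have "u4_mult (inv\<^bsub>U4\<^esub> w) w = (0, 0, 0, 0, 0, 0)" using U4.l_inv[of w] by simp
      then show ?thesis using w by (intro bexI[of _ "emb (inv\<^bsub>U4\<^esub> w)"]) simp_all
    qed
  next
    fix u v w assume "u \<in> carrier H" "v \<in> carrier H" "w \<in> carrier H"
    then have "u \<in> range emb" "v \<in> range emb" "w \<in> range emb" by simp_all
    then obtain u' v' w' where uvw: "u = emb u'" "v = emb v'" "w = emb w'" by blast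
    show "u \<otimes>\<^bsub>H\<^esub> v \<otimes>\<^bsub>H\<^esub> w = u \<otimes>\<^bsub>H\<^esub> (v \<otimes>\<^bsub>H\<^esub> w)"
      using U4.m_assoc[of u' v' w'] by (simp add: uvw)
  next
    fix u v assume "u \<in> carrier H" "v \<in> carrier H"
    then have "u \<in> range emb" "v \<in> range emb" by simp_all
    then obtain u' v' where uv: "u = emb u'" "v = emb v'" by blast
    show "u \<otimes>\<^bsub>H\<^esub> v \<in> carrier H" by (simp add: uv)
  next
    fix u assume "u \<in> carrier H"
    then have "u \<in> range emb" by simp
    then obtain u' where u': "u = emb u'" by blast
    show "\<one>\<^bsub>H\<^esub> \<otimes>\<^bsub>H\<^esub> u = u" using U4.l_one[of u'] by (simp add: u')
  qed simp
  moreover have "order H = 2 ^ 6" using order_U4 inj by (simp add: order_def card_image)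
  ultimately have "pro_p_group 2 H"
    using finite_UNIV_u4 by (intro finite_discrete_pro_p_group[where n = 6]) (auto simp: two_is_prime_nat)
  moreover have "converges_to_one H (emb \<circ> y)"
    using fin by (auto simp: converges_to_one_def intro: rev_finite_subset)
  ultimately obtain h where h: "h \<in> tgroup_hom S H" "\<And>l. h (x l) = emb (y l)"
    using free unfolding free_pro_p_group_def by (metis comp_apply)
  have top: "topological_group S"
    using free by (simp add: free_pro_p_group_def pro_p_group_def profinite_group_def)
  have hom: "h \<in> hom S H" "continuous_map (tg_top S) (discrete_topology (range emb)) h"
    using h(1) by (simp_all add: tgroup_hom_def)
  have "de \<circ> h \<in> tgroup_hom S U4"
    unfolding tgroup_hom_def
  proof (intro CollectI conjI)
    show "de \<circ> h \<in> hom S U4"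
    proof (rule homI)
      fix g g' assume g: "g \<in> carrier S" "g' \<in> carrier S"
      then have "h g \<in> range emb" "h g' \<in> range emb" using hom_in_carrier[OF hom(1)] by simp_all
      then obtain u v where "h g = emb u" "h g' = emb v" by blast
      then show "(de \<circ> h) (g \<otimes>\<^bsub>S\<^esub> g') = (de \<circ> h) g \<otimes>\<^bsub>U4\<^esub> (de \<circ> h) g'"
        using hom_mult[OF hom(1) g] by simp
    qed simp
    show "continuous_map (tg_top S) (tg_top U4) (de \<circ> h)"
      using hom(2) by (rule continuous_map_compose) (simp add: continuous_map_def)
  qed
  then show ?thesis using h(2) by (intro bexI[of _ "de \<circ> h"]) simp_all
qed

text \<open>Models the relation that the classes of \<open>g\<close> and \<open>t\<close> correspond
  under an isomorphism of quotients. The last clause expresses that saturated open sets, the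
  preimages of open sets of the quotient, are carried to open sets.\<close>

definition tgroup_corr :: "'a tgroup \<Rightarrow> 'b tgroup \<Rightarrow> ('a \<Rightarrow> 'b \<Rightarrow> bool) \<Rightarrow> bool" where
  "tgroup_corr G H L \<longleftrightarrow>
     (\<forall>g t. L g t \<longrightarrow> g \<in> carrier G \<and> t \<in> carrier H) \<and> (\<forall>t\<in>carrier H. \<exists>g. L g t) \<and>
     (\<forall>g t g' t'. L g t \<longrightarrow> L g' t' \<longrightarrow> L (g \<otimes>\<^bsub>G\<^esub> g') (t \<otimes>\<^bsub>H\<^esub> t')) \<and>
     (\<forall>U. openin (tg_top G) U \<longrightarrow> (\<forall>g t g'. g \<in> U \<longrightarrow> L g t \<longrightarrow> L g' t \<longrightarrow> g' \<in> U) \<longrightarrow>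
        openin (tg_top H) {t. \<exists>g\<in>U. L g t})"

text \<open>A map constant on the fibres of \<open>L\<close> factors through the common quotient and
  can be read on the other group. The target is just a binary operation \<open>opr\<close>, which
  covers both \<open>U4\<close> and its quotient by the centre.\<close>

lemma tgroup_corr_transfer:
  assumes L: "tgroup_corr G H L"
    and f: "\<And>g t g'. L g t \<Longrightarrow> L g' t \<Longrightarrow> f g = f g'"
    and hom: "\<And>g g'. g \<in> carrier G \<Longrightarrow> g' \<in> carrier G \<Longrightarrow> f (g \<otimes>\<^bsub>G\<^esub> g') = opr (f g) (f g')"
    and op: "\<And>V. openin (tg_top G) {g \<in> carrier G. f g \<in> V}"
  shows "\<exists>f'. (\<forall>g t. L g t \<longrightarrow> f' t = f g) \<and>
    (\<forall>t\<in>carrier H. \<forall>t'\<in>carrier H. f' (t \<otimes>\<^bsub>H\<^esub> t') = opr (f' t) (f' t')) \<and>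
    (\<forall>V. openin (tg_top H) {t \<in> carrier H. f' t \<in> V})"
proof -
  define f' where "f' t = f (SOME g. L g t)" for t
  have f': "f' t = f g" if "L g t" for g t
    unfolding f'_def using someI[of "\<lambda>g. L g t"] f that by metis
  have car: "g \<in> carrier G" "t \<in> carrier H" if "L g t" for g t
    using L that by (auto simp: tgroup_corr_def)
  have ex: "\<exists>g. L g t" if "t \<in> carrier H" for t using L that by (simp add: tgroup_corr_def)
  have "f' (t \<otimes>\<^bsub>H\<^esub> t') = opr (f' t) (f' t')" if t: "t \<in> carrier H" "t' \<in> carrier H" for t t'
  proof -
    obtain g g' where g: "L g t" "L g' t'" using ex t by metis
    then have "L (g \<otimes>\<^bsub>G\<^esub> g') (t \<otimes>\<^bsub>H\<^esub> t')" using L by (simp add: tgroup_corr_def)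
    then show ?thesis
      using f'[OF g(1)] f'[OF g(2)] hom[OF car(1)[OF g(1)] car(1)[OF g(2)]] by (simp add: f')
  qed
  moreover have "openin (tg_top H) {t \<in> carrier H. f' t \<in> V}" for V
  proof -
    let ?U = "{g \<in> carrier G. f g \<in> V}"
    have "g' \<in> ?U" if "g \<in> ?U" "L g t" "L g' t" for g t g'
      using that f[OF that(2,3)] car(1)[OF that(3)] by simp
    then have "openin (tg_top H) {t. \<exists>g\<in>?U. L g t}"
      using L op[of V] unfolding tgroup_corr_def by blast
    moreover have "{t. \<exists>g\<in>?U. L g t} = {t \<in> carrier H. f' t \<in> V}"
    proof (intro antisym subsetI)
      fix t assume "t \<in> {t. \<exists>g\<in>?U. L g t}"
      then show "t \<in> {t \<in> carrier H. f' t \<in> V}" using f' car by auto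
    next
      fix t assume t: "t \<in> {t \<in> carrier H. f' t \<in> V}"
      then obtain g where g: "L g t" using ex by blast
      then show "t \<in> {t. \<exists>g\<in>?U. L g t}" using t f'[OF g] car(1)[OF g] by auto
    qed
    ultimately show ?thesis by simp
  qed
  ultimately show ?thesis using f' by (intro exI[of _ f']) simp
qed

lemma topspace_quotient_top:
  assumes "group G" "topspace (tg_top G) = carrier G"
  shows "topspace (quotient_top G N) = carrier (G Mod N)"
proof -
  have "{g \<in> topspace (tg_top G). N #>\<^bsub>G\<^esub> g \<in> carrier (G Mod N)} = topspace (tg_top G)"
    using assms by (auto simp: FactGroup_def RCOSETS_def)
  then have "openin (quotient_top G N) (carrier (G Mod N))" by (simp add: openin_quotient_top)
  then show ?thesis
    by (metis openin_quotient_top openin_subset openin_topspace subset_antisym)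
qed

text \<open>A saturated open set is pushed to one quotient, moved through \<open>h\<close>, and
  pulled back to the other group. One direction uses that \<open>h\<close> is open, the other that
  it is continuous.\<close>

lemma quotient_tgroup_corr:
  assumes G: "group G" "topspace (tg_top G) = carrier G" "N \<lhd> G"
    and H: "group H" "topspace (tg_top H) = carrier H" "M \<lhd> H"
    and h: "h \<in> iso (quotient_tgroup G N) (quotient_tgroup H M)"
      "homeomorphic_map (tg_top (quotient_tgroup G N)) (tg_top (quotient_tgroup H M)) h"
    and L: "L = (\<lambda>g t. g \<in> carrier G \<and> t \<in> carrier H \<and> h (N #>\<^bsub>G\<^esub> g) = M #>\<^bsub>H\<^esub> t)"
  shows "tgroup_corr G H L" "tgroup_corr H G (\<lambda>t g. L g t)"
    "\<And>g t g'. L g t \<Longrightarrow> L g' t \<Longrightarrow> N #>\<^bsub>G\<^esub> g = N #>\<^bsub>G\<^esub> g'"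
proof -
  have qc [simp]: "carrier (quotient_tgroup G N) = rcosets\<^bsub>G\<^esub> N" "carrier (quotient_tgroup H M) = rcosets\<^bsub>H\<^esub> M"
    "tg_top (quotient_tgroup G N) = quotient_top G N" "tg_top (quotient_tgroup H M) = quotient_top H M"
    "mult (quotient_tgroup G N) = set_mult G" "mult (quotient_tgroup H M) = set_mult H"
    by (simp_all add: quotient_tgroup_def FactGroup_def)
  have cosG: "N #>\<^bsub>G\<^esub> g \<in> rcosets\<^bsub>G\<^esub> N" if "g \<in> carrier G" for g using that by (auto simp: RCOSETS_def)
  have cosH: "M #>\<^bsub>H\<^esub> t \<in> rcosets\<^bsub>H\<^esub> M" if "t \<in> carrier H" for t using that by (auto simp: RCOSETS_def)
  have bij: "bij_betw h (rcosets\<^bsub>G\<^esub> N) (rcosets\<^bsub>H\<^esub> M)" using h(1) by (simp add: iso_def)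
  have hom: "h (C <#>\<^bsub>G\<^esub> D) = h C <#>\<^bsub>H\<^esub> h D" if "C \<in> rcosets\<^bsub>G\<^esub> N" "D \<in> rcosets\<^bsub>G\<^esub> N" for C D
    using h(1) that by (auto simp: iso_def hom_def)
  show inj: "N #>\<^bsub>G\<^esub> g = N #>\<^bsub>G\<^esub> g'" if "L g t" "L g' t" for g t g'
    using bij_betw_imp_inj_on[OF bij] that cosG by (auto simp: L dest: inj_onD)
  have ex1: "\<exists>g. L g t" if "t \<in> carrier H" for t
  proof -
    have "M #>\<^bsub>H\<^esub> t \<in> h ` (rcosets\<^bsub>G\<^esub> N)" using bij_betw_imp_surj_on[OF bij] cosH[OF that] by simp
    then show ?thesis using that by (auto simp: L RCOSETS_def)
  qed
  have ex2: "\<exists>t. L g t" if "g \<in> carrier G" for g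
  proof -
    have "h (N #>\<^bsub>G\<^esub> g) \<in> rcosets\<^bsub>H\<^esub> M" using bij_betw_apply[OF bij cosG[OF that]] .
    then show ?thesis using that by (auto simp: L RCOSETS_def)
  qed
  have mult: "L (g \<otimes>\<^bsub>G\<^esub> g') (t \<otimes>\<^bsub>H\<^esub> t')" if "L g t" "L g' t'" for g t g' t'
  proof -
    have c: "g \<in> carrier G" "g' \<in> carrier G" "t \<in> carrier H" "t' \<in> carrier H" using that by (auto simp: L)
    have "h (N #>\<^bsub>G\<^esub> (g \<otimes>\<^bsub>G\<^esub> g')) = h ((N #>\<^bsub>G\<^esub> g) <#>\<^bsub>G\<^esub> (N #>\<^bsub>G\<^esub> g'))"
      using normal.rcos_sum[OF G(3)] c by simp
    also have "\<dots> = (M #>\<^bsub>H\<^esub> t) <#>\<^bsub>H\<^esub> (M #>\<^bsub>H\<^esub> t')" using hom cosG c that by (simp add: L)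
    also have "\<dots> = M #>\<^bsub>H\<^esub> (t \<otimes>\<^bsub>H\<^esub> t')" using normal.rcos_sum[OF H(3)] c by simp
    finally show ?thesis using c G(1) H(1) by (simp add: L monoid.m_closed group.is_monoid)
  qed
  have tG: "topspace (quotient_top G N) = rcosets\<^bsub>G\<^esub> N"
    using topspace_quotient_top[OF G(1,2)] by (simp add: FactGroup_def)
  have open1: "openin (tg_top H) {t. \<exists>g\<in>U. L g t}"
    if U: "openin (tg_top G) U" and sat: "\<forall>g t g'. g \<in> U \<longrightarrow> L g t \<longrightarrow> L g' t \<longrightarrow> g' \<in> U" for U
  proof -
    have UG: "U \<subseteq> carrier G" using openin_subset[OF U] G(2) by simp
    \<comment> \<open>Saturation of \<open>U\<close> under \<open>L\<close> means that
      \<open>U\<close> is a union of cosets, since every element of \<open>G\<close> has a partner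
      in \<open>H\<close>.\<close>
    have "{g \<in> topspace (tg_top G). N #>\<^bsub>G\<^esub> g \<in> (\<lambda>g. N #>\<^bsub>G\<^esub> g) ` U} = U"
    proof (intro antisym subsetI)
      fix g assume "g \<in> {g \<in> topspace (tg_top G). N #>\<^bsub>G\<^esub> g \<in> (\<lambda>g. N #>\<^bsub>G\<^esub> g) ` U}"
      then obtain g' where g: "g \<in> carrier G" "g' \<in> U" "N #>\<^bsub>G\<^esub> g = N #>\<^bsub>G\<^esub> g'" using G(2) by auto
      then obtain t where "L g' t" using ex2 UG by blast
      then have "L g t" using g by (simp add: L)
      with \<open>L g' t\<close> show "g \<in> U" using sat g(2) by blast
    qed (use UG G(2) in auto)
    then have "openin (quotient_top G N) ((\<lambda>g. N #>\<^bsub>G\<^esub> g) ` U)"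
      using U UG cosG by (auto simp: openin_quotient_top FactGroup_def)
    then have "openin (quotient_top H M) (h ` (\<lambda>g. N #>\<^bsub>G\<^esub> g) ` U)"
      using homeomorphic_imp_open_map[OF h(2)] by (simp add: open_map_def)
    then have "openin (tg_top H) {t \<in> topspace (tg_top H). M #>\<^bsub>H\<^esub> t \<in> h ` (\<lambda>g. N #>\<^bsub>G\<^esub> g) ` U}"
      by (simp add: openin_quotient_top)
    moreover have "{t \<in> topspace (tg_top H). M #>\<^bsub>H\<^esub> t \<in> h ` (\<lambda>g. N #>\<^bsub>G\<^esub> g) ` U} = {t. \<exists>g\<in>U. L g t}"
      using UG H(2) by (auto simp: L)
    ultimately show ?thesis by simp
  qed
  have open2: "openin (tg_top G) {g. \<exists>t\<in>U. L g t}"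
    if U: "openin (tg_top H) U" and sat: "\<forall>t g t'. t \<in> U \<longrightarrow> L g t \<longrightarrow> L g t' \<longrightarrow> t' \<in> U" for U
  proof -
    have UH: "U \<subseteq> carrier H" using openin_subset[OF U] H(2) by simp
    have "{t \<in> topspace (tg_top H). M #>\<^bsub>H\<^esub> t \<in> (\<lambda>t. M #>\<^bsub>H\<^esub> t) ` U} = U"
    proof (intro antisym subsetI)
      fix t assume "t \<in> {t \<in> topspace (tg_top H). M #>\<^bsub>H\<^esub> t \<in> (\<lambda>t. M #>\<^bsub>H\<^esub> t) ` U}"
      then obtain t' where t: "t \<in> carrier H" "t' \<in> U" "M #>\<^bsub>H\<^esub> t = M #>\<^bsub>H\<^esub> t'" using H(2) by auto
      then obtain g where "L g t'" using ex1 UH by blast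
      then have "L g t" using t by (simp add: L)
      with \<open>L g t'\<close> show "t \<in> U" using sat t(2) by blast
    qed (use UH H(2) in auto)
    then have "openin (quotient_top H M) ((\<lambda>t. M #>\<^bsub>H\<^esub> t) ` U)"
      using U UH cosH by (auto simp: openin_quotient_top FactGroup_def)
    then have "openin (quotient_top G N) {C \<in> topspace (quotient_top G N). h C \<in> (\<lambda>t. M #>\<^bsub>H\<^esub> t) ` U}"
      using homeomorphic_imp_continuous_map[OF h(2)] by (intro openin_continuous_map_preimage) simp_all
    then have "openin (tg_top G) {g \<in> topspace (tg_top G).
        N #>\<^bsub>G\<^esub> g \<in> {C \<in> topspace (quotient_top G N). h C \<in> (\<lambda>t. M #>\<^bsub>H\<^esub> t) ` U}}"
      by (simp only: openin_quotient_top)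
    moreover have "{g \<in> topspace (tg_top G).
        N #>\<^bsub>G\<^esub> g \<in> {C \<in> topspace (quotient_top G N). h C \<in> (\<lambda>t. M #>\<^bsub>H\<^esub> t) ` U}} = {g. \<exists>t\<in>U. L g t}"
      using UH G(2) tG cosG by (auto simp: L)
    ultimately show ?thesis by simp
  qed
  show "tgroup_corr G H L"
    unfolding tgroup_corr_def using ex1 mult open1 by (auto simp: L)
  show "tgroup_corr H G (\<lambda>t g. L g t)"
    unfolding tgroup_corr_def using ex2 mult open2 by (auto simp: L)
qed

lemma normal_Inter:
  assumes "group G" "\<N> \<noteq> {}" "\<And>N. N \<in> \<N> \<Longrightarrow> N \<lhd> G"
  shows "\<Inter>\<N> \<lhd> G"
proof -
  interpret group G by fact
  have "subgroup (\<Inter>\<N>) G"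
    using assms(2,3) normal_imp_subgroup by (intro subgroups_Inter) auto
  moreover have "g \<otimes>\<^bsub>G\<^esub> n \<otimes>\<^bsub>G\<^esub> inv\<^bsub>G\<^esub> g \<in> \<Inter>\<N>" if "g \<in> carrier G" "n \<in> \<Inter>\<N>" for g n
    using that normal.inv_op_closed2[OF assms(3)] by blast
  ultimately show ?thesis by (simp add: normal_inv_iff)
qed

text \<open>The index of the kernel is the order of a subgroup of \<open>U4\<close>, hence a divisor
  of 64. This is why a continuous homomorphism to \<open>U4\<close> factors through the maximal
  pro-2 quotient.\<close>

lemma kernel_in_p_power_open_normal:
  assumes "group_hom G U4 \<Phi>" "openin (tg_top G) (kernel G U4 \<Phi>)"
  shows "kernel G U4 \<Phi> \<in> p_power_open_normal 2 G"
proof -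
  interpret group_hom G U4 \<Phi> by fact
  let ?Q = "G Mod kernel G U4 \<Phi>" and ?f = "\<lambda>C. the_elem (\<Phi> ` C)"
  have "group_hom ?Q U4 ?f"
    using FactGroup_hom normal.factorgroup_is_group[OF normal_kernel] group_U4
    by (simp add: group_hom_def group_hom_axioms_def)
  then have "subgroup (?f ` carrier ?Q) U4" by (rule group_hom.img_is_subgroup)
  then have "card (rcosets\<^bsub>U4\<^esub> (?f ` carrier ?Q)) * card (?f ` carrier ?Q) = 2 ^ 6"
    using U4.lagrange order_U4 by simp
  then have "card (?f ` carrier ?Q) dvd 2 ^ 6" by (metis dvd_triv_right)
  then have "order ?Q dvd 2 ^ 6" using card_image[OF FactGroup_inj_on] by (simp add: order_def)
  then have "\<exists>n. order ?Q = 2 ^ n" using divides_primepow_nat[OF two_is_prime_nat] by blast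
  then show ?thesis using assms(2) normal_kernel by (simp add: p_power_open_normal_def)
qed

lemma same_coset_decompose:
  assumes "group G" "N \<lhd> G" "g \<in> carrier G" "g' \<in> carrier G" "N #>\<^bsub>G\<^esub> g = N #>\<^bsub>G\<^esub> g'"
  obtains n where "n \<in> N" "g = n \<otimes>\<^bsub>G\<^esub> g'"
proof -
  have "g \<in> N #>\<^bsub>G\<^esub> g" using group.rcos_self[OF assms(1,3) normal_imp_subgroup[OF assms(2)]] .
  then have "g \<in> N #>\<^bsub>G\<^esub> g'" by (simp only: assms(5))
  then show thesis using that by (auto simp: r_coset_def)
qed

text \<open>The projection of \<open>U4\<close> onto its quotient by the centre, with quintuples in
  place of cosets.\<close>

definition u4_trunc :: "u4 \<Rightarrow> bit \<times> bit \<times> bit \<times> bit \<times> bit" where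
  "u4_trunc = (\<lambda>(a, b, c, d, e, f). (a, b, c, d, e))"

fun u4_trunc_mult :: "bit \<times> bit \<times> bit \<times> bit \<times> bit \<Rightarrow> bit \<times> bit \<times> bit \<times> bit \<times> bit \<Rightarrow> bit \<times> bit \<times> bit \<times> bit \<times> bit" where
  "u4_trunc_mult (a, b, c, d, e) (a', b', c', d', e') =
     (a + a', b + b', c + c', d + d' + a * b', e + e' + b * c')"

lemma u4_trunc_mult: "u4_trunc (u4_mult u v) = u4_trunc_mult (u4_trunc u) (u4_trunc v)"
  by (cases u; cases v) (simp add: u4_trunc_def)

lemma u4_trunc_center: "u \<in> u4_center \<Longrightarrow> u4_trunc (u4_mult u v) = u4_trunc v"
  by (cases v) (auto simp: u4_center_def u4_trunc_def)

lemma u4_center_conjugate: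
  assumes "u \<in> u4_center" shows "v \<otimes>\<^bsub>U4\<^esub> u \<otimes>\<^bsub>U4\<^esub> inv\<^bsub>U4\<^esub> v = u"
proof -
  have "v \<otimes>\<^bsub>U4\<^esub> u = u \<otimes>\<^bsub>U4\<^esub> v" using assms by (cases v) (auto simp: u4_center_def add_ac)
  then have "v \<otimes>\<^bsub>U4\<^esub> u \<otimes>\<^bsub>U4\<^esub> inv\<^bsub>U4\<^esub> v = u \<otimes>\<^bsub>U4\<^esub> (v \<otimes>\<^bsub>U4\<^esub> inv\<^bsub>U4\<^esub> v)"
    using U4.m_assoc[of u v "inv\<^bsub>U4\<^esub> v"] by (simp del: U4_simps(2,3))
  then show ?thesis using U4.r_inv[of v] U4.r_one[of u] by (simp del: U4_simps(2,3))
qed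

text \<open>Vanishing of triple Massey products modulo \<open>2\<close> for absolute Galois groups, in the case of linearly
  independent characters.\<close>
lemma galois_massey_lift:
  fixes F :: "'f::field itself" and f :: "('f alg_closure \<Rightarrow> 'f alg_closure) \<Rightarrow> bit \<times> bit \<times> bit \<times> bit \<times> bit"
  defines "\<Gamma> \<equiv> absolute_galois_group F"
  assumes hom: "\<And>s t. s \<in> carrier \<Gamma> \<Longrightarrow> t \<in> carrier \<Gamma> \<Longrightarrow> f (s \<otimes>\<^bsub>\<Gamma>\<^esub> t) = u4_trunc_mult (f s) (f t)"
    and op: "\<And>V. openin (tg_top \<Gamma>) {t \<in> carrier \<Gamma>. f t \<in> V}"
    and s1: "s1 \<in> carrier \<Gamma>" "f s1 = (1, 0, 0, d1, e1)"
    and s2: "s2 \<in> carrier \<Gamma>" "f s2 = (0, 1, 0, d2, e2)"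
    and s3: "s3 \<in> carrier \<Gamma>" "f s3 = (0, 0, 1, d3, e3)"
  shows "\<exists>\<Phi>. \<Phi> \<in> hom \<Gamma> U4 \<and> (\<forall>V. openin (tg_top \<Gamma>) {t \<in> carrier \<Gamma>. \<Phi> t \<in> V}) \<and>
    (\<forall>t a b c d e. f t = (a, b, c, d, e) \<longrightarrow> superdiag (\<Phi> t) = (a, b, c))"
proof -
  interpret field_action \<Gamma> separable_closure "\<lambda>\<sigma>. \<sigma>"
    unfolding \<Gamma>_def by (rule field_action_galois)
  define A B C D E where "A t = fst (f t)" and "B t = fst (snd (f t))" and "C t = fst (snd (snd (f t)))"
    and "D t = fst (snd (snd (snd (f t))))" and "E t = snd (snd (snd (snd (f t))))" for t
  have ft: "f t = (A t, B t, C t, D t, E t)" for t by (simp add: A_def B_def C_def D_def E_def)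
  have homs: "A (s \<otimes>\<^bsub>\<Gamma>\<^esub> t) = A s + A t" "B (s \<otimes>\<^bsub>\<Gamma>\<^esub> t) = B s + B t" "C (s \<otimes>\<^bsub>\<Gamma>\<^esub> t) = C s + C t"
    "D (s \<otimes>\<^bsub>\<Gamma>\<^esub> t) = D s + D t + A s * B t" "E (s \<otimes>\<^bsub>\<Gamma>\<^esub> t) = E s + E t + B s * C t"
    if "s \<in> carrier \<Gamma>" "t \<in> carrier \<Gamma>" for s t
    using hom[OF that] by (simp_all add: ft)
  have "f \<one>\<^bsub>\<Gamma>\<^esub> = (0, 0, 0, 0, 0)"
    using homs[of "\<one>\<^bsub>\<Gamma>\<^esub>" "\<one>\<^bsub>\<Gamma>\<^esub>"] by (simp add: ft)
  then have "\<one>\<^bsub>\<Gamma>\<^esub> \<in> {t \<in> carrier \<Gamma>. f t \<in> {(0, 0, 0, 0, 0)}}" by simp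
  \<comment> \<open>Continuity of \<open>f\<close> at the identity turns into the finite set
    \<open>T\<close> demanded by \<open>massey_data\<close>.\<close>
  then obtain T where T: "finite T" "T \<subseteq> separable_closure"
    "\<And>\<sigma>. \<sigma> \<in> galois_carrier \<Longrightarrow> \<forall>t\<in>T. \<sigma> t = t \<Longrightarrow> \<sigma> \<in> {t \<in> carrier \<Gamma>. f t \<in> {(0, 0, 0, 0, 0)}}"
    using galois_open_nhd_one[of F, folded \<Gamma>_def, OF op[of "{(0, 0, 0, 0, 0)}"]] by blast
  have agree_iff: "agree U g \<one>\<^bsub>\<Gamma>\<^esub> \<longleftrightarrow> (\<forall>t\<in>U. g t = t)" if "U \<subseteq> separable_closure" for U g
    using that act_id by (auto simp: agree_def)
  have car: "carrier \<Gamma> = galois_carrier" by (simp add: \<Gamma>_def)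
  interpret massey_data \<Gamma> separable_closure "\<lambda>\<sigma>. \<sigma>" A B C D E T s1 s2 s3
  proof unfold_locales
    fix g assume g: "g \<in> carrier \<Gamma>" "agree T g \<one>\<^bsub>\<Gamma>\<^esub>"
    then have "f g = (0, 0, 0, 0, 0)" using T(3)[of g] agree_iff[OF T(2)] by (simp add: car)
    then show "A g = 0 \<and> B g = 0 \<and> C g = 0 \<and> D g = 0 \<and> E g = 0" by (simp add: ft)
  qed (use homs T(1,2) s1 s2 s3 in \<open>simp_all add: ft\<close>)
  have "\<exists>D' E' F' T'. lift D' E' F' T'"
  proof (cases "(2 :: 'f alg_closure) = 0")
    case True
    then show ?thesis by (intro lift_char_2 separable_closure_artin_schreier)
  next
    case False
    then show ?thesis by (intro lift_char_neq_2 separable_closure_sqrt)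
  qed
  then obtain D' E' F' T' where lift: "lift D' E' F' T'" by blast
  define \<Phi> where "\<Phi> t = (A t, B t, C t, D' t, E' t, F' t)" for t
  have hom\<Phi>: "\<Phi> \<in> hom \<Gamma> U4"
    using lift homs by (intro homI) (simp_all add: \<Phi>_def lift_def)
  have T': "finite T'" "T' \<subseteq> separable_closure" using lift by (simp_all add: lift_def)
  have triv: "\<Phi> t = \<one>\<^bsub>U4\<^esub>" if "t \<in> carrier \<Gamma>" "agree T' t \<one>\<^bsub>\<Gamma>\<^esub>" for t
    using lift that by (simp add: \<Phi>_def lift_def)
  \<comment> \<open>Being trivial on the stabilizer of \<open>T'\<close>, the homomorphism is
    constant on its cosets; this gives its continuity.\<close>
  have eq: "\<Phi> g = \<Phi> n" if n: "n \<in> carrier \<Gamma>" and g: "g \<in> carrier \<Gamma>" and ag: "\<forall>t\<in>T'. g t = n t" for g n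
  proof -
    have i: "inv\<^bsub>\<Gamma>\<^esub> n \<in> carrier \<Gamma>" "inv\<^bsub>\<Gamma>\<^esub> n \<otimes>\<^bsub>\<Gamma>\<^esub> g \<in> carrier \<Gamma>" using n g by simp_all
    have "agree T' (inv\<^bsub>\<Gamma>\<^esub> n \<otimes>\<^bsub>\<Gamma>\<^esub> g) \<one>\<^bsub>\<Gamma>\<^esub>"
      unfolding agree_iff[OF T'(2)]
    proof
      fix t assume t: "t \<in> T'"
      then have "t \<in> separable_closure" using T'(2) by blast
      then show "(inv\<^bsub>\<Gamma>\<^esub> n \<otimes>\<^bsub>\<Gamma>\<^esub> g) t = t" using act_comp[OF i(1) g] act_inv(1)[OF n] ag t by simp
    qed
    then have "\<Phi> (inv\<^bsub>\<Gamma>\<^esub> n \<otimes>\<^bsub>\<Gamma>\<^esub> g) = \<one>\<^bsub>U4\<^esub>" by (rule triv[OF i(2)])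
    then have "\<Phi> (n \<otimes>\<^bsub>\<Gamma>\<^esub> (inv\<^bsub>\<Gamma>\<^esub> n \<otimes>\<^bsub>\<Gamma>\<^esub> g)) = \<Phi> n"
      using hom_mult[OF hom\<Phi> n i(2)] U4.r_one[of "\<Phi> n"] by (simp del: U4_simps(2,3))
    then show ?thesis using n g i(1) by (simp flip: m_assoc)
  qed
  show ?thesis
  proof (intro exI[of _ \<Phi>] conjI allI impI hom\<Phi>)
    show "openin (tg_top \<Gamma>) {t \<in> carrier \<Gamma>. \<Phi> t \<in> V}" for V
      unfolding \<Gamma>_def
    proof (rule galois_open_set[OF T'])
      fix n g assume "n \<in> {t \<in> carrier (absolute_galois_group F). \<Phi> t \<in> V}" "g \<in> galois_carrier" "\<forall>t\<in>T'. g t = n t"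
      then show "g \<in> {t \<in> carrier (absolute_galois_group F). \<Phi> t \<in> V}" using eq[of n g] by (simp add: car)
    qed simp
    show "superdiag (\<Phi> t) = (a, b, c)" if "f t = (a, b, c, d, e)" for t a b c d e
      using that by (simp add: \<Phi>_def superdiag_def ft)
  qed
qed

theorem theorem1p3:
  fixes S :: "'g tgroup" and x :: "'i::wellorder \<Rightarrow> 'g" and R :: "'g set"
    and r :: 'g and i j k :: 'i
    and a :: "'i \<Rightarrow> nat" and b :: "'i \<Rightarrow> 'i \<Rightarrow> nat" and c :: "'i \<Rightarrow> 'i \<Rightarrow> 'i \<Rightarrow> nat"
    and F :: "'f::field itself"
  assumes "free_pro_p_group 2 S x"
    and "R \<subseteq> zassenhaus2 S 2"
    and "r \<in> R"
    and "i \<noteq> j" and "j \<noteq> k" and "i \<noteq> k" and "i < j" and "k < j"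
    and "canonical_decomposition S x r a b c"
    and "a k = 0" and "a j = 0"
    and "sym_exponent b i j = 0" and "sym_exponent b k j = 0" and "sym_exponent b k i = 0"
    and "\<forall>l. l \<notin> {i, j, k} \<longrightarrow> sym_exponent b k l = 0 \<and> sym_exponent b j l = 0"
    and "c i j k \<noteq> 0"
    and "\<forall>s\<in>R. s \<noteq> r \<longrightarrow>
           (\<exists>a' b' c'. canonical_decomposition S x s a' b' c' \<and>
              (k < i \<longrightarrow> b' k i = 0) \<and> (i < k \<longrightarrow> b' i k = 0) \<and> b' i j = 0)"
  shows "\<not> tgroup_isomorphic (quotient_tgroup S (closed_normal_subgroup_generated S R))
             (max_pro_p_quotient 2 (absolute_galois_group F))"
proof
  define \<Gamma> where "\<Gamma> = absolute_galois_group F"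
  define M where "M = \<Inter>(p_power_open_normal 2 \<Gamma>)"
  define N where "N = closed_normal_subgroup_generated S R"
  assume "tgroup_isomorphic (quotient_tgroup S (closed_normal_subgroup_generated S R))
             (max_pro_p_quotient 2 (absolute_galois_group F))"
  then obtain h where h: "h \<in> iso (quotient_tgroup S N) (quotient_tgroup \<Gamma> M)"
      "homeomorphic_map (tg_top (quotient_tgroup S N)) (tg_top (quotient_tgroup \<Gamma> M)) h"
    unfolding tgroup_isomorphic_def max_pro_p_quotient_def N_def M_def \<Gamma>_def by blast
  have S: "topological_group S" and x: "\<And>l. x l \<in> carrier S"
    using assms(1) by (auto simp: free_pro_p_group_def pro_p_group_def profinite_group_def converges_to_one_def)
  interpret S: group S by (rule group_tgroup(1)[OF S])
  interpret \<Gamma>: group \<Gamma> unfolding \<Gamma>_def by (rule group_absolute_galois_group)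
  have top\<Gamma>: "topspace (tg_top \<Gamma>) = carrier \<Gamma>" by (simp add: \<Gamma>_def)
  \<comment> \<open>The order k, i, j along the superdiagonal lets the commutator of
    \<open>x i\<close> and \<open>x j\<close> combine with \<open>x k\<close> to reach the corner
    entry.\<close>
  define y :: "'i \<Rightarrow> u4" where "y l = (of_bool (l = k), of_bool (l = i), of_bool (l = j), 0, 0, 0)" for l
  have "{l. y l \<noteq> \<one>\<^bsub>U4\<^esub>} \<subseteq> {i, j, k}" by (auto simp: y_def)
  then have "finite {l. y l \<noteq> \<one>\<^bsub>U4\<^esub>}" by (rule finite_subset) simp
  then obtain \<rho> where \<rho>: "\<rho> \<in> tgroup_hom S U4" "\<And>l. \<rho> (x l) = y l"
    using free_pro_2_group_hom_U4[OF assms(1), of y] by blast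
  interpret \<rho>: group_hom S U4 \<rho> by (rule tgroup_hom_group_hom[OF \<rho>(1) S])
  define Z where "Z = {g \<in> carrier S. \<rho> g \<in> u4_center}"
  \<comment> \<open>For \<open>r\<close> itself this vanishing is part of hypothesis (i).\<close>
  have "\<exists>a' b' c'. canonical_decomposition S x s a' b' c' \<and>
      (k < i \<longrightarrow> b' k i = 0) \<and> (i < k \<longrightarrow> b' i k = 0) \<and> b' i j = 0" if "s \<in> R" for s
  proof (cases "s = r")
    case True
    then show ?thesis
      using assms(7,9,12,14) by (intro exI[of _ a] exI[of _ b] exI[of _ c]) (auto simp: sym_exponent_def split: if_splits)
  qed (use assms(17) that in blast)
  then have "\<rho> s \<in> u4_center" if "s \<in> R" for s
    using that canonical_decomposition_center[OF \<rho>(1) S x \<rho>(2)[unfolded y_def] _ assms(7,8,6)] by metis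
  then have RZ: "R \<subseteq> Z"
    using assms(2) zassenhaus2_hom(1)[OF \<rho>(1) S] by (auto simp: Z_def)
  have Zs: "subgroup Z S" "closedin (tg_top S) Z"
    using preimage_closed_subgroup[OF \<rho>(1) S subgroup_u4_center] by (simp_all add: Z_def)
  have "g \<otimes>\<^bsub>S\<^esub> z \<otimes>\<^bsub>S\<^esub> inv\<^bsub>S\<^esub> g \<in> Z" if "g \<in> carrier S" "z \<in> Z" for g z
    using that u4_center_conjugate[of "\<rho> z" "\<rho> g"] by (simp add: Z_def \<rho>.hom_mult \<rho>.hom_inv del: U4_simps)
  then have Zn: "Z \<lhd> S" using Zs by (simp add: S.normal_inv_iff)
  then have NZ: "N \<subseteq> Z" using Zs RZ unfolding N_def closed_normal_subgroup_generated_def by blast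
  have Nn: "N \<lhd> S"
    unfolding N_def closed_normal_subgroup_generated_def
    using Zn Zs RZ by (intro normal_Inter[OF S.group_axioms]) auto
  have rN: "r \<in> N" using assms(3) by (auto simp: N_def closed_normal_subgroup_generated_def)
  \<comment> \<open>The trivial homomorphism shows that the family defining \<open>M\<close> is
    nonempty, so that \<open>M\<close> is an intersection of normal subgroups of \<Gamma>.\<close>
  have "group_hom \<Gamma> U4 (\<lambda>_. \<one>\<^bsub>U4\<^esub>)"
    using group_U4 \<Gamma>.group_axioms by (simp add: group_hom_def group_hom_axioms_def hom_def)
  moreover have "kernel \<Gamma> U4 (\<lambda>_. \<one>\<^bsub>U4\<^esub>) = carrier \<Gamma>" by (simp add: kernel_def)
  moreover have "openin (tg_top \<Gamma>) (carrier \<Gamma>)" by (metis openin_topspace top\<Gamma>)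
  ultimately have "carrier \<Gamma> \<in> p_power_open_normal 2 \<Gamma>" using kernel_in_p_power_open_normal by metis
  then have Mn: "M \<lhd> \<Gamma>"
    unfolding M_def by (intro normal_Inter[OF \<Gamma>.group_axioms]) (auto simp: p_power_open_normal_def)
  define L where "L = (\<lambda>g t. g \<in> carrier S \<and> t \<in> carrier \<Gamma> \<and> h (N #>\<^bsub>S\<^esub> g) = M #>\<^bsub>\<Gamma>\<^esub> t)"
  note corr = quotient_tgroup_corr[OF S.group_axioms group_tgroup(2)[OF S] Nn \<Gamma>.group_axioms top\<Gamma> Mn h L_def]
  have Lcar: "g \<in> carrier S" "t \<in> carrier \<Gamma>" if "L g t" for g t using that by (simp_all add: L_def)
  have Lex: "\<exists>t. L g t" if "g \<in> carrier S" for g using corr(2) that by (simp add: tgroup_corr_def)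
  \<comment> \<open>Relators go to the centre, so \<rho> modulo the centre depends only on the class
    modulo \<open>N\<close> and can be read on the Galois group.\<close>
  have "\<exists>f. (\<forall>g t. L g t \<longrightarrow> f t = u4_trunc (\<rho> g)) \<and>
    (\<forall>t\<in>carrier \<Gamma>. \<forall>t'\<in>carrier \<Gamma>. f (t \<otimes>\<^bsub>\<Gamma>\<^esub> t') = u4_trunc_mult (f t) (f t')) \<and>
    (\<forall>V. openin (tg_top \<Gamma>) {t \<in> carrier \<Gamma>. f t \<in> V})"
  proof (rule tgroup_corr_transfer[OF corr(1)])
    fix g t g' assume L: "L g t" "L g' t"
    obtain n where n: "n \<in> N" "g = n \<otimes>\<^bsub>S\<^esub> g'"
      by (rule same_coset_decompose[OF S.group_axioms Nn Lcar(1)[OF L(1)] Lcar(1)[OF L(2)] corr(3)[OF L]])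
    then have "n \<in> carrier S" "\<rho> n \<in> u4_center" using NZ by (auto simp: Z_def)
    then show "u4_trunc (\<rho> g) = u4_trunc (\<rho> g')"
      using n Lcar(1)[OF L(2)] u4_trunc_center by (simp add: \<rho>.hom_mult)
  next
    fix g g' assume "g \<in> carrier S" "g' \<in> carrier S"
    then show "u4_trunc (\<rho> (g \<otimes>\<^bsub>S\<^esub> g')) = u4_trunc_mult (u4_trunc (\<rho> g)) (u4_trunc (\<rho> g'))"
      by (simp add: \<rho>.hom_mult u4_trunc_mult)
  next
    fix V
    show "openin (tg_top S) {g \<in> carrier S. u4_trunc (\<rho> g) \<in> V}"
      using tgroup_hom_open[OF \<rho>(1) S, of "u4_trunc -` V"] by (simp only: vimage_eq)
  qed
  then obtain f where fL: "\<And>g t. L g t \<Longrightarrow> f t = u4_trunc (\<rho> g)"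
    and fhom: "\<And>t t'. t \<in> carrier \<Gamma> \<Longrightarrow> t' \<in> carrier \<Gamma> \<Longrightarrow> f (t \<otimes>\<^bsub>\<Gamma>\<^esub> t') = u4_trunc_mult (f t) (f t')"
    and fop: "\<And>V. openin (tg_top \<Gamma>) {t \<in> carrier \<Gamma>. f t \<in> V}"
    by blast
  have fx: "f t = (of_bool (l = k), of_bool (l = i), of_bool (l = j), 0, 0)" if "L (x l) t" for l t
    using fL[OF that] by (simp add: \<rho>(2) y_def u4_trunc_def)
  obtain tk ti tj where t: "L (x k) tk" "L (x i) ti" "L (x j) tj" using Lex[OF x] by metis
  have tc: "tk \<in> carrier \<Gamma>" "ti \<in> carrier \<Gamma>" "tj \<in> carrier \<Gamma>" using t Lcar by blast+
  have tf: "f tk = (1, 0, 0, 0, 0)" "f ti = (0, 1, 0, 0, 0)" "f tj = (0, 0, 1, 0, 0)"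
    using fx[OF t(1)] fx[OF t(2)] fx[OF t(3)] assms(4-8) by auto
  obtain \<Phi> where hom\<Phi>: "\<Phi> \<in> hom \<Gamma> U4" and op\<Phi>: "\<And>V. openin (tg_top \<Gamma>) {t \<in> carrier \<Gamma>. \<Phi> t \<in> V}"
    and sd\<Phi>: "\<And>t a b c d e. f t = (a, b, c, d, e) \<Longrightarrow> superdiag (\<Phi> t) = (a, b, c)"
    using galois_massey_lift[of F f, folded \<Gamma>_def, OF fhom fop tc(1) tf(1) tc(2) tf(2) tc(3) tf(3)] by blast
  interpret \<Phi>: group_hom \<Gamma> U4 \<Phi>
    using hom\<Phi> group_U4 \<Gamma>.group_axioms by (simp add: group_hom_def group_hom_axioms_def)
  have "kernel \<Gamma> U4 \<Phi> = {t \<in> carrier \<Gamma>. \<Phi> t \<in> {\<one>\<^bsub>U4\<^esub>}}" by (simp add: kernel_def)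
  then have "kernel \<Gamma> U4 \<Phi> \<in> p_power_open_normal 2 \<Gamma>"
    using op\<Phi>[of "{\<one>\<^bsub>U4\<^esub>}"] by (intro kernel_in_p_power_open_normal[OF \<Phi>.group_hom_axioms]) simp
  then have M\<Phi>: "M \<subseteq> kernel \<Gamma> U4 \<Phi>" by (auto simp: M_def)
  \<comment> \<open>The lift kills \<open>M\<close>, so it can be read back on \<open>S\<close>, now
    with full values in \<open>U4\<close>.\<close>
  have "\<exists>\<phi>. (\<forall>t g. L g t \<longrightarrow> \<phi> g = \<Phi> t) \<and>
    (\<forall>g\<in>carrier S. \<forall>g'\<in>carrier S. \<phi> (g \<otimes>\<^bsub>S\<^esub> g') = u4_mult (\<phi> g) (\<phi> g')) \<and>
    (\<forall>V. openin (tg_top S) {g \<in> carrier S. \<phi> g \<in> V})"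
  proof (rule tgroup_corr_transfer[OF corr(2)])
    fix t g t' assume L: "L g t" "L g t'"
    then have "M #>\<^bsub>\<Gamma>\<^esub> t = M #>\<^bsub>\<Gamma>\<^esub> t'" by (simp add: L_def)
    then obtain m where m: "m \<in> M" "t = m \<otimes>\<^bsub>\<Gamma>\<^esub> t'"
      by (rule same_coset_decompose[OF \<Gamma>.group_axioms Mn Lcar(2)[OF L(1)] Lcar(2)[OF L(2)]])
    then have "m \<in> carrier \<Gamma>" "\<Phi> m = \<one>\<^bsub>U4\<^esub>" using M\<Phi> by (auto simp: kernel_def)
    then show "\<Phi> t = \<Phi> t'"
      using m Lcar(2)[OF L(2)] U4.l_one[of "\<Phi> t'"] by (simp add: \<Phi>.hom_mult del: U4_simps(2,3))
  qed (use \<Phi>.hom_mult op\<Phi> in simp_all)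
  then obtain \<phi> where \<phi>L: "\<And>g t. L g t \<Longrightarrow> \<phi> g = \<Phi> t"
    and \<phi>hom: "\<And>g g'. g \<in> carrier S \<Longrightarrow> g' \<in> carrier S \<Longrightarrow> \<phi> (g \<otimes>\<^bsub>S\<^esub> g') = u4_mult (\<phi> g) (\<phi> g')"
    and \<phi>op: "\<And>V. openin (tg_top S) {g \<in> carrier S. \<phi> g \<in> V}"
    by blast
  have \<phi>: "\<phi> \<in> tgroup_hom S U4"
    using \<phi>hom \<phi>op by (simp add: tgroup_hom_def hom_def continuous_map_def group_tgroup(2)[OF S])
  interpret \<phi>: group_hom S U4 \<phi> by (rule tgroup_hom_group_hom[OF \<phi> S])
  have "superdiag (\<phi> (x l)) = (of_bool (l = k), of_bool (l = i), of_bool (l = j))" for l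
  proof -
    obtain t where t: "L (x l) t" using Lex[OF x] by blast
    then show ?thesis using sd\<Phi>[OF fx[OF t]] \<phi>L[OF t] by simp
  qed
  then have "\<phi> r \<noteq> \<one>\<^bsub>U4\<^esub>"
    using canonical_decomposition_nontrivial[OF \<phi> S x _ assms(9,7,8,6,10,11,12,13,14,15,16)] by blast
  \<comment> \<open>Since \<open>r\<close> lies in \<open>N\<close>, it has the class of the
    identity, so both are related to the same \<open>t\<close> and have the same image.\<close>
  moreover have "\<phi> r = \<one>\<^bsub>U4\<^esub>"
  proof -
    have rS: "r \<in> carrier S" using rN normal_imp_subgroup[OF Nn] by (rule_tac subgroup.mem_carrier)
    obtain t where t: "L r t" using Lex[OF rS] by blast
    have "N #>\<^bsub>S\<^esub> r = N #>\<^bsub>S\<^esub> \<one>\<^bsub>S\<^esub>"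
      using S.coset_join2[OF rS normal_imp_subgroup[OF Nn] rN]
        S.coset_join2[OF S.one_closed normal_imp_subgroup[OF Nn] subgroup.one_closed[OF normal_imp_subgroup[OF Nn]]] by simp
    then have "L \<one>\<^bsub>S\<^esub> t" using t by (simp add: L_def)
    then show ?thesis using \<phi>L[OF t] \<phi>L[of "\<one>\<^bsub>S\<^esub>" t] \<phi>.hom_one by simp
  qed
  ultimately show False ..
qed

end
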